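(* Let $\xi$ be a white noise in a real separable Hilbert space $H$, on a probability space $(\Omega,\mathcal{F},\mathbb{P})$ with $\mathcal{F}=\sigma(\xi)$, and let $\alpha\in L^2(\Omega,\mathcal{F},\mathbb{P})$. Let $u(\alpha)$ be the unique element of minimal $L^2(\Omega,\mathcal{F},\mathbb{P};H)$-norm in $$\mathcal{K}(\alpha)=\{u\in\mathrm{Dom}(I): Iu=\alpha-\mathbb{E}\alpha\}.$$ Then $$u(\alpha)=d\alpha .$$
   Context: $H$ is a real separable Hilbert space with scalar product $(\cdot,\cdot)$ and norm $|\cdot|$. A white noise $\xi$ in $H$ is a family $\{(\xi,h),h\in H\}$ of random variables such that each $(\xi,h)$ is Gaussian with mean $0$ and variance $|h|^2$ and $h\mapsto(\xi,h)$ is linear from $H$ to $L^2(\Omega,\mathcal{F},\mathbb{P})$. Itô–Wiener expansion: $H^{\otimes n}_s$ is the Hilbert space of symmetric $n$-linear Hilbert–Schmidt forms on $H$ with norm $\|A_n\|_n^2=\sum_{k_1,\dots,k_n}A_n(e_{k_1},\dots,e_{k_n})^2$, $(e_k)$ an orthonormal basis of $H$. For $A_n=\sum a_{k_1,\dots,k_n}e_{k_1}\otimes\dots\otimes e_{k_n}\in H_s^{\otimes n}$ put $A_n(\xi,\dots,\xi)=\sum_{j_1+j_2+\dots=n}b_{j_1,j_2,\dots}\prod_l H_{j_l}((\xi,e_l))$, where $b_{j_1,j_2,\dots}=\frac{n!}{j_1!j_2!\cdots}a_{1,\dots,1,2,\dots,2,\dots}$ (index $l$ repeated $j_l$ times)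 and $H_k(x)=(-1)^ke^{x^2/2}(d/dx)^ke^{-x^2/2}$. Then $\mathbb{E}A_n(\xi,\dots,\xi)^2=n!\|A_n\|_n^2$, polynomials of different degrees are orthogonal, and each $\alpha\in L^2(\Omega,\sigma(\xi),\mathbb{P})$ is uniquely $\alpha=\sum_{n\ge0}A_n(\xi,\dots,\xi)$ with $A_n\in H_s^{\otimes n}$. Stochastic derivative: $\alpha=\sum_nA_n(\xi,\dots,\xi)$ is stochastically differentiable if there is $D\alpha\in L^2(\Omega,\sigma(\xi),\mathbb{P};H)$ such that for every $h\in H$, $(D\alpha,h)=\sum_{n}nA_n(h,\xi,\dots,\xi)$ ($n-1$ copies of $\xi$). The extended stochastic integral is the adjoint operator $I=D^*$; it is a closed unbounded operator. The bounded operator $d:L^2(\Omega,\mathcal{F},\mathbb{P})\to L^2(\Omega,\mathcal{F},\mathbb{P};H)$ is defined, for $\alpha=\mathbb{E}\alpha+\sum_{n\ge1}A_n(\xi,\dots,\xi)$, by $d\alpha=\sum_{n\ge1}A_n(\cdot,\xi,\dots,\xi)$ ($n-1$ copies of $\xi$), i.e. $(d\alpha,h)=\sum_{n\ge1}A_n(h,\xi,\dots,\xi)$ for $h\in H$. The set $\mathcal{K}(\alpha)$ is a non-empty closed affine subspace of $L^2(\Omega,\mathcal{F},\mathbb{P};H)$, so $u(\alpha)=\mathrm{argmin}_{u\in\mathcal{K}(\alpha)}\mathbb{E}|u|^2$ is well defined and unique. The expression $\alpha=\mathbb{E}\alpha+I(u(\alpha))$ is called the minimal norm integral representation of $\alpha$.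 *)

theory Defs
  imports "HOL-Probability.Probability" "HOL-Library.Multiset"
begin

text \<open>Elements of the \<open>L\<^sup>2\<close> spaces are represented by functions; equality in \<open>L\<^sup>2\<close> is
  almost sure equality.\<close>

definition L2 :: "'w measure \<Rightarrow> ('w \<Rightarrow> 'b::{banach, second_countable_topology}) set" where
  "L2 M = {f \<in> borel_measurable M. integrable M (\<lambda>\<omega>. (norm (f \<omega>))\<^sup>2)}"

text \<open>Membership in \<open>L2 M\<close> is required explicitly because the Bochner integral of a
  non-integrable function is \<open>0\<close>.\<close>

definition L2_tendsto ::
  "'w measure \<Rightarrow> ('i \<Rightarrow> 'w \<Rightarrow> 'b::{banach, second_countable_topology}) \<Rightarrow> ('w \<Rightarrow> 'b) \<Rightarrow> 'i filter \<Rightarrow> bool"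
  where
  "L2_tendsto M X S F \<longleftrightarrow>
     S \<in> L2 M \<and> (\<forall>\<^sub>F i in F. X i \<in> L2 M) \<and>
     ((\<lambda>i. \<integral>\<omega>. (norm (X i \<omega> - S \<omega>))\<^sup>2 \<partial>M) \<longlongrightarrow> 0) F"

definition L2_Lim ::
  "'w measure \<Rightarrow> ('i \<Rightarrow> 'w \<Rightarrow> 'b::{banach, second_countable_topology}) \<Rightarrow> 'i filter \<Rightarrow> ('w \<Rightarrow> 'b)"
  where
  "L2_Lim M X F = (SOME S. L2_tendsto M X S F)"

definition centered_gaussian :: "'w measure \<Rightarrow> ('w \<Rightarrow> real) \<Rightarrow> real \<Rightarrow> bool" where
  "centered_gaussian M X v \<longleftrightarrow>
     X \<in> borel_measurable M \<and>
     (if v = 0 then (AE \<omega> in M. X \<omega> = 0)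
      else distributed M lborel X (\<lambda>x. ennreal (normal_density 0 (sqrt v) x)))"

text \<open>\<open>\<xi> h\<close> is the random variable \<open>(\<xi>, h)\<close>.\<close>

definition white_noise :: "'w measure \<Rightarrow> ('h::real_inner \<Rightarrow> 'w \<Rightarrow> real) \<Rightarrow> bool" where
  "white_noise M \<xi> \<longleftrightarrow>
     (\<forall>h. centered_gaussian M (\<xi> h) ((norm h)\<^sup>2)) \<and>
     (\<forall>a b h k. AE \<omega> in M. \<xi> (a *\<^sub>R h + b *\<^sub>R k) \<omega> = a * \<xi> h \<omega> + b * \<xi> k \<omega>)"

definition noise_sigma :: "'w measure \<Rightarrow> ('h \<Rightarrow> 'w \<Rightarrow> real) \<Rightarrow> 'w set set" where
  "noise_sigma M \<xi> = sigma_sets (space M) {\<xi> h -` B \<inter> space M | h B. B \<in> sets borel}"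

text \<open>The index set \<open>J\<close> is finite exactly when the space is finite-dimensional.\<close>

definition orthonormal_basis :: "nat set \<Rightarrow> (nat \<Rightarrow> 'h::real_inner) \<Rightarrow> bool" where
  "orthonormal_basis J e \<longleftrightarrow>
     (\<forall>i\<in>J. \<forall>j\<in>J. e i \<bullet> e j = (if i = j then 1 else 0)) \<and> closure (span (e ` J)) = UNIV"

text \<open>Probabilists' normalisation.\<close>

definition hermite :: "nat \<Rightarrow> real \<Rightarrow> real" where
  "hermite k x = (-1) ^ k * exp (x\<^sup>2 / 2) * (deriv ^^ k) (\<lambda>y. exp (- (y\<^sup>2) / 2)) x"

text \<open>An \<open>n\<close>-linear form is a function on lists, of which only the values at lists of length
  \<open>n\<close> matter. Boundedness is a separate requirement: square summability over a basis does not
  imply it for an arbitrary multilinear form.\<close>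

definition multilinear_form :: "nat \<Rightarrow> ('h::real_vector list \<Rightarrow> real) \<Rightarrow> bool" where
  "multilinear_form n A \<longleftrightarrow> (\<forall>xs i. length xs = n \<and> i < n \<longrightarrow> linear (\<lambda>x. A (xs[i := x])))"

definition bounded_form :: "nat \<Rightarrow> ('h::real_normed_vector list \<Rightarrow> real) \<Rightarrow> bool" where
  "bounded_form n A \<longleftrightarrow> (\<exists>C. \<forall>xs. length xs = n \<longrightarrow> \<bar>A xs\<bar> \<le> C * prod_list (map norm xs))"

definition symmetric_form :: "nat \<Rightarrow> ('h list \<Rightarrow> real) \<Rightarrow> bool" where
  "symmetric_form n A \<longleftrightarrow> (\<forall>xs ys. length xs = n \<and> mset xs = mset ys \<longrightarrow> A xs = A ys)"

definition sym_HS ::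
  "nat set \<Rightarrow> (nat \<Rightarrow> 'h::real_inner) \<Rightarrow> nat \<Rightarrow> ('h list \<Rightarrow> real) set" where
  "sym_HS J e n =
     {A. multilinear_form n A \<and> bounded_form n A \<and> symmetric_form n A \<and>
         (\<lambda>ks. (A (map e ks))\<^sup>2) summable_on {ks. length ks = n \<and> set ks \<subseteq> J}}"

text \<open>\<open>A(\<xi>, \<dots>, \<xi>)\<close>, with \<open>n\<close> arguments. The multiset \<open>m\<close> encodes \<open>(j\<^sub>l)\<close> through
  \<open>j\<^sub>l = count m l\<close>, and its sorted list is \<open>1, \<dots>, 1, 2, \<dots>, 2, \<dots>\<close> with \<open>l\<close> repeated \<open>j\<^sub>l\<close>
  times. As an \<open>L2_Lim\<close>, the value is determined up to null sets.\<close>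

definition wick_coeff ::
  "(nat \<Rightarrow> 'h) \<Rightarrow> ('h list \<Rightarrow> real) \<Rightarrow> nat multiset \<Rightarrow> real" where
  "wick_coeff e A m =
     fact (size m) / (\<Prod>l\<in>set_mset m. fact (count m l)) *
     A (map e (sorted_list_of_multiset m))"

definition wick ::
  "'w measure \<Rightarrow> ('h \<Rightarrow> 'w \<Rightarrow> real) \<Rightarrow> nat set \<Rightarrow> (nat \<Rightarrow> 'h) \<Rightarrow> nat \<Rightarrow> ('h list \<Rightarrow> real) \<Rightarrow> 'w \<Rightarrow> real"
  where
  "wick M \<xi> J e n A =
     L2_Lim M
       (\<lambda>F \<omega>. \<Sum>m\<in>F. wick_coeff e A m * (\<Prod>l\<in>set_mset m. hermite (count m l) (\<xi> (e l) \<omega>)))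
       (finite_subsets_at_top {m. size m = n \<and> set_mset m \<subseteq> J})"

definition ito_wiener ::
  "'w measure \<Rightarrow> ('h::real_inner \<Rightarrow> 'w \<Rightarrow> real) \<Rightarrow> nat set \<Rightarrow> (nat \<Rightarrow> 'h) \<Rightarrow>
   ('w \<Rightarrow> real) \<Rightarrow> (nat \<Rightarrow> 'h list \<Rightarrow> real) \<Rightarrow> bool" where
  "ito_wiener M \<xi> J e \<alpha> A \<longleftrightarrow>
     (\<forall>n. A n \<in> sym_HS J e n) \<and>
     L2_tendsto M (\<lambda>N \<omega>. \<Sum>n<N. wick M \<xi> J e n (A n) \<omega>) \<alpha> sequentially"

text \<open>\<open>stoch_deriv M \<xi> J e \<alpha> v\<close> is the graph of \<open>D\<close>. The form
  \<open>\<lambda>xs. A (Suc n) (h # xs)\<close> is \<open>A\<^sub>n\<^sub>+\<^sub>1(h, \<cdot>, \<dots>, \<cdot>)\<close>.\<close>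

definition stoch_deriv ::
  "'w measure \<Rightarrow> ('h::{real_inner, banach, second_countable_topology} \<Rightarrow> 'w \<Rightarrow> real) \<Rightarrow>
   nat set \<Rightarrow> (nat \<Rightarrow> 'h) \<Rightarrow> ('w \<Rightarrow> real) \<Rightarrow> ('w \<Rightarrow> 'h) \<Rightarrow> bool" where
  "stoch_deriv M \<xi> J e \<alpha> v \<longleftrightarrow>
     v \<in> L2 M \<and>
     (\<exists>A. ito_wiener M \<xi> J e \<alpha> A \<and>
       (\<forall>h. L2_tendsto M
              (\<lambda>N \<omega>. \<Sum>n<N. real (Suc n) * wick M \<xi> J e n (\<lambda>xs. A (Suc n) (h # xs)) \<omega>)
              (\<lambda>\<omega>. v \<omega> \<bullet> h) sequentially))"

text \<open>Graph and domain of the adjoint \<open>I = D\<^sup>*\<close>, and \<open>I\<close> itself (up to null sets).\<close>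

definition ext_integral_graph ::
  "'w measure \<Rightarrow> ('h::{real_inner, banach, second_countable_topology} \<Rightarrow> 'w \<Rightarrow> real) \<Rightarrow>
   nat set \<Rightarrow> (nat \<Rightarrow> 'h) \<Rightarrow> ('w \<Rightarrow> 'h) \<Rightarrow> ('w \<Rightarrow> real) \<Rightarrow> bool" where
  "ext_integral_graph M \<xi> J e u \<beta> \<longleftrightarrow>
     u \<in> L2 M \<and> \<beta> \<in> L2 M \<and>
     (\<forall>\<alpha> v. stoch_deriv M \<xi> J e \<alpha> v \<longrightarrow>
        (\<integral>\<omega>. v \<omega> \<bullet> u \<omega> \<partial>M) = (\<integral>\<omega>. \<alpha> \<omega> * \<beta> \<omega> \<partial>M))"

definition Dom_ext_integral ::
  "'w measure \<Rightarrow> ('h::{real_inner, banach, second_countable_topology} \<Rightarrow> 'w \<Rightarrow> real) \<Rightarrow>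
   nat set \<Rightarrow> (nat \<Rightarrow> 'h) \<Rightarrow> ('w \<Rightarrow> 'h) set" where
  "Dom_ext_integral M \<xi> J e = {u. \<exists>\<beta>. ext_integral_graph M \<xi> J e u \<beta>}"

definition ext_integral ::
  "'w measure \<Rightarrow> ('h::{real_inner, banach, second_countable_topology} \<Rightarrow> 'w \<Rightarrow> real) \<Rightarrow>
   nat set \<Rightarrow> (nat \<Rightarrow> 'h) \<Rightarrow> ('w \<Rightarrow> 'h) \<Rightarrow> ('w \<Rightarrow> real)" where
  "ext_integral M \<xi> J e u = (SOME \<beta>. ext_integral_graph M \<xi> J e u \<beta>)"

definition integrands ::
  "'w measure \<Rightarrow> ('h::{real_inner, banach, second_countable_topology} \<Rightarrow> 'w \<Rightarrow> real) \<Rightarrow>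
   nat set \<Rightarrow> (nat \<Rightarrow> 'h) \<Rightarrow> ('w \<Rightarrow> real) \<Rightarrow> ('w \<Rightarrow> 'h) set" where
  "integrands M \<xi> J e \<alpha> =
     {u \<in> Dom_ext_integral M \<xi> J e.
        AE \<omega> in M. ext_integral M \<xi> J e u \<omega> = \<alpha> \<omega> - (\<integral>\<omega>'. \<alpha> \<omega>' \<partial>M)}"

definition d_op ::
  "'w measure \<Rightarrow> ('h::{real_inner, banach, second_countable_topology} \<Rightarrow> 'w \<Rightarrow> real) \<Rightarrow>
   nat set \<Rightarrow> (nat \<Rightarrow> 'h) \<Rightarrow> ('w \<Rightarrow> real) \<Rightarrow> ('w \<Rightarrow> 'h)" where
  "d_op M \<xi> J e \<alpha> =
     (SOME v. v \<in> L2 M \<and>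
       (\<exists>A. ito_wiener M \<xi> J e \<alpha> A \<and>
         (\<forall>h. L2_tendsto M
                (\<lambda>N \<omega>. \<Sum>n<N. wick M \<xi> J e n (\<lambda>xs. A (Suc n) (h # xs)) \<omega>)
                (\<lambda>\<omega>. v \<omega> \<bullet> h) sequentially)))"

end

theory Submission
  imports Defs "HOL-Computational_Algebra.Polynomial"
begin

text \<open>Everything is reduced to coordinates in the orthogonal basis of Wick monomials
\<open>\<Phi>\<^sub>m = \<Prod>\<^sub>l H\<^sub>m\<^sub>(\<^sub>l\<^sub>)((\<xi>, e\<^sub>l))\<close>, where \<open>m\<close> runs through the finite multisets over \<open>J\<close>.
In these coordinates the derivative \<open>D\<close> and the operator \<open>d\<close> become index shifts,
\<open>\<langle>(D\<alpha>, e\<^sub>k), \<Phi>\<^sub>m\<rangle> = \<langle>\<alpha>, \<Phi>\<^sub>m\<^sub>+\<^sub>k\<rangle>\<close> and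
\<open>\<langle>(d\<alpha>, e\<^sub>k), \<Phi>\<^sub>m\<rangle> = \<langle>\<alpha>, \<Phi>\<^sub>m\<^sub>+\<^sub>k\<rangle> / (|m| + 1)\<close>.
Two facts follow.

First, \<open>d\<alpha>\<close> is itself a stochastic derivative: dividing the part of degree \<open>n\<close> of \<open>\<alpha>\<close> by \<open>n\<close>,
for every \<open>n \<ge> 1\<close>, gives a square integrable \<open>g\<close> with \<open>Dg = d\<alpha>\<close>
(\<open>divided_derivative_is_stoch_deriv\<close>).
Secondly, \<open>d\<alpha>\<close> is an admissible integrand, that is,
\<open>\<langle>D\<gamma>, d\<alpha>\<rangle> = \<langle>\<gamma>, \<alpha> - E\<alpha>\<rangle>\<close> for every \<open>\<gamma>\<close> in the domain of \<open>D\<close>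
(\<open>divided_derivative_adjoint\<close>).

Now let \<open>u\<close> be any integrand of \<open>\<alpha>\<close>. Pairing both \<open>u\<close> and \<open>d\<alpha>\<close> with \<open>Dg = d\<alpha>\<close> gives
\<open>\<langle>d\<alpha>, u\<rangle> = \<langle>g, \<alpha> - E\<alpha>\<rangle> = \<langle>d\<alpha>, d\<alpha>\<rangle>\<close>, hence \<open>|u|\<^sup>2 = |d\<alpha>|\<^sup>2 + |u - d\<alpha>|\<^sup>2\<close>
(\<open>integrands_norm\<close>): \<open>d\<alpha>\<close> is the minimiser, and the only one.

Most of the text supplies the chaos decomposition behind the coordinates. Orthogonality of the
\<open>\<Phi>\<^sub>m\<close> comes from the independence of the variables \<open>(\<xi>, e\<^sub>l)\<close>, and completeness from
the approximation of \<open>exp(i(\<xi>, h))\<close> by polynomials; both rest on \<open>fourier_uniqueness\<close>, which replaces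
exponentials \<open>exp(isY)\<close> under an integral by indicators of \<open>Y\<close>, one variable at a time.
The symmetric forms \<open>A\<^sub>n\<close> of \<open>\<alpha>\<close> are obtained by iterating \<open>d\<close>: on the degree \<open>n\<close> it acts as
\<open>D/n\<close>, so \<open>n\<close> applications produce \<open>D\<^sup>n/n!\<close>, and \<open>A\<^sub>n(h\<^sub>1, \<dots>, h\<^sub>n)\<close> is the mean of
\<open>d\<alpha>\<close> contracted with \<open>h\<^sub>1\<close>, differentiated again and contracted with \<open>h\<^sub>2\<close>, and so on.\<close>

section \<open>Square integrable functions\<close>

definition L2_inner :: "'w measure \<Rightarrow> ('w \<Rightarrow> 'b) \<Rightarrow> ('w \<Rightarrow> 'b::{real_inner, banach, second_countable_topology}) \<Rightarrow> real" where
  "L2_inner M f g = (\<integral>\<omega>. f \<omega> \<bullet> g \<omega> \<partial>M)"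

definition L2_norm :: "'w measure \<Rightarrow> ('w \<Rightarrow> 'b::{real_inner, banach, second_countable_topology}) \<Rightarrow> real" where
  "L2_norm M f = sqrt (L2_inner M f f)"

lemma L2_measurable [measurable_dest]: "f \<in> L2 M \<Longrightarrow> f \<in> borel_measurable M"
  by (simp add: L2_def)

lemma L2_inner_integrable:
  fixes f g :: "'w \<Rightarrow> 'b::{real_inner, banach, second_countable_topology}"
  assumes "f \<in> L2 M" "g \<in> L2 M"
  shows "integrable M (\<lambda>\<omega>. f \<omega> \<bullet> g \<omega>)"
proof (rule Bochner_Integration.integrable_bound)
  show "integrable M (\<lambda>\<omega>. (norm (f \<omega>))\<^sup>2 + (norm (g \<omega>))\<^sup>2)"
    using assms by (auto simp: L2_def)
  show "(\<lambda>\<omega>. f \<omega> \<bullet> g \<omega>) \<in> borel_measurable M"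
    using assms[THEN L2_measurable] by measurable
  have "\<bar>f \<omega> \<bullet> g \<omega>\<bar> \<le> (norm (f \<omega>))\<^sup>2 + (norm (g \<omega>))\<^sup>2" for \<omega>
  proof -
    have "\<bar>f \<omega> \<bullet> g \<omega>\<bar> \<le> norm (f \<omega>) * norm (g \<omega>)" by (rule Cauchy_Schwarz_ineq2)
    also have "\<dots> \<le> (norm (f \<omega>))\<^sup>2 + (norm (g \<omega>))\<^sup>2"
      using sum_squares_bound[of "norm (f \<omega>)" "norm (g \<omega>)"]
        mult_nonneg_nonneg[OF norm_ge_zero[of "f \<omega>"] norm_ge_zero[of "g \<omega>"]] by linarith
    finally show ?thesis .
  qed
  then show "AE \<omega> in M. norm (f \<omega> \<bullet> g \<omega>) \<le> norm ((norm (f \<omega>))\<^sup>2 + (norm (g \<omega>))\<^sup>2)"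
    by auto
qed

lemma L2_zero [simp]: "(\<lambda>_. 0) \<in> L2 M"
  by (simp add: L2_def)

lemma L2_add:
  fixes f g :: "'w \<Rightarrow> 'b::{real_inner, banach, second_countable_topology}"
  assumes "f \<in> L2 M" "g \<in> L2 M"
  shows "(\<lambda>\<omega>. f \<omega> + g \<omega>) \<in> L2 M"
proof -
  have "(\<lambda>\<omega>. (norm (f \<omega> + g \<omega>))\<^sup>2)
      = (\<lambda>\<omega>. (norm (f \<omega>))\<^sup>2 + 2 * (f \<omega> \<bullet> g \<omega>) + (norm (g \<omega>))\<^sup>2)"
    by (auto simp: power2_norm_eq_inner inner_add_left inner_add_right inner_commute)
  then show ?thesis
    using assms L2_inner_integrable[OF assms] by (auto simp: L2_def)
qed

lemma L2_scaleR: "f \<in> L2 M \<Longrightarrow> (\<lambda>\<omega>. c *\<^sub>R f \<omega>) \<in> L2 M"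
  by (auto simp: L2_def power_mult_distrib)

lemma L2_mult: "f \<in> L2 M \<Longrightarrow> (\<lambda>\<omega>. c * f \<omega>) \<in> L2 M" for f :: "'w \<Rightarrow> real"
  using L2_scaleR[of f M c] by simp

lemma L2_diff:
  fixes f g :: "'w \<Rightarrow> 'b::{real_inner, banach, second_countable_topology}"
  assumes "f \<in> L2 M" "g \<in> L2 M"
  shows "(\<lambda>\<omega>. f \<omega> - g \<omega>) \<in> L2 M"
  using L2_add[OF assms(1) L2_scaleR[OF assms(2), of "-1"]] by simp

lemma L2_sum:
  fixes f :: "'i \<Rightarrow> 'w \<Rightarrow> 'b::{real_inner, banach, second_countable_topology}"
  assumes "\<And>i. i \<in> I \<Longrightarrow> f i \<in> L2 M"
  shows "(\<lambda>\<omega>. \<Sum>i\<in>I. f i \<omega>) \<in> L2 M"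
  using assms by (induction I rule: infinite_finite_induct) (auto intro: L2_add)

lemma (in prob_space) L2_const: "(\<lambda>_. c) \<in> L2 M"
  by (simp add: L2_def)

lemma L2_inner_vec:
  fixes f :: "'w \<Rightarrow> 'b::{real_inner, banach, second_countable_topology}"
  assumes "f \<in> L2 M" shows "(\<lambda>\<omega>. f \<omega> \<bullet> h) \<in> L2 M"
proof -
  have "integrable M (\<lambda>\<omega>. (f \<omega> \<bullet> h)\<^sup>2)"
  proof (rule Bochner_Integration.integrable_bound)
    show "integrable M (\<lambda>\<omega>. (norm (f \<omega>))\<^sup>2 * (norm h)\<^sup>2)"
      using assms by (auto simp: L2_def)
    show "(\<lambda>\<omega>. (f \<omega> \<bullet> h)\<^sup>2) \<in> borel_measurable M"
      using L2_measurable[OF assms] by measurable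
    show "AE \<omega> in M. norm ((f \<omega> \<bullet> h)\<^sup>2) \<le> norm ((norm (f \<omega>))\<^sup>2 * (norm h)\<^sup>2)"
      using Cauchy_Schwarz_ineq[of "f _" h]
      by (auto simp: power2_norm_eq_inner abs_mult)
  qed
  then show ?thesis using L2_measurable[OF assms] by (auto simp: L2_def)
qed

lemma L2_scaleR_vec:
  fixes g :: "'w \<Rightarrow> real" and h :: "'b::{real_inner, banach, second_countable_topology}"
  assumes "g \<in> L2 M" shows "(\<lambda>\<omega>. g \<omega> *\<^sub>R h) \<in> L2 M"
  using assms by (auto simp: L2_def power_mult_distrib)

lemma L2_inner_commute: "L2_inner M f g = L2_inner M g f"
  by (simp add: L2_inner_def inner_commute)

lemma L2_inner_add_left:
  assumes "f \<in> L2 M" "f' \<in> L2 M" "g \<in> L2 M"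
  shows "L2_inner M (\<lambda>\<omega>. f \<omega> + f' \<omega>) g = L2_inner M f g + L2_inner M f' g"
  using assms by (simp add: L2_inner_def inner_add_left L2_inner_integrable)

lemma L2_inner_diff_left:
  assumes "f \<in> L2 M" "f' \<in> L2 M" "g \<in> L2 M"
  shows "L2_inner M (\<lambda>\<omega>. f \<omega> - f' \<omega>) g = L2_inner M f g - L2_inner M f' g"
  using assms by (simp add: L2_inner_def inner_diff_left L2_inner_integrable)

lemma L2_inner_scaleR_left: "L2_inner M (\<lambda>\<omega>. c *\<^sub>R f \<omega>) g = c * L2_inner M f g"
  by (simp add: L2_inner_def)

lemma L2_inner_mult_left: "L2_inner M (\<lambda>\<omega>. c * f \<omega>) g = c * L2_inner M f g" for f :: "'w \<Rightarrow> real"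
  using L2_inner_scaleR_left[of M c f g] by simp

lemma L2_inner_scaleR_right: "L2_inner M f (\<lambda>\<omega>. c *\<^sub>R g \<omega>) = c * L2_inner M f g"
  by (simp add: L2_inner_def)

lemma L2_inner_sum_left:
  assumes "\<And>i. i \<in> I \<Longrightarrow> f i \<in> L2 M" "g \<in> L2 M"
  shows "L2_inner M (\<lambda>\<omega>. \<Sum>i\<in>I. f i \<omega>) g = (\<Sum>i\<in>I. L2_inner M (f i) g)"
  using assms by (simp add: L2_inner_def inner_sum_left L2_inner_integrable)

lemma L2_inner_sum_right:
  assumes "\<And>i. i \<in> I \<Longrightarrow> f i \<in> L2 M" "g \<in> L2 M"
  shows "L2_inner M g (\<lambda>\<omega>. \<Sum>i\<in>I. f i \<omega>) = (\<Sum>i\<in>I. L2_inner M g (f i))"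
  using L2_inner_sum_left[OF assms] by (simp add: L2_inner_commute)

lemma L2_inner_vec_scaleR: "L2_inner M (\<lambda>\<omega>. v \<omega> \<bullet> h) g = L2_inner M v (\<lambda>\<omega>. g \<omega> *\<^sub>R h)"
  by (simp add: L2_inner_def mult.commute)

lemma L2_inner_cong_AE:
  assumes "f \<in> L2 M" "f' \<in> L2 M" "g \<in> L2 M" "AE \<omega> in M. f \<omega> = f' \<omega>"
  shows "L2_inner M f g = L2_inner M f' g"
  unfolding L2_inner_def
proof (rule integral_cong_AE)
  show "AE \<omega> in M. f \<omega> \<bullet> g \<omega> = f' \<omega> \<bullet> g \<omega>" using assms(4) by auto
qed (use assms(1-3)[THEN L2_measurable] in measurable)

lemma L2_inner_self: "L2_inner M f f = (\<integral>\<omega>. (norm (f \<omega>))\<^sup>2 \<partial>M)"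
  by (simp add: L2_inner_def power2_norm_eq_inner)

lemma L2_inner_self_nonneg [simp]: "0 \<le> L2_inner M f f"
  by (simp add: L2_inner_self)

lemma L2_norm_nonneg [simp]: "0 \<le> L2_norm M f"
  by (simp add: L2_norm_def)

lemma L2_norm_power2: "(L2_norm M f)\<^sup>2 = L2_inner M f f"
  by (simp add: L2_norm_def)

lemma L2_norm_scaleR: "L2_norm M (\<lambda>\<omega>. c *\<^sub>R f \<omega>) = \<bar>c\<bar> * L2_norm M f"
  by (simp add: L2_norm_def L2_inner_scaleR_left L2_inner_scaleR_right real_sqrt_mult
      flip: mult.assoc)

lemma L2_norm_minus_commute: "L2_norm M (\<lambda>\<omega>. f \<omega> - g \<omega>) = L2_norm M (\<lambda>\<omega>. g \<omega> - f \<omega>)"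
  by (simp add: L2_norm_def L2_inner_self norm_minus_commute)

lemma L2_inner_self_eq_0:
  assumes "f \<in> L2 M" "L2_inner M f f = 0"
  shows "AE \<omega> in M. f \<omega> = 0"
  using assms integral_nonneg_eq_0_iff_AE[of M "\<lambda>\<omega>. (norm (f \<omega>))\<^sup>2"]
  by (auto simp: L2_def L2_inner_self)

lemma L2_inner_self_scaled_add:
  assumes "f \<in> L2 M" "g \<in> L2 M"
  shows "L2_inner M (\<lambda>\<omega>. f \<omega> + t *\<^sub>R g \<omega>) (\<lambda>\<omega>. f \<omega> + t *\<^sub>R g \<omega>)
       = L2_inner M f f + 2 * t * L2_inner M f g + t\<^sup>2 * L2_inner M g g"
proof -
  have "(f \<omega> + t *\<^sub>R g \<omega>) \<bullet> (f \<omega> + t *\<^sub>R g \<omega>)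
      = f \<omega> \<bullet> f \<omega> + 2 * t * (f \<omega> \<bullet> g \<omega>) + t\<^sup>2 * (g \<omega> \<bullet> g \<omega>)" for \<omega>
    by (simp add: inner_add_left inner_add_right inner_commute power2_eq_square)
  then show ?thesis
    using assms by (simp add: L2_inner_def L2_inner_integrable)
qed

lemma L2_Cauchy_Schwarz:
  assumes f: "f \<in> L2 M" and g: "g \<in> L2 M"
  shows "\<bar>L2_inner M f g\<bar> \<le> L2_norm M f * L2_norm M g"
proof -
  let ?a = "L2_inner M f f" and ?b = "L2_inner M f g" and ?c = "L2_inner M g g"
  have pos: "0 \<le> ?a + 2 * t * ?b + t\<^sup>2 * ?c" for t
    using L2_inner_self_nonneg[of M "\<lambda>\<omega>. f \<omega> + t *\<^sub>R g \<omega>"]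
    by (simp only: L2_inner_self_scaled_add[OF f g])
  have "?b\<^sup>2 \<le> ?a * ?c"
  proof (cases "?c = 0")
    case True
    \<comment> \<open>If \<open>?b \<noteq> 0\<close>, this value of \<open>t\<close> makes the quadratic equal to \<open>-1\<close>.\<close>
    have "?b = 0"
      using pos[of "- (?a + 1) / (2 * ?b)"] True by (cases "?b = 0") (auto simp: field_simps)
    then show ?thesis by simp
  next
    case False
    then have c: "?c > 0" using L2_inner_self_nonneg[of M g] by linarith
    \<comment> \<open>The minimum of the quadratic, attained at \<open>t = -b/c\<close>.\<close>
    have "0 \<le> ?a - ?b\<^sup>2 / ?c"
      using pos[of "- ?b / ?c"] c by (simp add: power2_eq_square field_simps)
    then show ?thesis using c by (simp add: field_simps)
  qed
  then have "sqrt (?b\<^sup>2) \<le> sqrt (?a * ?c)" by (rule real_sqrt_le_mono)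
  then show ?thesis by (simp add: L2_norm_def real_sqrt_mult)
qed

lemma L2_norm_triangle:
  assumes f: "f \<in> L2 M" and g: "g \<in> L2 M"
  shows "L2_norm M (\<lambda>\<omega>. f \<omega> + g \<omega>) \<le> L2_norm M f + L2_norm M g"
proof -
  have "(L2_norm M (\<lambda>\<omega>. f \<omega> + g \<omega>))\<^sup>2 = L2_inner M f f + 2 * L2_inner M f g + L2_inner M g g"
    using L2_inner_self_scaled_add[OF f g, of 1] by (simp add: L2_norm_power2)
  also have "\<dots> \<le> (L2_norm M f + L2_norm M g)\<^sup>2"
    using L2_Cauchy_Schwarz[OF f g] by (simp add: power2_sum L2_norm_power2)
  finally show ?thesis by (rule power2_le_imp_le) simp
qed

lemma L2_norm_triangle_diff:
  assumes "f \<in> L2 M" "g \<in> L2 M" "k \<in> L2 M"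
  shows "L2_norm M (\<lambda>\<omega>. f \<omega> - k \<omega>)
    \<le> L2_norm M (\<lambda>\<omega>. f \<omega> - g \<omega>) + L2_norm M (\<lambda>\<omega>. g \<omega> - k \<omega>)"
  using L2_norm_triangle[OF L2_diff[OF assms(1,2)] L2_diff[OF assms(2,3)]] by simp

lemma L2_tendsto_iff_norm:
  fixes S :: "'w \<Rightarrow> 'b::{real_inner, banach, second_countable_topology}"
  shows "L2_tendsto M X S F \<longleftrightarrow> S \<in> L2 M \<and> (\<forall>\<^sub>F i in F. X i \<in> L2 M) \<and>
     ((\<lambda>i. L2_norm M (\<lambda>\<omega>. X i \<omega> - S \<omega>)) \<longlongrightarrow> 0) F"
proof -
  have "((\<lambda>i. \<integral>\<omega>. (norm (X i \<omega> - S \<omega>))\<^sup>2 \<partial>M) \<longlongrightarrow> 0) F \<longleftrightarrow>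
     ((\<lambda>i. L2_norm M (\<lambda>\<omega>. X i \<omega> - S \<omega>)) \<longlongrightarrow> 0) F" (is "?l \<longleftrightarrow> ?r")
  proof
    assume ?l then show ?r
      using tendsto_real_sqrt[of "\<lambda>i. \<integral>\<omega>. (norm (X i \<omega> - S \<omega>))\<^sup>2 \<partial>M" 0 F]
      by (simp add: L2_norm_def L2_inner_self)
  next
    assume ?r then show ?l
      using tendsto_power[of "\<lambda>i. L2_norm M (\<lambda>\<omega>. X i \<omega> - S \<omega>)" 0 F 2]
      by (simp add: L2_norm_power2 L2_inner_self)
  qed
  then show ?thesis by (simp add: L2_tendsto_def)
qed

lemma L2_tendsto_inner:
  fixes S :: "'w \<Rightarrow> 'b::{real_inner, banach, second_countable_topology}"
  assumes lim: "L2_tendsto M X S F" and g: "g \<in> L2 M"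
  shows "((\<lambda>i. L2_inner M (X i) g) \<longlongrightarrow> L2_inner M S g) F"
proof (rule LIM_zero_cancel)
  have S: "S \<in> L2 M" and X: "\<forall>\<^sub>F i in F. X i \<in> L2 M"
    and l: "((\<lambda>i. L2_norm M (\<lambda>\<omega>. X i \<omega> - S \<omega>)) \<longlongrightarrow> 0) F"
    using lim by (auto simp: L2_tendsto_iff_norm)
  show "((\<lambda>i. L2_inner M (X i) g - L2_inner M S g) \<longlongrightarrow> 0) F"
  proof (rule Lim_null_comparison)
    show "\<forall>\<^sub>F i in F. norm (L2_inner M (X i) g - L2_inner M S g)
        \<le> L2_norm M (\<lambda>\<omega>. X i \<omega> - S \<omega>) * L2_norm M g"
      using X
    proof eventually_elim
      case (elim i)
      then show ?case
        using L2_Cauchy_Schwarz[OF L2_diff[OF elim S] g] L2_inner_diff_left[OF elim S g] by simp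
    qed
    show "((\<lambda>i. L2_norm M (\<lambda>\<omega>. X i \<omega> - S \<omega>) * L2_norm M g) \<longlongrightarrow> 0) F"
      using tendsto_mult_right[OF l, of "L2_norm M g"] by simp
  qed
qed

lemma L2_tendsto_norm:
  fixes S :: "'w \<Rightarrow> 'b::{real_inner, banach, second_countable_topology}"
  assumes lim: "L2_tendsto M X S F"
  shows "((\<lambda>i. L2_norm M (X i)) \<longlongrightarrow> L2_norm M S) F"
proof (rule LIM_zero_cancel)
  have S: "S \<in> L2 M" and X: "\<forall>\<^sub>F i in F. X i \<in> L2 M"
    and l: "((\<lambda>i. L2_norm M (\<lambda>\<omega>. X i \<omega> - S \<omega>)) \<longlongrightarrow> 0) F"
    using lim by (auto simp: L2_tendsto_iff_norm)
  show "((\<lambda>i. L2_norm M (X i) - L2_norm M S) \<longlongrightarrow> 0) F"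
  proof (rule Lim_null_comparison[OF _ l])
    show "\<forall>\<^sub>F i in F. norm (L2_norm M (X i) - L2_norm M S) \<le> L2_norm M (\<lambda>\<omega>. X i \<omega> - S \<omega>)"
      using X
    proof eventually_elim
      case (elim i)
      show ?case
        using L2_norm_triangle[OF L2_diff[OF elim S] S] L2_norm_triangle[OF L2_diff[OF S elim] elim]
          L2_norm_minus_commute[of M S "X i"] by simp
    qed
  qed
qed

lemma L2_norm_cong_AE:
  assumes "f \<in> L2 M" "g \<in> L2 M" "AE \<omega> in M. f \<omega> = g \<omega>"
  shows "L2_norm M f = L2_norm M g"
  using L2_inner_cong_AE[OF assms(1,2,1,3)] L2_inner_cong_AE[OF assms(1,2,2,3)]
  by (simp add: L2_norm_def L2_inner_commute)

lemma (in prob_space) integral_norm_le_L2_norm: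
  fixes f :: "'a \<Rightarrow> 'b::{real_inner, banach, second_countable_topology}"
  assumes "f \<in> L2 M"
  shows "integrable M (\<lambda>\<omega>. norm (f \<omega>))" "(\<integral>\<omega>. norm (f \<omega>) \<partial>M) \<le> L2_norm M f"
proof -
  have n: "(\<lambda>\<omega>. norm (f \<omega>)) \<in> L2 M" using assms by (auto simp: L2_def intro: borel_measurable_norm)
  show "integrable M (\<lambda>\<omega>. norm (f \<omega>))"
    using L2_inner_integrable[OF n L2_const[of 1]] by simp
  show "(\<integral>\<omega>. norm (f \<omega>) \<partial>M) \<le> L2_norm M f"
    using L2_Cauchy_Schwarz[OF n L2_const[of 1]]
    by (simp add: L2_inner_def L2_norm_def prob_space power2_norm_eq_inner flip: power2_eq_square)
qed

text \<open>Completeness of \<open>L\<^sup>2\<close> for sequences that are Cauchy at a geometric rate: the increments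
are then summable in \<open>L\<^sup>1\<close>, which forces convergence almost everywhere, and Fatou's lemma turns
this into convergence in \<open>L\<^sup>2\<close>. The orthogonal series below only need this case.\<close>

lemma (in prob_space) L2_complete_fast:
  fixes X :: "nat \<Rightarrow> 'a \<Rightarrow> 'b::{real_inner, banach, second_countable_topology}"
  assumes X: "\<And>n. X n \<in> L2 M"
    and fast: "\<And>n m. n \<le> m \<Longrightarrow> L2_norm M (\<lambda>\<omega>. X m \<omega> - X n \<omega>) \<le> (1/2)^n"
  shows "\<exists>S. L2_tendsto M X S sequentially"
proof -
  have [measurable]: "X n \<in> borel_measurable M" for n using X by (rule L2_measurable)
  define D where "D n \<omega> = norm (X (Suc n) \<omega> - X n \<omega>)" for n \<omega>
  have [measurable]: "D n \<in> borel_measurable M" for n unfolding D_def by measurable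
  have D: "(\<integral>\<^sup>+\<omega>. ennreal (D n \<omega>) \<partial>M) \<le> ennreal ((1/2)^n)" for n
    using integral_norm_le_L2_norm[OF L2_diff[OF X[of "Suc n"] X[of n]]] fast[of n "Suc n"]
    unfolding D_def by (subst nn_integral_eq_integral) (auto intro!: ennreal_leI)
  have "(\<integral>\<^sup>+\<omega>. (\<Sum>n. ennreal (D n \<omega>)) \<partial>M) = (\<Sum>n. \<integral>\<^sup>+\<omega>. ennreal (D n \<omega>) \<partial>M)"
    by (rule nn_integral_suminf) simp
  also have "\<dots> \<le> (\<Sum>n. ennreal ((1/2)^n))"
    by (intro suminf_le) (auto simp: D)
  also have "\<dots> = ennreal (\<Sum>n. (1/2)^n)"
    by (rule suminf_ennreal2) auto
  also have "\<dots> < \<infinity>" by simp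
  finally have "(\<integral>\<^sup>+\<omega>. (\<Sum>n. ennreal (D n \<omega>)) \<partial>M) \<noteq> \<infinity>" by simp
  then have "AE \<omega> in M. (\<Sum>n. ennreal (D n \<omega>)) \<noteq> \<infinity>"
    by (intro nn_integral_noteq_infinite) auto
  then have "AE \<omega> in M. summable (\<lambda>n. D n \<omega>)"
  proof eventually_elim
    case (elim \<omega>)
    show ?case
      by (rule summable_suminf_not_top) (use elim in \<open>auto simp: D_def\<close>)
  qed
  then have conv: "AE \<omega> in M. convergent (\<lambda>n. X n \<omega>)"
  proof eventually_elim
    case (elim \<omega>)
    have "summable (\<lambda>n. X (Suc n) \<omega> - X n \<omega>)"
      by (rule summable_norm_cancel) (use elim in \<open>simp add: D_def\<close>)
    then have "convergent (\<lambda>n. \<Sum>k<n. X (Suc k) \<omega> - X k \<omega>)"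
      by (simp add: summable_iff_convergent)
    then have "convergent (\<lambda>n. X n \<omega> - X 0 \<omega>)"
      by (simp only: sum_lessThan_telescope[of "\<lambda>k. X k \<omega>"])
    then show ?case
      using convergent_add[OF _ convergent_const[of "X 0 \<omega>"]] by fastforce
  qed
  define S where "S \<omega> = lim (\<lambda>n. X n \<omega>)" for \<omega>
  have [measurable]: "S \<in> borel_measurable M" unfolding S_def by measurable
  have lim: "AE \<omega> in M. (\<lambda>n. X n \<omega>) \<longlonglongrightarrow> S \<omega>"
    using conv by eventually_elim (simp add: S_def convergent_LIMSEQ_iff)
  have fatou: "(\<integral>\<^sup>+\<omega>. ennreal ((norm (X n \<omega> - S \<omega>))\<^sup>2) \<partial>M) \<le> ennreal (((1/2)^n)\<^sup>2)" for n
  proof -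
    have "(\<integral>\<^sup>+\<omega>. ennreal ((norm (X n \<omega> - S \<omega>))\<^sup>2) \<partial>M)
        = (\<integral>\<^sup>+\<omega>. liminf (\<lambda>m. ennreal ((norm (X n \<omega> - X m \<omega>))\<^sup>2)) \<partial>M)"
    proof (rule nn_integral_cong_AE)
      show "AE \<omega> in M. ennreal ((norm (X n \<omega> - S \<omega>))\<^sup>2)
          = liminf (\<lambda>m. ennreal ((norm (X n \<omega> - X m \<omega>))\<^sup>2))"
        using lim
      proof eventually_elim
        case (elim \<omega>)
        have "(\<lambda>m. ennreal ((norm (X n \<omega> - X m \<omega>))\<^sup>2)) \<longlonglongrightarrow> ennreal ((norm (X n \<omega> - S \<omega>))\<^sup>2)"
          by (intro tendsto_intros elim)
        then show ?case by (rule lim_imp_Liminf[OF sequentially_bot, symmetric])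
      qed
    qed
    also have "\<dots> \<le> liminf (\<lambda>m. \<integral>\<^sup>+\<omega>. ennreal ((norm (X n \<omega> - X m \<omega>))\<^sup>2) \<partial>M)"
      by (rule nn_integral_liminf) simp
    also have "\<dots> \<le> ennreal (((1/2)^n)\<^sup>2)"
    proof (rule Liminf_le)
      show "\<forall>\<^sub>F m in sequentially. (\<integral>\<^sup>+\<omega>. ennreal ((norm (X n \<omega> - X m \<omega>))\<^sup>2) \<partial>M)
          \<le> ennreal (((1/2)^n)\<^sup>2)"
        using eventually_ge_at_top[of n]
      proof eventually_elim
        case (elim m)
        have "(\<integral>\<^sup>+\<omega>. ennreal ((norm (X n \<omega> - X m \<omega>))\<^sup>2) \<partial>M)
            = ennreal ((L2_norm M (\<lambda>\<omega>. X m \<omega> - X n \<omega>))\<^sup>2)"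
          using L2_diff[OF X[of n] X[of m]]
          by (subst nn_integral_eq_integral) (auto simp: L2_def L2_norm_power2 L2_inner_self norm_minus_commute)
        also have "\<dots> \<le> ennreal (((1/2)^n)\<^sup>2)"
          by (intro ennreal_leI power_mono fast elim) simp
        finally show ?case .
      qed
    qed simp
    finally show ?thesis .
  qed
  have diff: "(\<lambda>\<omega>. X n \<omega> - S \<omega>) \<in> L2 M" for n
  proof -
    have "integrable M (\<lambda>\<omega>. (norm (X n \<omega> - S \<omega>))\<^sup>2)"
      using fatou[of n] by (intro integrableI_bounded) (auto simp: le_less_trans)
    then show ?thesis by (simp add: L2_def)
  qed
  have "S \<in> L2 M" using L2_diff[OF X[of 0] diff[of 0]] by simp
  have "norm (\<integral>\<omega>. (norm (X n \<omega> - S \<omega>))\<^sup>2 \<partial>M) \<le> ((1/2)^n)\<^sup>2" for n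
    using fatou[of n] diff[of n]
    by (subst (asm) nn_integral_eq_integral) (auto simp: L2_def)
  then have bound: "\<forall>\<^sub>F n in sequentially. norm (\<integral>\<omega>. (norm (X n \<omega> - S \<omega>))\<^sup>2 \<partial>M) \<le> ((1/2)^n)\<^sup>2"
    by (rule always_eventually[OF allI])
  have "(\<lambda>n. ((1/2::real)^n)\<^sup>2) \<longlonglongrightarrow> 0\<^sup>2"
    by (intro tendsto_power LIMSEQ_realpow_zero) simp_all
  then have "(\<lambda>n. \<integral>\<omega>. (norm (X n \<omega> - S \<omega>))\<^sup>2 \<partial>M) \<longlonglongrightarrow> 0"
    by (intro Lim_null_comparison[OF bound]) (simp only: power_zero_numeral)
  with \<open>S \<in> L2 M\<close> X show ?thesis by (auto simp: L2_tendsto_def)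
qed

lemma L2_inner_orthogonal_sums:
  fixes \<phi> :: "'i \<Rightarrow> 'w \<Rightarrow> 'b::{real_inner, banach, second_countable_topology}"
  assumes "finite F" "\<And>i. i \<in> F \<Longrightarrow> \<phi> i \<in> L2 M"
    and "\<And>i j. i \<in> F \<Longrightarrow> j \<in> F \<Longrightarrow> i \<noteq> j \<Longrightarrow> L2_inner M (\<phi> i) (\<phi> j) = 0"
  shows "L2_inner M (\<lambda>\<omega>. \<Sum>i\<in>F. \<phi> i \<omega>) (\<lambda>\<omega>. \<Sum>i\<in>F. \<phi> i \<omega>) = (\<Sum>i\<in>F. L2_inner M (\<phi> i) (\<phi> i))"
proof -
  have "L2_inner M (\<lambda>\<omega>. \<Sum>i\<in>F. \<phi> i \<omega>) (\<lambda>\<omega>. \<Sum>i\<in>F. \<phi> i \<omega>)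
      = (\<Sum>i\<in>F. \<Sum>j\<in>F. L2_inner M (\<phi> i) (\<phi> j))"
    using assms by (simp add: L2_inner_sum_left L2_inner_sum_right L2_sum)
  also have "\<dots> = (\<Sum>i\<in>F. \<Sum>j\<in>F. if j = i then L2_inner M (\<phi> i) (\<phi> i) else 0)"
    using assms(3) by (intro sum.cong refl) auto
  finally show ?thesis using assms(1) by simp
qed

text \<open>The limit along finite subsets exists because, by Pythagoras, what a finite set adds to the partial
sum is controlled by how far the sum of squares is from its supremum. A sequence of finite sets
approaching that supremum geometrically reduces the claim to sequences.\<close>

lemma (in prob_space) L2_orthogonal_series:
  fixes \<phi> :: "'i \<Rightarrow> 'a \<Rightarrow> 'b::{real_inner, banach, second_countable_topology}"
  assumes \<phi>: "\<And>i. i \<in> I \<Longrightarrow> \<phi> i \<in> L2 M"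
    and orth: "\<And>i j. i \<in> I \<Longrightarrow> j \<in> I \<Longrightarrow> i \<noteq> j \<Longrightarrow> L2_inner M (\<phi> i) (\<phi> j) = 0"
    and bound: "\<And>F. finite F \<Longrightarrow> F \<subseteq> I \<Longrightarrow> (\<Sum>i\<in>F. L2_inner M (\<phi> i) (\<phi> i)) \<le> C"
  shows "\<exists>S. L2_tendsto M (\<lambda>F \<omega>. \<Sum>i\<in>F. \<phi> i \<omega>) S (finite_subsets_at_top I)"
proof -
  define q where "q i = L2_inner M (\<phi> i) (\<phi> i)" for i
  define Q where "Q = {F. finite F \<and> F \<subseteq> I}"
  define s where "s = (SUP F\<in>Q. sum q F)"
  have q0: "q i \<ge> 0" for i by (simp add: q_def)
  have bdd: "bdd_above (sum q ` Q)" using bound by (auto simp: Q_def q_def intro!: bdd_aboveI)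
  have "Q \<noteq> {}" by (auto simp: Q_def)
  have upper: "sum q F \<le> s" if "F \<in> Q" for F
    unfolding s_def by (rule cSUP_upper[OF that bdd])
  have "\<exists>F\<in>Q. s - ((1/2)^n)\<^sup>2 < sum q F" for n :: nat
    using less_cSUP_iff[OF \<open>Q \<noteq> {}\<close> bdd, of "s - ((1/2)^n)\<^sup>2"] by (simp add: s_def)
  then obtain G where G: "\<And>n. G n \<in> Q" "\<And>n. s - ((1/2)^n)\<^sup>2 < sum q (G n)" by metis
  \<comment> \<open>Unions make the exhausting sets increasing, so that their partial sums are comparable.\<close>
  define F where "F n = (\<Union>k\<le>n. G k)" for n
  have FQ: "F n \<in> Q" for n using G(1) by (auto simp: F_def Q_def)
  have Fmono: "F n \<subseteq> F m" if "n \<le> m" for n m using that by (force simp: F_def)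
  define Z where "Z A \<omega> = (\<Sum>i\<in>A. \<phi> i \<omega>)" for A \<omega>
  have ZL2: "Z A \<in> L2 M" if "A \<in> Q" for A
    using that \<phi> unfolding Z_def[abs_def] Q_def by (intro L2_sum) auto
  have tail: "L2_norm M (\<lambda>\<omega>. Z A \<omega> - Z (F n) \<omega>) \<le> (1/2)^n" if A: "A \<in> Q" "F n \<subseteq> A" for A n
  proof -
    have fin: "finite A" "finite (F n)" using A FQ[of n] by (auto simp: Q_def)
    have "(\<lambda>\<omega>. Z A \<omega> - Z (F n) \<omega>) = (\<lambda>\<omega>. \<Sum>i\<in>A - F n. \<phi> i \<omega>)"
      using fin A(2) by (auto simp: Z_def sum_diff)
    then have "(L2_norm M (\<lambda>\<omega>. Z A \<omega> - Z (F n) \<omega>))\<^sup>2 = sum q (A - F n)"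
      using A(1) \<phi> orth fin(1) unfolding L2_norm_power2 q_def
      by (simp, intro L2_inner_orthogonal_sums) (auto simp: Q_def subset_eq)
    also have "\<dots> = sum q A - sum q (F n)" using fin A(2) by (simp add: sum_diff)
    also have "\<dots> \<le> s - sum q (G n)"
      using upper[OF A(1)] sum_mono2[OF fin(2), of "G n" q] q0 by (force simp: F_def)
    also have "\<dots> \<le> ((1/2)^n)\<^sup>2" using G(2)[of n] by simp
    finally show ?thesis by (rule power2_le_imp_le) simp
  qed
  have "\<exists>S. L2_tendsto M (\<lambda>n. Z (F n)) S sequentially"
    by (rule L2_complete_fast) (auto intro!: ZL2[OF FQ] tail[OF FQ Fmono])
  then obtain S where S: "S \<in> L2 M"
    and lim: "(\<lambda>n. L2_norm M (\<lambda>\<omega>. Z (F n) \<omega> - S \<omega>)) \<longlonglongrightarrow> 0"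
    by (auto simp: L2_tendsto_iff_norm)
  have "((\<lambda>A. L2_norm M (\<lambda>\<omega>. Z A \<omega> - S \<omega>)) \<longlongrightarrow> 0) (finite_subsets_at_top I)"
  proof (rule tendstoI)
    fix \<epsilon> :: real assume "\<epsilon> > 0"
    have "(\<lambda>n. (1/2::real)^n + L2_norm M (\<lambda>\<omega>. Z (F n) \<omega> - S \<omega>)) \<longlonglongrightarrow> 0"
      using tendsto_add[OF LIMSEQ_realpow_zero[of "1/2"] lim] by simp
    then have "\<forall>\<^sub>F n in sequentially. (1/2::real)^n + L2_norm M (\<lambda>\<omega>. Z (F n) \<omega> - S \<omega>) < \<epsilon>"
      using \<open>\<epsilon> > 0\<close> by (rule order_tendstoD)
    then obtain n where n: "(1/2::real)^n + L2_norm M (\<lambda>\<omega>. Z (F n) \<omega> - S \<omega>) < \<epsilon>"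
      by (auto simp: eventually_sequentially)
    show "\<forall>\<^sub>F A in finite_subsets_at_top I. dist (L2_norm M (\<lambda>\<omega>. Z A \<omega> - S \<omega>)) 0 < \<epsilon>"
      unfolding eventually_finite_subsets_at_top
    proof (intro exI[of _ "F n"] conjI allI impI)
      show "finite (F n)" "F n \<subseteq> I" using FQ[of n] by (auto simp: Q_def)
      fix A assume A: "finite A \<and> F n \<subseteq> A \<and> A \<subseteq> I"
      then have "A \<in> Q" by (simp add: Q_def)
      then show "dist (L2_norm M (\<lambda>\<omega>. Z A \<omega> - S \<omega>)) 0 < \<epsilon>"
        using L2_norm_triangle_diff[OF ZL2[OF \<open>A \<in> Q\<close>] ZL2[OF FQ[of n]] S] tail[of A n] A n by simp
    qed
  qed
  moreover have "\<forall>\<^sub>F A in finite_subsets_at_top I. Z A \<in> L2 M"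
    by (rule eventually_finite_subsets_at_top_weakI) (auto intro: ZL2 simp: Q_def)
  ultimately show ?thesis
    using S unfolding L2_tendsto_iff_norm Z_def[abs_def] by blast
qed

lemma L2_tendsto_cong_AE:
  fixes S :: "'w \<Rightarrow> 'b::{real_inner, banach, second_countable_topology}"
  assumes lim: "L2_tendsto M X S F" and S': "S' \<in> L2 M" and eq: "AE \<omega> in M. S \<omega> = S' \<omega>"
  shows "L2_tendsto M X S' F"
proof -
  have S: "S \<in> L2 M" and X: "\<forall>\<^sub>F i in F. X i \<in> L2 M"
    and l: "((\<lambda>i. L2_norm M (\<lambda>\<omega>. X i \<omega> - S \<omega>)) \<longlongrightarrow> 0) F"
    using lim by (auto simp: L2_tendsto_iff_norm)
  have "\<forall>\<^sub>F i in F. L2_norm M (\<lambda>\<omega>. X i \<omega> - S \<omega>) = L2_norm M (\<lambda>\<omega>. X i \<omega> - S' \<omega>)"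
    using X
  proof eventually_elim
    case (elim i)
    show ?case using eq by (intro L2_norm_cong_AE L2_diff elim S S') auto
  qed
  then have "((\<lambda>i. L2_norm M (\<lambda>\<omega>. X i \<omega> - S' \<omega>)) \<longlongrightarrow> 0) F"
    using l by (rule Lim_transform_eventually[rotated])
  then show ?thesis using S' X by (simp add: L2_tendsto_iff_norm)
qed

text \<open>Coordinates of an orthogonal series: the net of partial coordinates is eventually constant.\<close>

lemma L2_series_inner:
  fixes S g :: "'w \<Rightarrow> 'b::{real_inner, banach, second_countable_topology}"
  assumes lim: "L2_tendsto M (\<lambda>F \<omega>. \<Sum>i\<in>F. \<phi> i \<omega>) S (finite_subsets_at_top I)"
    and \<phi>: "\<And>i. i \<in> I \<Longrightarrow> \<phi> i \<in> L2 M" and g: "g \<in> L2 M"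
    and inner: "\<And>i. i \<in> I \<Longrightarrow> L2_inner M (\<phi> i) g = (if i = i0 then x else 0)"
  shows "L2_inner M S g = (if i0 \<in> I then x else 0)"
proof (rule tendsto_unique[OF _ L2_tendsto_inner[OF lim g]])
  have "\<forall>\<^sub>F F in finite_subsets_at_top I. L2_inner M (\<lambda>\<omega>. \<Sum>i\<in>F. \<phi> i \<omega>) g = (if i0 \<in> I then x else 0)"
    unfolding eventually_finite_subsets_at_top
  proof (intro exI[of _ "{i0} \<inter> I"] conjI allI impI)
    fix F assume F: "finite F \<and> {i0} \<inter> I \<subseteq> F \<and> F \<subseteq> I"
    then have "L2_inner M (\<lambda>\<omega>. \<Sum>i\<in>F. \<phi> i \<omega>) g = (\<Sum>i\<in>F. L2_inner M (\<phi> i) g)"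
      using \<phi> g by (intro L2_inner_sum_left) auto
    also have "\<dots> = (\<Sum>i\<in>F. if i = i0 then x else 0)"
      using F by (intro sum.cong refl inner) auto
    finally show "L2_inner M (\<lambda>\<omega>. \<Sum>i\<in>F. \<phi> i \<omega>) g = (if i0 \<in> I then x else 0)"
      using F by auto
  qed auto
  then show "((\<lambda>F. L2_inner M (\<lambda>\<omega>. \<Sum>i\<in>F. \<phi> i \<omega>) g) \<longlongrightarrow> (if i0 \<in> I then x else 0)) (finite_subsets_at_top I)"
    by (rule tendsto_eventually)
qed simp

lemma L2_norm_inner_vec_le:
  fixes v :: "'w \<Rightarrow> 'b::{real_inner, banach, second_countable_topology}"
  assumes v: "v \<in> L2 M" shows "L2_norm M (\<lambda>\<omega>. v \<omega> \<bullet> h) \<le> L2_norm M v * norm h"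
proof -
  have "L2_inner M (\<lambda>\<omega>. v \<omega> \<bullet> h) (\<lambda>\<omega>. v \<omega> \<bullet> h) \<le> (\<integral>\<omega>. (v \<omega> \<bullet> v \<omega>) * (h \<bullet> h) \<partial>M)"
    unfolding L2_inner_def
  proof (rule integral_mono)
    show "integrable M (\<lambda>\<omega>. (v \<omega> \<bullet> h) \<bullet> (v \<omega> \<bullet> h))"
      by (rule L2_inner_integrable) (rule L2_inner_vec[OF v])+
    show "integrable M (\<lambda>\<omega>. (v \<omega> \<bullet> v \<omega>) * (h \<bullet> h))" using L2_inner_integrable[OF v v] by simp
    show "(v \<omega> \<bullet> h) \<bullet> (v \<omega> \<bullet> h) \<le> (v \<omega> \<bullet> v \<omega>) * (h \<bullet> h)" for \<omega>
      using Cauchy_Schwarz_ineq[of "v \<omega>" h] by (simp add: power2_eq_square)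
  qed
  also have "\<dots> = L2_inner M v v * (norm h)\<^sup>2" by (simp add: L2_inner_def power2_norm_eq_inner)
  finally have "(L2_norm M (\<lambda>\<omega>. v \<omega> \<bullet> h))\<^sup>2 \<le> (L2_norm M v * norm h)\<^sup>2"
    by (simp add: L2_norm_power2 power_mult_distrib)
  then show ?thesis by (rule power2_le_imp_le) simp
qed

lemma bounded_linear_L2_inner_vec:
  fixes v :: "'w \<Rightarrow> 'b::{real_inner, banach, second_countable_topology}"
  assumes v: "v \<in> L2 M" and g: "g \<in> L2 M"
  shows "bounded_linear (\<lambda>h. L2_inner M (\<lambda>\<omega>. v \<omega> \<bullet> h) g)"
proof (rule bounded_linear_intro[where K = "L2_norm M v * L2_norm M g"])
  note vh = L2_inner_vec[OF v]
  show "L2_inner M (\<lambda>\<omega>. v \<omega> \<bullet> (x + y)) g = L2_inner M (\<lambda>\<omega>. v \<omega> \<bullet> x) g + L2_inner M (\<lambda>\<omega>. v \<omega> \<bullet> y) g" for x y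
    unfolding inner_add_right by (rule L2_inner_add_left[OF vh vh g])
  show "L2_inner M (\<lambda>\<omega>. v \<omega> \<bullet> (r *\<^sub>R x)) g = r *\<^sub>R L2_inner M (\<lambda>\<omega>. v \<omega> \<bullet> x) g" for r x
    by (simp add: L2_inner_mult_left)
  show "norm (L2_inner M (\<lambda>\<omega>. v \<omega> \<bullet> x) g) \<le> norm x * (L2_norm M v * L2_norm M g)" for x
    using order.trans[OF L2_Cauchy_Schwarz[OF vh g] mult_right_mono[OF L2_norm_inner_vec_le[OF v]]]
    by (simp add: mult_ac)
qed

section \<open>Hermite polynomials and the standard normal law\<close>

text \<open>The Rodrigues formula defining \<open>hermite\<close> is awkward to integrate; as genuine polynomials the
Hermite functions can be treated by linear algebra on moments.\<close>

fun hermite_poly :: "nat \<Rightarrow> real poly" where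
  "hermite_poly 0 = 1"
| "hermite_poly (Suc n) = [:0, 1:] * hermite_poly n - pderiv (hermite_poly n)"

lemma hermite_eq_poly: "hermite k x = poly (hermite_poly k) x"
proof -
  have "(deriv ^^ k) (\<lambda>y::real. exp (- (y\<^sup>2) / 2))
      = (\<lambda>x. (-1) ^ k * poly (hermite_poly k) x * exp (- (x\<^sup>2) / 2))"
  proof (induction k)
    case (Suc k)
    have "((\<lambda>x. (-1) ^ k * poly (hermite_poly k) x * exp (- (x\<^sup>2) / 2)) has_real_derivative
        (-1) ^ Suc k * poly (hermite_poly (Suc k)) x * exp (- (x\<^sup>2) / 2)) (at x)" for x :: real
      by (auto intro!: derivative_eq_intros simp: algebra_simps)
    then show ?case
      unfolding funpow.simps comp_def Suc.IH by (intro ext DERIV_imp_deriv)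
  qed simp
  then have "hermite k x = ((-1) ^ k * (-1) ^ k) * (exp (x\<^sup>2 / 2) * exp (- (x\<^sup>2) / 2)) * poly (hermite_poly k) x"
    unfolding hermite_def by (simp only: mult_ac)
  also have "(-1::real) ^ k * (-1) ^ k = 1" by (simp flip: power_mult_distrib)
  also have "exp (x\<^sup>2 / 2) * exp (- (x\<^sup>2) / 2) = 1" by (simp flip: exp_add)
  finally show ?thesis by simp
qed

lemma hermite_0 [simp]: "hermite 0 = (\<lambda>_. 1)"
  by (simp add: fun_eq_iff hermite_eq_poly)

lemma borel_measurable_hermite [measurable]: "hermite k \<in> borel_measurable borel"
  by (rule borel_measurable_continuous_onI) (simp add: hermite_eq_poly[abs_def] continuous_on_poly)

lemma pderiv_hermite_poly_Suc: "pderiv (hermite_poly (Suc n)) = smult (real (Suc n)) (hermite_poly n)"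
proof (induction n)
  case (Suc n)
  have "pderiv (hermite_poly (Suc (Suc n)))
      = hermite_poly (Suc n) + [:0, 1:] * pderiv (hermite_poly (Suc n)) - pderiv (pderiv (hermite_poly (Suc n)))"
    by (subst hermite_poly.simps(2)) (simp add: pderiv_mult pderiv_diff pderiv_pCons del: hermite_poly.simps)
  also have "\<dots> = hermite_poly (Suc n)
      + smult (real (Suc n)) ([:0, 1:] * hermite_poly n - pderiv (hermite_poly n))"
    unfolding Suc.IH by (simp add: pderiv_smult smult_diff_right del: hermite_poly.simps)
  also have "\<dots> = hermite_poly (Suc n) + smult (real (Suc n)) (hermite_poly (Suc n))"
    by (simp only: hermite_poly.simps(2))
  also have "\<dots> = smult (real (Suc (Suc n))) (hermite_poly (Suc n))"
    by (simp only: of_nat_Suc[of "Suc n"] smult_add_left smult_1_left)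
  finally show ?case .
qed (simp add: pderiv_pCons pderiv_1 one_pCons)

text \<open>The three-term recurrence. Truncated subtraction in \<open>k - 1\<close> is harmless since the
coefficient vanishes at \<open>k = 0\<close>.\<close>

lemma hermite_times:
  "x * hermite k x = hermite (Suc k) x + real k * hermite (k - 1) x"
proof (cases k)
  case (Suc n)
  have "hermite_poly (Suc k) = [:0, 1:] * hermite_poly k - smult (real k) (hermite_poly n)"
    using pderiv_hermite_poly_Suc[of n] unfolding Suc by (simp only: hermite_poly.simps(2)[of "Suc n"])
  then show ?thesis using Suc by (simp add: hermite_eq_poly del: hermite_poly.simps(2))
qed (simp add: hermite_eq_poly)

lemma integrable_std_normal_poly: "integrable std_normal_distribution (poly p)"
  unfolding poly_altdef[abs_def]
  by (intro Bochner_Integration.integrable_sum integrable_mult_right integrable_std_normal_distribution_moment)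

lemma std_normal_moment_rec:
  "(LINT x|std_normal_distribution. x ^ Suc k)
    = real k * (LINT x|std_normal_distribution. x ^ (k - 1))"
proof (cases "even k")
  case True
  then have "k = 0 \<or> odd (k - 1)" by (cases k) auto
  then show ?thesis
    using True integral_std_normal_distribution_moment_odd[of "Suc k"]
      integral_std_normal_distribution_moment_odd[of "k - 1"] by auto
next
  case False
  then obtain j where k: "k = 2 * j + 1" by (rule oddE)
  have e: "Suc k = 2 * Suc j" "k - 1 = 2 * j" using k by auto
  have f: "fact (2 * Suc j) = 2 * real (Suc j) * (real k * fact (2 * j))"
    using k by (simp add: algebra_simps)
  show ?thesis
    unfolding e std_normal_distribution_even_moments(1) f by (simp add: divide_simps del: of_nat_Suc)
qed

text \<open>Both sides are linear in the polynomial, and on monomials this is the recursion of the Gaussian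
moments.\<close>

lemma std_normal_integration_by_parts:
  "(LINT x|std_normal_distribution. poly ([:0, 1:] * p) x)
    = (LINT x|std_normal_distribution. poly (pderiv p) x)"
proof -
  let ?E = "\<lambda>p. LINT x|std_normal_distribution. poly p x"
  have add: "?E (p + q) = ?E p + ?E q" for p q
    by (simp add: integrable_std_normal_poly)
  have "?E ([:0, 1:] * (\<Sum>i\<in>I. monom (c i) i)) = ?E (pderiv (\<Sum>i\<in>I. monom (c i) i))"
    if "finite I" for I and c :: "nat \<Rightarrow> real"
    using that
  proof (induction I)
    case (insert i I)
    have "poly ([:0, 1:] * monom (c i) i) = (\<lambda>x. c i * x ^ Suc i)"
      "poly (pderiv (monom (c i) i)) = (\<lambda>x. c i * (real i * x ^ (i - 1)))"
      by (simp_all add: fun_eq_iff poly_monom pderiv_monom)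
    then have "?E ([:0, 1:] * monom (c i) i) = ?E (pderiv (monom (c i) i))"
      using std_normal_moment_rec[of i] by (simp only: integral_mult_right_zero)
    then show ?case
      using insert.IH by (simp only: sum.insert[OF insert.hyps] distrib_left pderiv_add add)
  qed simp
  from this[of "{..degree p}" "coeff p"] show ?thesis
    by (simp add: poly_as_sum_of_monoms)
qed

text \<open>Integration by parts moves one degree from the first Hermite factor to a derivative of the second,
so induction on the degree applies.\<close>

lemma hermite_orthogonal:
  "(LINT x|std_normal_distribution. hermite n x * hermite m x) = (if n = m then fact n else 0)"
proof -
  let ?E = "\<lambda>p. LINT x|std_normal_distribution. poly p x"
  have step: "?E (hermite_poly (Suc n) * p) = ?E (hermite_poly n * pderiv p)" for n p
  proof -
    have "hermite_poly (Suc n) * p + pderiv (hermite_poly n) * p = [:0, 1:] * (hermite_poly n * p)"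
      by (simp add: algebra_simps)
    then have "?E (hermite_poly (Suc n) * p) + ?E (pderiv (hermite_poly n) * p)
        = ?E ([:0, 1:] * (hermite_poly n * p))"
      by (simp only: flip: Bochner_Integration.integral_add[OF integrable_std_normal_poly integrable_std_normal_poly] poly_add)
    also have "\<dots> = ?E (pderiv (hermite_poly n * p))"
      by (rule std_normal_integration_by_parts)
    also have "\<dots> = ?E (hermite_poly n * pderiv p) + ?E (pderiv (hermite_poly n) * p)"
      by (simp only: pderiv_mult poly_add mult.commute
        Bochner_Integration.integral_add[OF integrable_std_normal_poly integrable_std_normal_poly])
    finally show ?thesis by simp
  qed
  have one: "?E 1 = 1"
    using prob_space.prob_space[OF prob_space_normal_density[of 1 0]] by simp
  have "?E (hermite_poly n * hermite_poly m) = (if n = m then fact n else 0)"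
  proof (induction n arbitrary: m)
    case 0
    show ?case
    proof (cases m)
      case (Suc k)
      show ?thesis using step[of k 1] Suc by (simp add: pderiv_1 mult.commute del: hermite_poly.simps(2))
    qed (use one in simp)
  next
    case (Suc n)
    show ?case
    proof (cases m)
      case 0 then show ?thesis using step[of n 1] by (simp add: pderiv_1 del: hermite_poly.simps(2))
    next
      case (Suc k)
      then show ?thesis
        using step[of n "hermite_poly m"] Suc.IH[of k]
        by (simp add: pderiv_hermite_poly_Suc del: hermite_poly.simps(2))
    qed
  qed
  then show ?thesis by (simp add: hermite_eq_poly)
qed

lemma integrable_std_normal_hermite: "integrable std_normal_distribution (\<lambda>x. hermite n x * hermite m x)"
proof -
  have "(\<lambda>x. hermite n x * hermite m x) = poly (hermite_poly n * hermite_poly m)"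
    by (simp add: fun_eq_iff hermite_eq_poly)
  then show ?thesis by (simp only: integrable_std_normal_poly)
qed

section \<open>Uniqueness of Fourier transforms\<close>

text \<open>The hypothesis at \<open>s = 0\<close> says that the positive and negative parts of \<open>g\<close> have the same
mass. If it is positive, then after normalisation they are probability densities under which \<open>Y\<close> has the same
characteristic function, hence the same law by Levy's theorem.\<close>

lemma (in prob_space) fourier_uniqueness_real:
  fixes g Y :: "'a \<Rightarrow> real"
  assumes g: "integrable M g" and Y[measurable]: "Y \<in> borel_measurable M"
    and zero: "\<And>s. (\<integral>\<omega>. g \<omega> *\<^sub>R iexp (s * Y \<omega>) \<partial>M) = 0" and B[measurable]: "B \<in> sets borel"
  shows "(\<integral>\<omega>. g \<omega> * indicator B (Y \<omega>) \<partial>M) = 0"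
proof -
  have [measurable]: "g \<in> borel_measurable M" using g by auto
  define P where "P \<omega> = max (g \<omega>) 0" for \<omega>
  define N where "N \<omega> = max (- g \<omega>) 0" for \<omega>
  have int: "integrable M P" "integrable M N" unfolding P_def N_def using g by auto
  have [measurable]: "P \<in> borel_measurable M" "N \<in> borel_measurable M" using int by auto
  have gPN: "g \<omega> = P \<omega> - N \<omega>" and nn: "P \<omega> \<ge> 0" "N \<omega> \<ge> 0" for \<omega> by (auto simp: P_def N_def)
  have ie: "integrable M (\<lambda>\<omega>. h \<omega> *\<^sub>R iexp (s * Y \<omega>))" if "integrable M h" for h :: "'a \<Rightarrow> real" and s
  proof (rule Bochner_Integration.integrable_bound[OF that])
    have [measurable]: "h \<in> borel_measurable M" using that by auto
    show "(\<lambda>\<omega>. h \<omega> *\<^sub>R iexp (s * Y \<omega>)) \<in> borel_measurable M" by measurable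
  qed auto
  have eq: "(\<integral>\<omega>. P \<omega> *\<^sub>R iexp (s * Y \<omega>) \<partial>M) = (\<integral>\<omega>. N \<omega> *\<^sub>R iexp (s * Y \<omega>) \<partial>M)" for s
    using zero[of s] ie[OF int(1)] ie[OF int(2)] by (simp add: gPN scaleR_diff_left)
  define c where "c = (\<integral>\<omega>. P \<omega> \<partial>M)"
  have cN: "c = (\<integral>\<omega>. N \<omega> \<partial>M)"
  proof -
    have "complex_of_real (\<integral>\<omega>. P \<omega> \<partial>M) = complex_of_real (\<integral>\<omega>. N \<omega> \<partial>M)"
      using eq[of 0] by (simp add: scaleR_conv_of_real)
    then show ?thesis by (simp add: c_def)
  qed
  have "c \<ge> 0" unfolding c_def using nn by simp
  show ?thesis
  proof (cases "c = 0")
    case True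
    have "AE \<omega> in M. P \<omega> = 0" "AE \<omega> in M. N \<omega> = 0"
      using True integral_nonneg_eq_0_iff_AE[OF int(1)] integral_nonneg_eq_0_iff_AE[OF int(2)] nn
      by (auto simp: c_def cN[unfolded c_def])
    then have "AE \<omega> in M. g \<omega> * indicator B (Y \<omega>) = 0" by eventually_elim (simp add: gPN)
    then show ?thesis by (subst integral_eq_zero_AE) auto
  next
    case False
    then have c: "c > 0" using \<open>c \<ge> 0\<close> by simp
    define L where "L h = distr (density M (\<lambda>\<omega>. ennreal (h \<omega> / c))) borel Y" for h :: "'a \<Rightarrow> real"
    have rd: "real_distribution (L h)"
      and LI: "\<And>f :: real \<Rightarrow> complex. f \<in> borel_measurable borel \<Longrightarrow>
        (\<integral>x. f x \<partial>(L h)) = (\<integral>\<omega>. h \<omega> *\<^sub>R f (Y \<omega>) \<partial>M) / c"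
      if h: "integrable M h" "\<And>\<omega>. h \<omega> \<ge> 0" "(\<integral>\<omega>. h \<omega> \<partial>M) = c" for h
    proof -
      have [measurable]: "h \<in> borel_measurable M" using h by auto
      have "prob_space (density M (\<lambda>\<omega>. ennreal (h \<omega> / c)))"
      proof
        have "(\<integral>\<^sup>+\<omega>. ennreal (h \<omega> / c) \<partial>M) = ennreal (\<integral>\<omega>. h \<omega> / c \<partial>M)"
          using h c by (intro nn_integral_eq_integral) auto
        then show "emeasure (density M (\<lambda>\<omega>. ennreal (h \<omega> / c))) (space (density M (\<lambda>\<omega>. ennreal (h \<omega> / c)))) = 1"
          using h(3) c by (simp add: emeasure_density cong: nn_integral_cong)
      qed
      then show "real_distribution (L h)"
        unfolding L_def real_distribution_def real_distribution_axioms_def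
        by (auto intro!: prob_space.prob_space_distr)
      fix f :: "real \<Rightarrow> complex" assume [measurable]: "f \<in> borel_measurable borel"
      have "(\<integral>x. f x \<partial>(L h)) = (\<integral>\<omega>. (h \<omega> / c) *\<^sub>R f (Y \<omega>) \<partial>M)"
        unfolding L_def using h c by (subst integral_distr) (auto simp: integral_density)
      also have "\<dots> = (\<integral>\<omega>. (h \<omega> *\<^sub>R f (Y \<omega>)) / c \<partial>M)"
        by (simp add: scaleR_conv_of_real)
      finally show "(\<integral>x. f x \<partial>(L h)) = (\<integral>\<omega>. h \<omega> *\<^sub>R f (Y \<omega>) \<partial>M) / c" by simp
    qed
    note LP = LI[OF int(1) nn(1) c_def[symmetric]] and LN = LI[OF int(2) nn(2) cN[symmetric]]
    have "L P = L N"
    proof (rule Levy_uniqueness)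
      show "real_distribution (L P)" "real_distribution (L N)"
        using rd[OF int(1) nn(1) c_def[symmetric]] rd[OF int(2) nn(2) cN[symmetric]] by auto
      show "char (L P) = char (L N)"
        using eq by (intro ext) (simp add: char_def LP LN)
    qed
    then have "(\<integral>\<omega>. P \<omega> *\<^sub>R (indicator B (Y \<omega>) :: complex) \<partial>M) = (\<integral>\<omega>. N \<omega> *\<^sub>R indicator B (Y \<omega>) \<partial>M)"
      using LP[of "indicator B"] LN[of "indicator B"] c by simp
    then have "complex_of_real (\<integral>\<omega>. P \<omega> * indicator B (Y \<omega>) \<partial>M)
        = complex_of_real (\<integral>\<omega>. N \<omega> * indicator B (Y \<omega>) \<partial>M)"
      by (simp add: scaleR_conv_of_real indicator_def of_bool_def if_distrib cong: if_cong
          flip: integral_complex_of_real)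
    then have "(\<integral>\<omega>. P \<omega> * indicator B (Y \<omega>) \<partial>M) = (\<integral>\<omega>. N \<omega> * indicator B (Y \<omega>) \<partial>M)"
      by (simp only: of_real_eq_iff)
    moreover have "integrable M (\<lambda>\<omega>. h \<omega> * indicator B (Y \<omega>))" if "integrable M h" for h :: "'a \<Rightarrow> real"
    proof (rule Bochner_Integration.integrable_bound[OF that])
      have [measurable]: "h \<in> borel_measurable M" using that by auto
      show "(\<lambda>\<omega>. h \<omega> * indicator B (Y \<omega>)) \<in> borel_measurable M" by measurable
    qed (auto split: split_indicator)
    ultimately show ?thesis using int by (simp add: gPN left_diff_distrib)
  qed
qed

lemma (in prob_space) integrable_mult_iexp:
  fixes g :: "'a \<Rightarrow> complex" and Y :: "'a \<Rightarrow> real"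
  assumes g: "integrable M g" and Y[measurable]: "Y \<in> borel_measurable M"
  shows "integrable M (\<lambda>\<omega>. g \<omega> * iexp (s * Y \<omega>))"
proof (rule Bochner_Integration.integrable_bound[OF g])
  have [measurable]: "g \<in> borel_measurable M" using g by auto
  show "(\<lambda>\<omega>. g \<omega> * iexp (s * Y \<omega>)) \<in> borel_measurable M" by measurable
qed (auto simp: norm_mult)

text \<open>The complex version is what allows an induction over several variables: \<open>g\<close> may itself contain
exponentials of other variables. It reduces to the real one because the hypothesis, being
required for all real \<open>s\<close>, passes to the complex conjugate of \<open>g\<close>.\<close>

lemma (in prob_space) fourier_uniqueness:
  fixes g :: "'a \<Rightarrow> complex" and Y :: "'a \<Rightarrow> real"
  assumes g: "integrable M g" and Y[measurable]: "Y \<in> borel_measurable M"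
    and zero: "\<And>s. (\<integral>\<omega>. g \<omega> * iexp (s * Y \<omega>) \<partial>M) = 0" and B[measurable]: "B \<in> sets borel"
  shows "(\<integral>\<omega>. g \<omega> * indicator B (Y \<omega>) \<partial>M) = 0"
proof -
  have [measurable]: "g \<in> borel_measurable M" using g by auto
  have cz: "(\<integral>\<omega>. cnj (g \<omega>) * iexp (s * Y \<omega>) \<partial>M) = 0" for s
  proof -
    have "(\<integral>\<omega>. cnj (g \<omega>) * iexp (s * Y \<omega>) \<partial>M) = (\<integral>\<omega>. cnj (g \<omega> * iexp ((- s) * Y \<omega>)) \<partial>M)"
      by (simp add: exp_cnj)
    also have "\<dots> = cnj (\<integral>\<omega>. g \<omega> * iexp ((- s) * Y \<omega>) \<partial>M)"
      by (rule integral_bounded_linear[OF bounded_linear_cnj integrable_mult_iexp[OF g Y]])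
    finally show ?thesis using zero[of "- s"] by simp
  qed
  have gi: "integrable M (\<lambda>\<omega>. cnj (g \<omega>))" using g by simp
  have "(\<integral>\<omega>. Re (g \<omega>) *\<^sub>R iexp (s * Y \<omega>) \<partial>M) = 0" for s
  proof -
    have eq: "Re (g \<omega>) *\<^sub>R iexp (s * Y \<omega>) = (g \<omega> * iexp (s * Y \<omega>) + cnj (g \<omega>) * iexp (s * Y \<omega>)) / 2" for \<omega>
      using complex_add_cnj[of "g \<omega>"] by (simp add: scaleR_conv_of_real flip: distrib_right)
    show ?thesis
      unfolding eq using zero[of s] cz[of s] integrable_mult_iexp[OF g Y, of s] integrable_mult_iexp[OF gi Y, of s] by simp
  qed
  moreover have "(\<integral>\<omega>. Im (g \<omega>) *\<^sub>R iexp (s * Y \<omega>) \<partial>M) = 0" for s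
  proof -
    have eq: "Im (g \<omega>) *\<^sub>R iexp (s * Y \<omega>) = (g \<omega> * iexp (s * Y \<omega>) - cnj (g \<omega>) * iexp (s * Y \<omega>)) / (2 * \<i>)" for \<omega>
      using complex_diff_cnj[of "g \<omega>"] by (simp add: scaleR_conv_of_real mult_ac flip: left_diff_distrib)
    show ?thesis
      unfolding eq using zero[of s] cz[of s] integrable_mult_iexp[OF g Y, of s] integrable_mult_iexp[OF gi Y, of s] by simp
  qed
  ultimately have "(\<integral>\<omega>. Re (g \<omega>) * indicator B (Y \<omega>) \<partial>M) = 0" "(\<integral>\<omega>. Im (g \<omega>) * indicator B (Y \<omega>) \<partial>M) = 0"
    using g by (intro fourier_uniqueness_real; simp)+
  moreover have "integrable M (\<lambda>\<omega>. g \<omega> * indicator B (Y \<omega>))"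
    by (rule Bochner_Integration.integrable_bound[OF g]) (auto split: split_indicator)
  moreover have "Re (g \<omega> * indicator B (Y \<omega>)) = Re (g \<omega>) * indicator B (Y \<omega>)"
    "Im (g \<omega> * indicator B (Y \<omega>)) = Im (g \<omega>) * indicator B (Y \<omega>)" for \<omega>
    by (auto split: split_indicator)
  ultimately show ?thesis
    by (simp add: complex_eq_iff flip: integral_Re integral_Im)
qed

section \<open>White noise: Gaussian moments and independence\<close>

locale white_noise_basis = prob_space M for M :: "'w measure" +
  fixes \<xi> :: "'h::{real_inner, banach, second_countable_topology} \<Rightarrow> 'w \<Rightarrow> real"
    and J :: "nat set" and e :: "nat \<Rightarrow> 'h"
  assumes noise: "white_noise M \<xi>"
    and generated: "sets M = noise_sigma M \<xi>"
    and basis: "orthonormal_basis J e"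
begin

lemma noise_measurable [measurable]: "\<xi> h \<in> borel_measurable M"
  using noise by (auto simp: white_noise_def centered_gaussian_def)

lemma noise_linear: "AE \<omega> in M. \<xi> (a *\<^sub>R h + b *\<^sub>R k) \<omega> = a * \<xi> h \<omega> + b * \<xi> k \<omega>"
  using noise by (auto simp: white_noise_def)

lemma noise_scaleR: "AE \<omega> in M. \<xi> (a *\<^sub>R h) \<omega> = a * \<xi> h \<omega>"
  using noise_linear[of a h 0 0] by simp

lemma noise_add: "AE \<omega> in M. \<xi> (h + k) \<omega> = \<xi> h \<omega> + \<xi> k \<omega>"
  using noise_linear[of 1 h 1 k] by simp

lemma noise_diff: "AE \<omega> in M. \<xi> (h - k) \<omega> = \<xi> h \<omega> - \<xi> k \<omega>"
  using noise_linear[of 1 h "-1" k] by simp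

lemma noise_zero: "AE \<omega> in M. \<xi> 0 \<omega> = 0"
  using noise_scaleR[of 0 0] by simp

lemma inner_basis: "i \<in> J \<Longrightarrow> j \<in> J \<Longrightarrow> e i \<bullet> e j = (if i = j then 1 else 0)"
  using basis by (auto simp: orthonormal_basis_def)

lemma norm_basis [simp]: "i \<in> J \<Longrightarrow> norm (e i) = 1"
  by (simp add: norm_eq_sqrt_inner inner_basis)

lemma distr_noise_unit:
  assumes "norm u = 1" shows "distr M lborel (\<xi> u) = std_normal_distribution"
proof -
  have "centered_gaussian M (\<xi> u) ((norm u)\<^sup>2)" using noise by (simp add: white_noise_def)
  then have "distributed M lborel (\<xi> u) std_normal_density"
    using assms by (simp add: centered_gaussian_def)
  then show ?thesis by (rule distributed_distr_eq_density)
qed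

lemma
  fixes f :: "real \<Rightarrow> 'c::{banach, second_countable_topology}"
  assumes "norm u = 1" and [measurable]: "f \<in> borel_measurable borel"
  shows expectation_noise_unit: "(\<integral>\<omega>. f (\<xi> u \<omega>) \<partial>M) = (LINT x|std_normal_distribution. f x)"
    and integrable_noise_unit: "integrable M (\<lambda>\<omega>. f (\<xi> u \<omega>)) \<longleftrightarrow> integrable std_normal_distribution f"
proof -
  have m: "\<xi> u \<in> measurable M lborel" by simp
  show "(\<integral>\<omega>. f (\<xi> u \<omega>) \<partial>M) = (LINT x|std_normal_distribution. f x)"
    using integral_distr[OF m, of f] distr_noise_unit[OF assms(1)] by simp
  show "integrable M (\<lambda>\<omega>. f (\<xi> u \<omega>)) \<longleftrightarrow> integrable std_normal_distribution f"
    using integrable_distr_eq[OF m, of f] distr_noise_unit[OF assms(1)] by simp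
qed

lemma noise_normalize:
  assumes "h \<noteq> 0"
  obtains u where "norm u = 1" "AE \<omega> in M. \<xi> h \<omega> = norm h * \<xi> u \<omega>"
proof
  show "norm (h /\<^sub>R norm h) = 1" using assms by simp
  show "AE \<omega> in M. \<xi> h \<omega> = norm h * \<xi> (h /\<^sub>R norm h) \<omega>"
    using noise_scaleR[of "norm h" "h /\<^sub>R norm h"] assms by simp
qed

lemma noise_characteristic: "(\<integral>\<omega>. iexp (\<xi> h \<omega>) \<partial>M) = complex_of_real (exp (- ((norm h)\<^sup>2) / 2))"
proof (cases "h = 0")
  case True
  have "(\<integral>\<omega>. iexp (\<xi> h \<omega>) \<partial>M) = (\<integral>\<omega>. 1 \<partial>M)"
    using noise_zero True by (intro integral_cong_AE) auto
  then show ?thesis using True by (simp add: prob_space)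
next
  case False
  then obtain u where u: "norm u = 1" "AE \<omega> in M. \<xi> h \<omega> = norm h * \<xi> u \<omega>" by (rule noise_normalize)
  have "(\<integral>\<omega>. iexp (\<xi> h \<omega>) \<partial>M) = (\<integral>\<omega>. iexp (norm h * \<xi> u \<omega>) \<partial>M)"
    using u(2) by (intro integral_cong_AE) auto
  also have "\<dots> = char std_normal_distribution (norm h)"
    unfolding char_def by (rule expectation_noise_unit[OF u(1)]) simp
  finally show ?thesis by (simp add: char_std_normal_distribution)
qed

lemma
  shows noise_even_moment: "(\<integral>\<omega>. (\<xi> h \<omega>) ^ (2 * k) \<partial>M) = norm h ^ (2 * k) * (fact (2 * k) / (2 ^ k * fact k))"
    and integrable_noise_power: "integrable M (\<lambda>\<omega>. (\<xi> h \<omega>) ^ n)"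
proof -
  have "(\<integral>\<omega>. (\<xi> h \<omega>) ^ (2 * k) \<partial>M) = norm h ^ (2 * k) * (fact (2 * k) / (2 ^ k * fact k))
      \<and> integrable M (\<lambda>\<omega>. (\<xi> h \<omega>) ^ n)"
  proof (cases "h = 0")
    case True
    have "(\<integral>\<omega>. (\<xi> h \<omega>) ^ (2 * k) \<partial>M) = (\<integral>\<omega>. 0 ^ (2 * k) \<partial>M)"
      using noise_zero True by (intro integral_cong_AE) auto
    moreover have "integrable M (\<lambda>\<omega>. (\<xi> h \<omega>) ^ n) \<longleftrightarrow> integrable M (\<lambda>\<omega>. (0::real) ^ n)"
      using noise_zero True by (intro integrable_cong_AE) auto
    ultimately show ?thesis using True by (cases k) (auto simp: prob_space)
  next
    case False
    then obtain u where u: "norm u = 1" "AE \<omega> in M. \<xi> h \<omega> = norm h * \<xi> u \<omega>" by (rule noise_normalize)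
    have eq: "(\<integral>\<omega>. (\<xi> h \<omega>) ^ (2 * k) \<partial>M) = (\<integral>\<omega>. norm h ^ (2 * k) * (\<xi> u \<omega>) ^ (2 * k) \<partial>M)"
      using u(2) by (intro integral_cong_AE) (auto simp: power_mult_distrib)
    have "integrable M (\<lambda>\<omega>. (\<xi> h \<omega>) ^ n) \<longleftrightarrow> integrable M (\<lambda>\<omega>. norm h ^ n * (\<xi> u \<omega>) ^ n)"
      using u(2) by (intro integrable_cong_AE) (auto simp: power_mult_distrib)
    moreover have "integrable M (\<lambda>\<omega>. (\<xi> u \<omega>) ^ n)"
      by (subst integrable_noise_unit[OF u(1)]) (auto intro: integrable_std_normal_distribution_moment)
    moreover have "(\<integral>\<omega>. (\<xi> u \<omega>) ^ (2 * k) \<partial>M) = fact (2 * k) / (2 ^ k * fact k)"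
      by (subst expectation_noise_unit[OF u(1)]) (auto simp: std_normal_distribution_even_moments)
    ultimately show ?thesis using eq by simp
  qed
  then show "(\<integral>\<omega>. (\<xi> h \<omega>) ^ (2 * k) \<partial>M) = norm h ^ (2 * k) * (fact (2 * k) / (2 ^ k * fact k))"
    "integrable M (\<lambda>\<omega>. (\<xi> h \<omega>) ^ n)" by auto
qed

lemma noise_power_L2: "(\<lambda>\<omega>. (\<xi> h \<omega>) ^ n) \<in> L2 M"
  using integrable_noise_power[of h "n * 2"] by (auto simp: L2_def power_mult)

lemma noise_L2: "\<xi> h \<in> L2 M"
  using noise_power_L2[of h 1] by simp

lemma noise_L2_norm: "L2_norm M (\<xi> h) = norm h"
  using noise_even_moment[of h 1] by (simp add: L2_norm_def L2_inner_def flip: power2_eq_square)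

text \<open>The joint law of orthonormal coordinates without multivariate characteristic functions. The
exponential \<open>exp(i(\<xi>, h))\<close> carries the induction: applied to \<open>h + se\<^sub>k\<close>, the
induction hypothesis factorises, since the squared norms of orthogonal vectors add, and
\<open>fourier_uniqueness\<close> then replaces the exponential of \<open>(\<xi>, e\<^sub>k)\<close> by an indicator.\<close>

lemma joint_noise_law:
  assumes "finite L" "L \<subseteq> J" "\<And>l. l \<in> L \<Longrightarrow> B l \<in> sets borel" "\<And>l. l \<in> L \<Longrightarrow> h \<bullet> e l = 0"
  shows "(\<integral>\<omega>. (\<Prod>l\<in>L. indicator (B l) (\<xi> (e l) \<omega>)) * iexp (\<xi> h \<omega>) \<partial>M)
    = (\<Prod>l\<in>L. \<integral>\<omega>. indicator (B l) (\<xi> (e l) \<omega>) \<partial>M) * (\<integral>\<omega>. iexp (\<xi> h \<omega>) \<partial>M)"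
  using assms
proof (induction L arbitrary: h rule: finite_induct)
  case (insert k L)
  define Q :: "'w \<Rightarrow> complex" where "Q \<omega> = (\<Prod>l\<in>L. indicator (B l) (\<xi> (e l) \<omega>))" for \<omega>
  define p :: complex where "p = (\<Prod>l\<in>L. \<integral>\<omega>. indicator (B l) (\<xi> (e l) \<omega>) \<partial>M)"
  \<comment> \<open>Subtracting this constant gives a \<open>g\<close> whose Fourier transform along \<open>(\<xi>, e\<^sub>k)\<close> vanishes.\<close>
  define c where "c = p * (\<integral>\<omega>. iexp (\<xi> h \<omega>) \<partial>M)"
  define g where "g \<omega> = Q \<omega> * iexp (\<xi> h \<omega>) - c" for \<omega>
  have B: "B l \<in> sets borel" if "l \<in> insert k L" for l using insert.prems that by auto
  have ind[measurable]: "(\<lambda>\<omega>. indicator (B l) (\<xi> (e l) \<omega>) :: complex) \<in> borel_measurable M"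
    if "l \<in> insert k L" for l
  proof -
    note B[OF that, measurable]
    show ?thesis by measurable
  qed
  have Qm[measurable]: "Q \<in> borel_measurable M"
    unfolding Q_def[abs_def] using ind by (intro borel_measurable_prod) auto
  have Qb: "norm (Q \<omega>) \<le> 1" for \<omega>
    unfolding Q_def by (intro order.trans[OF norm_prod_le] prod_le_1) (auto split: split_indicator)
  have intQ: "integrable M (\<lambda>\<omega>. Q \<omega> * iexp (\<xi> h \<omega>))" for h
    by (rule integrable_const_bound[of _ 1]) (auto simp: norm_mult Qb)
  have IH: "(\<integral>\<omega>. Q \<omega> * iexp (\<xi> h' \<omega>) \<partial>M) = p * (\<integral>\<omega>. iexp (\<xi> h' \<omega>) \<partial>M)"
    if "\<And>l. l \<in> L \<Longrightarrow> h' \<bullet> e l = 0" for h'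
    using insert.IH[of h'] insert.prems that by (auto simp: Q_def p_def)
  have kJ: "k \<in> J" using insert.prems by auto
  have hk: "h \<bullet> e k = 0" using insert.prems by auto
  have intg: "integrable M g" unfolding g_def[abs_def] by (intro Bochner_Integration.integrable_diff intQ) simp
  have zero: "(\<integral>\<omega>. g \<omega> * iexp (s * \<xi> (e k) \<omega>) \<partial>M) = 0" for s
  proof -
    have "(\<integral>\<omega>. g \<omega> * iexp (s * \<xi> (e k) \<omega>) \<partial>M)
        = (\<integral>\<omega>. Q \<omega> * iexp (\<xi> (h + s *\<^sub>R e k) \<omega>) - c * iexp (\<xi> (s *\<^sub>R e k) \<omega>) \<partial>M)"
    proof (rule integral_cong_AE)
      show "AE \<omega> in M. g \<omega> * iexp (s * \<xi> (e k) \<omega>)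
          = Q \<omega> * iexp (\<xi> (h + s *\<^sub>R e k) \<omega>) - c * iexp (\<xi> (s *\<^sub>R e k) \<omega>)"
        using noise_add[of h "s *\<^sub>R e k"] noise_scaleR[of s "e k"]
        by eventually_elim (simp add: g_def algebra_simps exp_add)
    qed (auto simp: g_def[abs_def])
    also have "\<dots> = (\<integral>\<omega>. Q \<omega> * iexp (\<xi> (h + s *\<^sub>R e k) \<omega>) \<partial>M) - c * (\<integral>\<omega>. iexp (\<xi> (s *\<^sub>R e k) \<omega>) \<partial>M)"
    proof -
      have "integrable M (\<lambda>\<omega>. iexp (\<xi> (s *\<^sub>R e k) \<omega>))"
        by (rule integrable_const_bound[of _ 1]) auto
      then show ?thesis using intQ by (subst Bochner_Integration.integral_diff) auto
    qed
    also have "(\<integral>\<omega>. Q \<omega> * iexp (\<xi> (h + s *\<^sub>R e k) \<omega>) \<partial>M)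
        = p * (\<integral>\<omega>. iexp (\<xi> (h + s *\<^sub>R e k) \<omega>) \<partial>M)"
    proof (rule IH)
      fix l assume l: "l \<in> L"
      then have "e k \<bullet> e l = 0" using inner_basis[OF kJ, of l] insert by auto
      then show "(h + s *\<^sub>R e k) \<bullet> e l = 0" using l insert.prems by (simp add: inner_add_left)
    qed
    also have "(\<integral>\<omega>. iexp (\<xi> (h + s *\<^sub>R e k) \<omega>) \<partial>M)
        = (\<integral>\<omega>. iexp (\<xi> h \<omega>) \<partial>M) * (\<integral>\<omega>. iexp (\<xi> (s *\<^sub>R e k) \<omega>) \<partial>M)"
    proof -
      have "(norm (h + s *\<^sub>R e k))\<^sup>2 = (norm h)\<^sup>2 + (norm (s *\<^sub>R e k))\<^sup>2"
        unfolding power2_norm_eq_inner using hk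
        by (simp add: inner_add_left inner_add_right inner_commute)
      then have "- ((norm (h + s *\<^sub>R e k))\<^sup>2) / 2 = - ((norm h)\<^sup>2) / 2 + - ((norm (s *\<^sub>R e k))\<^sup>2) / 2"
        by simp
      then show ?thesis
        unfolding noise_characteristic by (simp only: exp_add of_real_mult)
    qed
    finally show ?thesis by (simp add: c_def)
  qed
  have intQk: "integrable M (\<lambda>\<omega>. Q \<omega> * iexp (\<xi> h \<omega>) * indicator (B k) (\<xi> (e k) \<omega>))"
    using ind[of k] by (intro integrable_const_bound[of _ 1]) (auto simp: norm_mult Qb split: split_indicator)
  have intk: "integrable M (\<lambda>\<omega>. indicator (B k) (\<xi> (e k) \<omega>) :: complex)"
    using ind[of k] by (intro integrable_const_bound[of _ 1]) (auto split: split_indicator)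
  have "0 = (\<integral>\<omega>. g \<omega> * indicator (B k) (\<xi> (e k) \<omega>) \<partial>M)"
    using fourier_uniqueness[OF intg noise_measurable zero B[of k]] by simp
  also have "\<dots> = (\<integral>\<omega>. Q \<omega> * iexp (\<xi> h \<omega>) * indicator (B k) (\<xi> (e k) \<omega>) \<partial>M)
      - c * (\<integral>\<omega>. indicator (B k) (\<xi> (e k) \<omega>) \<partial>M)"
    unfolding g_def left_diff_distrib using intQk intk by simp
  finally have "(\<integral>\<omega>. Q \<omega> * iexp (\<xi> h \<omega>) * indicator (B k) (\<xi> (e k) \<omega>) \<partial>M)
      = c * (\<integral>\<omega>. indicator (B k) (\<xi> (e k) \<omega>) \<partial>M)" by simp
  then show ?case
    using insert.hyps by (simp add: Q_def c_def p_def mult_ac)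
qed simp

lemma indep_noise_basis:
  assumes "finite K" "K \<subseteq> J"
  shows "indep_vars (\<lambda>_. borel) (\<lambda>l. \<xi> (e l)) K"
proof (cases "K = {}")
  case True then show ?thesis by (auto simp: indep_vars_def2 indep_sets_def)
next
  case False
  show ?thesis
  proof (subst indep_vars_finite[OF False assms(1), where E = "\<lambda>_. sets borel"])
    show "sets borel = sigma_sets (space borel) (sets (borel :: real measure))"
      by (simp only: sets.sigma_sets_eq)
    show "Int_stable (sets (borel :: real measure))" by (rule sets.Int_stable)
    show "\<forall>A\<in>\<Pi> i\<in>K. sets borel. prob (\<Inter>j\<in>K. \<xi> (e j) -` A j \<inter> space M)
        = (\<Prod>j\<in>K. prob (\<xi> (e j) -` A j \<inter> space M))"
    proof
      fix A assume "A \<in> (\<Pi> i\<in>K. sets (borel :: real measure))"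
      then have A: "A l \<in> sets borel" if "l \<in> K" for l using that by auto
      have ev: "\<xi> (e l) -` A l \<inter> space M \<in> sets M" if "l \<in> K" for l
        using A[OF that] by measurable
      have one: "(\<integral>\<omega>. iexp (\<xi> 0 \<omega>) \<partial>M) = 1" by (simp add: noise_characteristic)
      have "(\<integral>\<omega>. (\<Prod>l\<in>K. indicator (A l) (\<xi> (e l) \<omega>)) * iexp (\<xi> 0 \<omega>) \<partial>M)
          = (\<integral>\<omega>. complex_of_real (indicator (\<Inter>j\<in>K. \<xi> (e j) -` A j \<inter> space M) \<omega>) \<partial>M)"
      proof (rule integral_cong_AE)
        show "AE \<omega> in M. (\<Prod>l\<in>K. indicator (A l) (\<xi> (e l) \<omega>)) * iexp (\<xi> 0 \<omega>)
          = complex_of_real (indicator (\<Inter>j\<in>K. \<xi> (e j) -` A j \<inter> space M) \<omega>)"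
          using noise_zero AE_space
        proof eventually_elim
          case (elim \<omega>)
          show ?case
          proof (cases "\<forall>l\<in>K. \<xi> (e l) \<omega> \<in> A l")
            case True then show ?thesis using elim by (simp add: indicator_def)
          next
            case F: False
            then show ?thesis using assms(1) by (auto simp: indicator_def prod_zero_iff)
          qed
        qed
        show "(\<lambda>\<omega>. (\<Prod>l\<in>K. indicator (A l) (\<xi> (e l) \<omega>)) * iexp (\<xi> 0 \<omega>)) \<in> borel_measurable M"
        proof (intro borel_measurable_times borel_measurable_prod)
          fix l assume "l \<in> K"
          note A[OF this, measurable]
          show "(\<lambda>\<omega>. indicator (A l) (\<xi> (e l) \<omega>) :: complex) \<in> borel_measurable M" by measurable
        qed simp
        show "(\<lambda>\<omega>. complex_of_real (indicator (\<Inter>j\<in>K. \<xi> (e j) -` A j \<inter> space M) \<omega>)) \<in> borel_measurable M"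
        proof -
          have [measurable]: "(\<Inter>j\<in>K. \<xi> (e j) -` A j \<inter> space M) \<in> sets M"
            using ev assms(1) False by (intro sets.finite_INT) auto
          show ?thesis by measurable
        qed
      qed
      also have "\<dots> = complex_of_real (prob (\<Inter>j\<in>K. \<xi> (e j) -` A j \<inter> space M))"
      proof -
        have "(\<Inter>j\<in>K. \<xi> (e j) -` A j \<inter> space M) \<inter> space M = (\<Inter>j\<in>K. \<xi> (e j) -` A j \<inter> space M)"
          using False by auto
        then show ?thesis by simp
      qed
      finally have lhs: "(\<integral>\<omega>. (\<Prod>l\<in>K. indicator (A l) (\<xi> (e l) \<omega>)) * iexp (\<xi> 0 \<omega>) \<partial>M)
        = complex_of_real (prob (\<Inter>j\<in>K. \<xi> (e j) -` A j \<inter> space M))" .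
      have each: "(\<integral>\<omega>. indicator (A l) (\<xi> (e l) \<omega>) \<partial>M) = complex_of_real (prob (\<xi> (e l) -` A l \<inter> space M))" for l
      proof -
        have "(\<integral>\<omega>. indicator (A l) (\<xi> (e l) \<omega>) \<partial>M)
            = (\<integral>\<omega>. complex_of_real (indicator (\<xi> (e l) -` A l \<inter> space M) \<omega>) \<partial>M)"
          by (intro Bochner_Integration.integral_cong) (auto split: split_indicator)
        then show ?thesis by simp
      qed
      have "(\<integral>\<omega>. (\<Prod>l\<in>K. indicator (A l) (\<xi> (e l) \<omega>)) * iexp (\<xi> 0 \<omega>) \<partial>M)
          = (\<Prod>l\<in>K. \<integral>\<omega>. indicator (A l) (\<xi> (e l) \<omega>) \<partial>M) * (\<integral>\<omega>. iexp (\<xi> 0 \<omega>) \<partial>M)"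
        by (rule joint_noise_law[OF assms]) (auto intro: A)
      then have "complex_of_real (prob (\<Inter>j\<in>K. \<xi> (e j) -` A j \<inter> space M))
          = complex_of_real (\<Prod>j\<in>K. prob (\<xi> (e j) -` A j \<inter> space M))"
        unfolding lhs each one by (simp only: mult_1_right of_real_prod)
      then show "prob (\<Inter>j\<in>K. \<xi> (e j) -` A j \<inter> space M) = (\<Prod>j\<in>K. prob (\<xi> (e j) -` A j \<inter> space M))"
        by (simp only: of_real_eq_iff)
    qed
  qed auto
qed

section \<open>Wick monomials and their orthogonality\<close>

definition wick_monomial :: "nat multiset \<Rightarrow> 'w \<Rightarrow> real" where
  "wick_monomial m \<omega> = (\<Prod>l\<in>set_mset m. hermite (count m l) (\<xi> (e l) \<omega>))"

text \<open>The squared norm of the Wick monomial, also written \<open>m!\<close>.\<close>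

definition multiset_fact :: "nat multiset \<Rightarrow> real" where
  "multiset_fact m = (\<Prod>l\<in>set_mset m. fact (count m l))"

lemma multiset_fact_pos [simp]: "multiset_fact m > 0"
  by (simp add: multiset_fact_def prod_pos)

lemma wick_monomial_prod:
  assumes "finite K" "set_mset m \<subseteq> K"
  shows "wick_monomial m \<omega> = (\<Prod>l\<in>K. hermite (count m l) (\<xi> (e l) \<omega>))"
  unfolding wick_monomial_def using assms
  by (intro prod.mono_neutral_left) (auto simp: not_in_iff)

lemma multiset_fact_prod:
  assumes "finite K" "set_mset m \<subseteq> K"
  shows "multiset_fact m = (\<Prod>l\<in>K. fact (count m l))"
  unfolding multiset_fact_def using assms
  by (intro prod.mono_neutral_left) (auto simp: not_in_iff)

lemma wick_monomial_measurable [measurable]: "wick_monomial m \<in> borel_measurable M"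
  unfolding wick_monomial_def[abs_def] by measurable

lemma
  assumes "set_mset m \<subseteq> J" "set_mset m' \<subseteq> J"
  shows wick_monomial_inner: "L2_inner M (wick_monomial m) (wick_monomial m')
      = (if m = m' then multiset_fact m else 0)"
    and wick_monomial_integrable: "integrable M (\<lambda>\<omega>. wick_monomial m \<omega> * wick_monomial m' \<omega>)"
proof -
  define K where "K = set_mset m \<union> set_mset m'"
  have K: "finite K" "K \<subseteq> J" "set_mset m \<subseteq> K" "set_mset m' \<subseteq> K" using assms by (auto simp: K_def)
  define Y where "Y l \<omega> = hermite (count m l) (\<xi> (e l) \<omega>) * hermite (count m' l) (\<xi> (e l) \<omega>)" for l \<omega>
  have eq: "wick_monomial m \<omega> * wick_monomial m' \<omega> = (\<Prod>l\<in>K. Y l \<omega>)" for \<omega>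
    by (simp add: wick_monomial_prod[OF K(1,3)] wick_monomial_prod[OF K(1,4)] Y_def prod.distrib)
  have indep: "indep_vars (\<lambda>_. borel) Y K"
    unfolding Y_def by (rule indep_vars_compose2[OF indep_noise_basis[OF K(1,2)]]) measurable
  have int: "integrable M (Y l)" if "l \<in> K" for l
    unfolding Y_def[abs_def] using K(2) that integrable_std_normal_hermite
    by (subst integrable_noise_unit) auto
  have EY: "(\<integral>\<omega>. Y l \<omega> \<partial>M) = (if count m l = count m' l then fact (count m l) else 0)" if "l \<in> K" for l
    unfolding Y_def[abs_def] using K(2) that
    by (subst expectation_noise_unit) (auto simp: hermite_orthogonal)
  show "integrable M (\<lambda>\<omega>. wick_monomial m \<omega> * wick_monomial m' \<omega>)"
    unfolding eq by (rule indep_vars_integrable[OF K(1) indep int])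
  have "L2_inner M (wick_monomial m) (wick_monomial m') = (\<Prod>l\<in>K. \<integral>\<omega>. Y l \<omega> \<partial>M)"
    unfolding L2_inner_def inner_real_def eq by (rule indep_vars_lebesgue_integral[OF K(1) indep int])
  also have "\<dots> = (\<Prod>l\<in>K. if count m l = count m' l then fact (count m l) else 0)"
    by (intro prod.cong refl EY)
  also have "\<dots> = (if m = m' then multiset_fact m else 0)"
  proof (cases "m = m'")
    case True then show ?thesis by (simp add: multiset_fact_prod[OF K(1,4)])
  next
    case False
    then obtain l where "count m l \<noteq> count m' l" by (auto simp: multiset_eq_iff)
    moreover from this have "l \<in> K" by (force simp: K_def not_in_iff)
    ultimately show ?thesis using False K(1) by (auto intro!: prod_zero)
  qed
  finally show "L2_inner M (wick_monomial m) (wick_monomial m') = (if m = m' then multiset_fact m else 0)" .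
qed

lemma wick_monomial_L2: "set_mset m \<subseteq> J \<Longrightarrow> wick_monomial m \<in> L2 M"
  using wick_monomial_integrable[of m m] by (simp add: L2_def power2_eq_square)

lemma wick_monomial_empty [simp]: "wick_monomial {#} = (\<lambda>_. 1)"
  by (simp add: fun_eq_iff wick_monomial_def)

section \<open>Completeness of the Wick monomials\<close>

text \<open>The Hermite recurrence in the coordinate \<open>k\<close>; the other factors are unaffected.\<close>

lemma wick_monomial_times_noise:
  "\<xi> (e k) \<omega> * wick_monomial m \<omega>
    = wick_monomial (add_mset k m) \<omega> + real (count m k) * wick_monomial (m - {#k#}) \<omega>"
proof -
  define K where "K = insert k (set_mset m)"
  define R where "R = (\<Prod>l\<in>K - {k}. hermite (count m l) (\<xi> (e l) \<omega>))"
  have K: "finite K" "k \<in> K" by (auto simp: K_def)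
  have R: "wick_monomial m' \<omega> = hermite (count m' k) (\<xi> (e k) \<omega>) * R"
    if "set_mset m' \<subseteq> K" "\<And>l. l \<noteq> k \<Longrightarrow> count m' l = count m l" for m'
    using that(2) by (simp add: wick_monomial_prod[OF K(1) that(1)] prod.remove[OF K] R_def)
  have "wick_monomial m \<omega> = hermite (count m k) (\<xi> (e k) \<omega>) * R"
    by (rule R) (auto simp: K_def)
  moreover have "wick_monomial (add_mset k m) \<omega> = hermite (Suc (count m k)) (\<xi> (e k) \<omega>) * R"
    by (subst R) (auto simp: K_def)
  moreover have "wick_monomial (m - {#k#}) \<omega> = hermite (count m k - 1) (\<xi> (e k) \<omega>) * R"
    by (subst R) (auto simp: K_def dest: in_diffD)
  ultimately show ?thesis
    using hermite_times[of "\<xi> (e k) \<omega>" "count m k"] by (metis distrib_right mult.assoc)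
qed

text \<open>The linear span of the Wick monomials. It is stable under multiplication by the noise and therefore
contains all powers of \<open>(\<xi>, h)\<close>, for \<open>h\<close> in the span of the basis; this is all that completeness
requires of it.\<close>

inductive_set wick_polynomials :: "('w \<Rightarrow> real) set" where
  zero: "(\<lambda>_. 0) \<in> wick_polynomials"
| add_monomial: "p \<in> wick_polynomials \<Longrightarrow> set_mset m \<subseteq> J \<Longrightarrow>
    (\<lambda>\<omega>. p \<omega> + c * wick_monomial m \<omega>) \<in> wick_polynomials"

lemma wick_polynomials_monomial: "set_mset m \<subseteq> J \<Longrightarrow> wick_monomial m \<in> wick_polynomials"
  using add_monomial[OF zero, of m 1] by simp

lemma wick_polynomials_add:
  assumes "p \<in> wick_polynomials" "q \<in> wick_polynomials"
  shows "(\<lambda>\<omega>. p \<omega> + q \<omega>) \<in> wick_polynomials"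
  using assms(2)
proof induction
  case (add_monomial q m c)
  then show ?case
    using wick_polynomials.add_monomial[of "\<lambda>\<omega>. p \<omega> + q \<omega>" m c] by (simp add: add.assoc)
qed (use assms(1) in simp)

lemma wick_polynomials_scale:
  assumes "p \<in> wick_polynomials" shows "(\<lambda>\<omega>. a * p \<omega>) \<in> wick_polynomials"
  using assms
proof induction
  case (add_monomial q m c)
  then show ?case
    using wick_polynomials.add_monomial[of "\<lambda>\<omega>. a * q \<omega>" m "a * c"]
    by (simp add: distrib_left mult.assoc)
qed (simp add: wick_polynomials.zero)

lemma wick_polynomials_times_noise_basis:
  assumes "p \<in> wick_polynomials" "k \<in> J"
  shows "(\<lambda>\<omega>. \<xi> (e k) \<omega> * p \<omega>) \<in> wick_polynomials"
  using assms(1)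
proof induction
  case (add_monomial q m c)
  have "set_mset (m - {#k#}) \<subseteq> J" using add_monomial.hyps(2) by (auto dest: in_diffD)
  then have "(\<lambda>\<omega>. \<xi> (e k) \<omega> * q \<omega> + (c * wick_monomial (add_mset k m) \<omega>
      + (c * real (count m k)) * wick_monomial (m - {#k#}) \<omega>)) \<in> wick_polynomials"
    using add_monomial assms(2)
    by (intro wick_polynomials_add wick_polynomials_scale wick_polynomials_monomial) auto
  moreover have "\<xi> (e k) \<omega> * (q \<omega> + c * wick_monomial m \<omega>) = \<xi> (e k) \<omega> * q \<omega> +
      (c * wick_monomial (add_mset k m) \<omega> + (c * real (count m k)) * wick_monomial (m - {#k#}) \<omega>)" for \<omega>
    using arg_cong[OF wick_monomial_times_noise[of k \<omega> m], of "(*) c"] by (simp add: algebra_simps)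
  ultimately show ?case by simp
qed (simp add: wick_polynomials.zero)

lemma wick_polynomials_times_noise:
  assumes "h \<in> span (e ` J)"
  shows "p \<in> wick_polynomials \<Longrightarrow> \<exists>q\<in>wick_polynomials. AE \<omega> in M. q \<omega> = \<xi> h \<omega> * p \<omega>"
  using assms
proof (induction arbitrary: p rule: span_induct_alt)
  case base
  show ?case using noise_zero by (intro bexI[OF _ wick_polynomials.zero]) auto
next
  case (step c x y)
  then obtain k where k: "k \<in> J" "x = e k" by auto
  obtain q where q: "q \<in> wick_polynomials" "AE \<omega> in M. q \<omega> = \<xi> y \<omega> * p \<omega>" using step by blast
  show ?case
  proof (rule bexI)
    show "(\<lambda>\<omega>. c * (\<xi> (e k) \<omega> * p \<omega>) + q \<omega>) \<in> wick_polynomials"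
      using q(1) step.prems k by (intro wick_polynomials_add wick_polynomials_scale wick_polynomials_times_noise_basis)
    show "AE \<omega> in M. c * (\<xi> (e k) \<omega> * p \<omega>) + q \<omega> = \<xi> (c *\<^sub>R x + y) \<omega> * p \<omega>"
      using noise_linear[of c x 1 y] q(2) by eventually_elim (simp add: k algebra_simps)
  qed
qed

lemma noise_power_wick_polynomial:
  assumes "h \<in> span (e ` J)"
  shows "\<exists>q\<in>wick_polynomials. AE \<omega> in M. q \<omega> = \<xi> h \<omega> ^ n"
proof (induction n)
  case 0
  show ?case using wick_polynomials_monomial[of "{#}"] by (intro bexI[of _ "\<lambda>_. 1"]) auto
next
  case (Suc n)
  then obtain q where q: "q \<in> wick_polynomials" "AE \<omega> in M. q \<omega> = \<xi> h \<omega> ^ n" by blast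
  obtain r where r: "r \<in> wick_polynomials" "AE \<omega> in M. r \<omega> = \<xi> h \<omega> * q \<omega>"
    using wick_polynomials_times_noise[OF assms q(1)] by blast
  show ?case
  proof (rule bexI[OF _ r(1)])
    show "AE \<omega> in M. r \<omega> = \<xi> h \<omega> ^ Suc n" using q(2) r(2) by eventually_elim simp
  qed
qed

lemma wick_polynomials_orthogonal:
  assumes "p \<in> wick_polynomials" "f \<in> L2 M"
    and "\<And>m. set_mset m \<subseteq> J \<Longrightarrow> L2_inner M f (wick_monomial m) = 0"
  shows "p \<in> L2 M \<and> L2_inner M p f = 0"
  using assms(1)
proof induction
  case zero then show ?case by (simp add: L2_inner_def)
next
  case (add_monomial q m c)
  note m = L2_mult[OF wick_monomial_L2[OF add_monomial.hyps(2)], of c]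
  then show ?case
    using add_monomial assms(2) assms(3)[of m] L2_inner_commute[of M "wick_monomial m" f]
    by (auto simp: L2_inner_add_left L2_inner_mult_left intro: L2_add)
qed

text \<open>Cauchy--Schwarz in the form used for the two approximation arguments below, where a real square
integrable \<open>f\<close> is integrated against a complex error term.\<close>

lemma integral_mult_bound:
  fixes f G :: "'w \<Rightarrow> real" and g :: "'w \<Rightarrow> complex"
  assumes f: "f \<in> L2 M" and G: "G \<in> L2 M" and g[measurable]: "g \<in> borel_measurable M"
    and le: "AE \<omega> in M. cmod (g \<omega>) \<le> \<bar>G \<omega>\<bar>"
  shows "integrable M (\<lambda>\<omega>. f \<omega> * g \<omega>)"
    and "cmod (\<integral>\<omega>. f \<omega> * g \<omega> \<partial>M) \<le> L2_norm M f * L2_norm M G"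
proof -
  have [measurable]: "f \<in> borel_measurable M" "G \<in> borel_measurable M" using f G by (auto simp: L2_def)
  have a: "(\<lambda>\<omega>. \<bar>f \<omega>\<bar>) \<in> L2 M" "(\<lambda>\<omega>. \<bar>G \<omega>\<bar>) \<in> L2 M" using f G by (auto simp: L2_def)
  have n: "L2_norm M (\<lambda>\<omega>. \<bar>f \<omega>\<bar>) = L2_norm M f" "L2_norm M (\<lambda>\<omega>. \<bar>G \<omega>\<bar>) = L2_norm M G"
    by (simp_all add: L2_norm_def L2_inner_def)
  have int: "integrable M (\<lambda>\<omega>. \<bar>f \<omega>\<bar> * \<bar>G \<omega>\<bar>)" using L2_inner_integrable[OF a] by simp
  have le': "AE \<omega> in M. cmod (f \<omega> * g \<omega>) \<le> \<bar>f \<omega>\<bar> * \<bar>G \<omega>\<bar>"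
    using le by eventually_elim (auto simp: norm_mult intro: mult_left_mono)
  show i: "integrable M (\<lambda>\<omega>. f \<omega> * g \<omega>)"
    by (rule Bochner_Integration.integrable_bound[OF int]) (use le' in auto)
  have "cmod (\<integral>\<omega>. f \<omega> * g \<omega> \<partial>M) \<le> (\<integral>\<omega>. \<bar>f \<omega>\<bar> * \<bar>G \<omega>\<bar> \<partial>M)"
    by (rule order.trans[OF integral_norm_bound integral_mono_AE[OF integrable_norm[OF i] int le']])
  also have "\<dots> \<le> L2_norm M f * L2_norm M G"
    using L2_Cauchy_Schwarz[OF a] unfolding n by (simp add: L2_inner_def)
  finally show "cmod (\<integral>\<omega>. f \<omega> * g \<omega> \<partial>M) \<le> L2_norm M f * L2_norm M G" .
qed

text \<open>The Gaussian moment \<open>E(\<xi>, h)\<^sup>2\<^sup>n = |h|\<^sup>2\<^sup>n (2n)! / (2\<^sup>n n!)\<close> is at most \<open>(2|h|\<^sup>2)\<^sup>n n!\<close>,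
because the central binomial coefficient is at most \<open>4\<^sup>n\<close>. Hence the Taylor remainder of
\<open>exp(i(\<xi>, h))\<close> tends to \<open>0\<close> in \<open>L\<^sup>2\<close>.\<close>

lemma noise_power_L2_norm_bound:
  "(L2_norm M (\<lambda>\<omega>. \<xi> h \<omega> ^ n) / fact n)\<^sup>2 \<le> (2 * (norm h)\<^sup>2) ^ n / fact n"
proof -
  have "(L2_norm M (\<lambda>\<omega>. \<xi> h \<omega> ^ n))\<^sup>2 = (\<integral>\<omega>. \<xi> h \<omega> ^ (2 * n) \<partial>M)"
    by (simp add: L2_norm_power2 L2_inner_def mult_2 power_add)
  also have "\<dots> = norm h ^ (2 * n) * (fact (2 * n) / (2 ^ n * fact n))" by (rule noise_even_moment)
  finally have "(L2_norm M (\<lambda>\<omega>. \<xi> h \<omega> ^ n) / fact n)\<^sup>2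
      = (fact (2 * n) / (fact n * fact n)) * norm h ^ (2 * n) / (2 ^ n * fact n)"
    unfolding power_divide by (simp add: power2_eq_square mult_ac)
  also have "fact (2 * n) / (fact n * fact n) = real (2 * n choose n)"
    by (subst binomial_fact) (simp_all add: mult_2)
  also have "real (2 * n choose n) * norm h ^ (2 * n) / (2 ^ n * fact n)
      \<le> real (2 ^ (2 * n)) * norm h ^ (2 * n) / (2 ^ n * fact n)"
    using binomial_le_pow2[of "2 * n" n] by (intro divide_right_mono mult_right_mono) (simp_all only: of_nat_le_iff, simp_all)
  also have "\<dots> = (2 * (norm h)\<^sup>2) ^ n / fact n"
  proof -
    have "real (2 ^ (2 * n)) = 2 ^ n * 2 ^ n" by (simp add: mult_2 power_add)
    then show ?thesis by (simp add: power_mult power_mult_distrib)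
  qed
  finally show ?thesis .
qed

lemma iexp_diff_le: "cmod (iexp x - iexp y) \<le> \<bar>x - y\<bar>"
proof -
  have "iexp x - iexp y = iexp y * (iexp (x - y) - 1)"
    by (simp add: algebra_simps flip: exp_add)
  then have "cmod (iexp x - iexp y) = cmod (iexp (x - y) - 1)" by (simp add: norm_mult)
  also have "\<dots> \<le> \<bar>x - y\<bar>" using iexp_approx1[of "x - y" 0] by simp
  finally show ?thesis .
qed

text \<open>For \<open>h\<close> in the span of the basis, all Taylor polynomials of \<open>exp(i(\<xi>, h))\<close> are orthogonal
to \<open>f\<close>, and the remainder is small in \<open>L\<^sup>2\<close>. General \<open>h\<close> are reached by density, as
\<open>h \<mapsto> (\<xi>, h)\<close> is an isometry into \<open>L\<^sup>2\<close> and \<open>exp(ix)\<close> is Lipschitz.\<close>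

lemma orthogonal_iexp_noise:
  fixes f :: "'w \<Rightarrow> real"
  assumes f: "f \<in> L2 M" and orth: "\<And>m. set_mset m \<subseteq> J \<Longrightarrow> L2_inner M f (wick_monomial m) = 0"
  shows "(\<integral>\<omega>. f \<omega> * iexp (\<xi> h \<omega>) \<partial>M) = 0"
proof -
  have span: "(\<integral>\<omega>. f \<omega> * iexp (\<xi> h \<omega>) \<partial>M) = 0" if h: "h \<in> span (e ` J)" for h
  proof -
    define I where "I = (\<integral>\<omega>. f \<omega> * iexp (\<xi> h \<omega>) \<partial>M)"
    have pow: "(\<integral>\<omega>. f \<omega> * complex_of_real (\<xi> h \<omega> ^ k) \<partial>M) = 0"
      and pow_int: "integrable M (\<lambda>\<omega>. f \<omega> * complex_of_real (\<xi> h \<omega> ^ k))" for k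
    proof -
      obtain q where q: "q \<in> wick_polynomials" "AE \<omega> in M. q \<omega> = \<xi> h \<omega> ^ k"
        using noise_power_wick_polynomial[OF h] by blast
      have "L2_inner M (\<lambda>\<omega>. \<xi> h \<omega> ^ k) f = 0"
        using wick_polynomials_orthogonal[OF q(1) f orth] L2_inner_cong_AE[OF _ noise_power_L2 f q(2)] by auto
      moreover have "(\<integral>\<omega>. f \<omega> * complex_of_real (\<xi> h \<omega> ^ k) \<partial>M)
          = (\<integral>\<omega>. complex_of_real (f \<omega> * \<xi> h \<omega> ^ k) \<partial>M)" by simp
      ultimately show "(\<integral>\<omega>. f \<omega> * complex_of_real (\<xi> h \<omega> ^ k) \<partial>M) = 0"
        by (simp only: integral_complex_of_real) (simp add: L2_inner_def mult.commute)
      show "integrable M (\<lambda>\<omega>. f \<omega> * complex_of_real (\<xi> h \<omega> ^ k))"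
        by (rule integral_mult_bound[OF f noise_power_L2[of h k]]) (auto simp: norm_power power_abs)
    qed
    have "(cmod I)\<^sup>2 \<le> (L2_norm M f)\<^sup>2 * ((2 * (norm h)\<^sup>2) ^ n / fact n)" if "n > 0" for n
    proof -
      obtain N where n: "n = Suc N" using \<open>n > 0\<close> by (cases n) auto
      define T where "T \<omega> = (\<Sum>k\<le>N. (\<i> * \<xi> h \<omega>) ^ k / fact k)" for \<omega>
      have T: "f \<omega> * T \<omega> = (\<Sum>k\<le>N. (\<i> ^ k / fact k) * (f \<omega> * complex_of_real (\<xi> h \<omega> ^ k)))" for \<omega>
        by (simp add: T_def sum_distrib_left power_mult_distrib mult_ac)
      have intT: "integrable M (\<lambda>\<omega>. f \<omega> * T \<omega>)"
        unfolding T by (intro Bochner_Integration.integrable_sum integrable_mult_right pow_int)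
      have "(\<integral>\<omega>. f \<omega> * T \<omega> \<partial>M) = 0"
        unfolding T by (subst Bochner_Integration.integral_sum)
          (simp_all only: integral_mult_right_zero pow integrable_mult_right pow_int mult_zero_right sum.neutral_const)
      moreover have int1: "integrable M (\<lambda>\<omega>. f \<omega> * iexp (\<xi> h \<omega>))"
        by (rule integral_mult_bound[OF f L2_const[of 1]]) auto
      ultimately have I: "I = (\<integral>\<omega>. f \<omega> * (iexp (\<xi> h \<omega>) - T \<omega>) \<partial>M)"
        using intT by (simp add: I_def right_diff_distrib)
      have G: "(\<lambda>\<omega>. (1 / fact n) * \<xi> h \<omega> ^ n) \<in> L2 M" by (rule L2_mult[OF noise_power_L2])
      have "cmod I \<le> L2_norm M f * L2_norm M (\<lambda>\<omega>. (1 / fact n) * \<xi> h \<omega> ^ n)"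
        unfolding I
      proof (rule integral_mult_bound(2)[OF f G])
        show "(\<lambda>\<omega>. iexp (\<xi> h \<omega>) - T \<omega>) \<in> borel_measurable M" unfolding T_def[abs_def] by measurable
        show "AE \<omega> in M. cmod (iexp (\<xi> h \<omega>) - T \<omega>) \<le> \<bar>1 / fact n * \<xi> h \<omega> ^ n\<bar>"
          using iexp_approx1[of "\<xi> h _" N] by (auto simp: T_def n abs_mult power_abs simp del: fact_Suc power_Suc)
      qed
      also have "L2_norm M (\<lambda>\<omega>. (1 / fact n) * \<xi> h \<omega> ^ n) = L2_norm M (\<lambda>\<omega>. \<xi> h \<omega> ^ n) / fact n"
        using L2_norm_scaleR[of M "1 / fact n" "\<lambda>\<omega>. \<xi> h \<omega> ^ n"] by simp
      finally have "(cmod I)\<^sup>2 \<le> (L2_norm M f * (L2_norm M (\<lambda>\<omega>. \<xi> h \<omega> ^ n) / fact n))\<^sup>2"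
        by (intro power_mono) auto
      also have "\<dots> = (L2_norm M f)\<^sup>2 * (L2_norm M (\<lambda>\<omega>. \<xi> h \<omega> ^ n) / fact n)\<^sup>2"
        by (rule power_mult_distrib)
      also have "\<dots> \<le> (L2_norm M f)\<^sup>2 * ((2 * (norm h)\<^sup>2) ^ n / fact n)"
        by (intro mult_left_mono noise_power_L2_norm_bound) simp
      finally show ?thesis .
    qed
    then have ev: "\<forall>\<^sub>F n in sequentially. (cmod I)\<^sup>2 \<le> (L2_norm M f)\<^sup>2 * ((2 * (norm h)\<^sup>2) ^ n / fact n)"
      by (rule eventually_mono[OF eventually_gt_at_top[of 0]])
    have "(\<lambda>n. (2 * (norm h)\<^sup>2) ^ n / fact n) \<longlonglongrightarrow> 0"
      using summable_LIMSEQ_zero[OF summable_exp[of "2 * (norm h)\<^sup>2"]] by (simp add: field_simps)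
    then have "(\<lambda>n. (L2_norm M f)\<^sup>2 * ((2 * (norm h)\<^sup>2) ^ n / fact n)) \<longlonglongrightarrow> 0"
      by (rule tendsto_mult_right_zero)
    from tendsto_lowerbound[OF this ev] have "(cmod I)\<^sup>2 \<le> 0" by simp
    then show ?thesis by (simp add: I_def)
  qed
  have "cmod (\<integral>\<omega>. f \<omega> * iexp (\<xi> h \<omega>) \<partial>M) \<le> L2_norm M f * \<epsilon>" if "\<epsilon> > 0" for \<epsilon>
  proof -
    have "h \<in> closure (span (e ` J))" using basis by (simp add: orthonormal_basis_def)
    then obtain h' where h': "h' \<in> span (e ` J)" "dist h' h < \<epsilon>"
      using \<open>\<epsilon> > 0\<close> by (auto simp: closure_approachable)
    have int: "integrable M (\<lambda>\<omega>. f \<omega> * iexp (\<xi> k \<omega>))" for k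
      by (rule integral_mult_bound[OF f L2_const[of 1]]) auto
    have "(\<integral>\<omega>. f \<omega> * iexp (\<xi> h \<omega>) \<partial>M) = (\<integral>\<omega>. f \<omega> * (iexp (\<xi> h \<omega>) - iexp (\<xi> h' \<omega>)) \<partial>M)"
      using int span[OF h'(1)] by (simp add: right_diff_distrib)
    also have "cmod \<dots> \<le> L2_norm M f * L2_norm M (\<xi> (h - h'))"
    proof (rule integral_mult_bound(2)[OF f noise_L2])
      show "AE \<omega> in M. cmod (iexp (\<xi> h \<omega>) - iexp (\<xi> h' \<omega>)) \<le> \<bar>\<xi> (h - h') \<omega>\<bar>"
        using noise_diff[of h h'] by eventually_elim (use iexp_diff_le in auto)
    qed measurable
    also have "\<dots> \<le> L2_norm M f * \<epsilon>"
      using h'(2) by (intro mult_left_mono) (auto simp: noise_L2_norm dist_norm norm_minus_commute)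
    finally show ?thesis .
  qed
  note bound = this
  have "cmod (\<integral>\<omega>. f \<omega> * iexp (\<xi> h \<omega>) \<partial>M) \<le> 0 + \<epsilon>" if "\<epsilon> > 0" for \<epsilon>
  proof -
    have pos: "L2_norm M f + 1 > 0" using L2_norm_nonneg[of M f] by linarith
    have "cmod (\<integral>\<omega>. f \<omega> * iexp (\<xi> h \<omega>) \<partial>M) \<le> L2_norm M f * (\<epsilon> / (L2_norm M f + 1))"
      using bound[of "\<epsilon> / (L2_norm M f + 1)"] pos that by simp
    also have "\<dots> \<le> \<epsilon>" using pos that by (simp add: field_simps)
    finally show ?thesis by simp
  qed
  then have "cmod (\<integral>\<omega>. f \<omega> * iexp (\<xi> h \<omega>) \<partial>M) \<le> 0" by (rule field_le_epsilon)
  then show ?thesis by simp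
qed

text \<open>Exponentials are traded for indicators one at a time, with the free vector \<open>h\<close> providing the
exponential of the next variable.\<close>

lemma orthogonal_cylinder:
  fixes f :: "'w \<Rightarrow> real"
  assumes f: "f \<in> L2 M" and orth: "\<And>m. set_mset m \<subseteq> J \<Longrightarrow> L2_inner M f (wick_monomial m) = 0"
  assumes "\<forall>(k, B)\<in>set L. B \<in> sets borel"
  shows "(\<integral>\<omega>. complex_of_real (f \<omega>) * (\<Prod>(k, B)\<leftarrow>L. indicator B (\<xi> k \<omega>)) * iexp (\<xi> h \<omega>) \<partial>M) = 0"
  using assms(3)
proof (induction L arbitrary: h)
  case Nil then show ?case using orthogonal_iexp_noise[OF f orth] by simp
next
  case (Cons kB L)
  obtain k B where kB: "kB = (k, B)" by (cases kB)
  have [measurable]: "B \<in> sets borel" using Cons.prems kB by auto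
  define Q :: "'w \<Rightarrow> complex" where "Q \<omega> = (\<Prod>(k, B)\<leftarrow>L. indicator B (\<xi> k \<omega>))" for \<omega>
  have Q: "Q \<in> borel_measurable M \<and> (\<forall>\<omega>. cmod (Q \<omega>) \<le> 1)"
  proof -
    have "\<forall>(k, B)\<in>set L. B \<in> sets borel" using Cons.prems by auto
    then show ?thesis unfolding Q_def[abs_def]
    proof (induction L)
      case (Cons a L)
      obtain k B where a: "a = (k, B)" by (cases a)
      then have [measurable]: "B \<in> sets borel" using Cons.prems by auto
      have [measurable]: "(\<lambda>\<omega>. (\<Prod>(k, B)\<leftarrow>L. indicator B (\<xi> k \<omega>)) :: complex) \<in> borel_measurable M"
        using Cons by auto
      show ?case using Cons by (auto simp: a norm_mult split: split_indicator)
    qed simp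
  qed
  then have [measurable]: "Q \<in> borel_measurable M" by simp
  have int: "integrable M (\<lambda>\<omega>. f \<omega> * Q \<omega> * iexp (\<xi> h \<omega>))" for h
    using integral_mult_bound(1)[OF f L2_const[of 1], of "\<lambda>\<omega>. Q \<omega> * iexp (\<xi> h \<omega>)"] Q
    by (simp add: norm_mult mult.assoc)
  have "(\<integral>\<omega>. (f \<omega> * Q \<omega> * iexp (\<xi> h \<omega>)) * iexp (s * \<xi> k \<omega>) \<partial>M) = 0" for s
  proof -
    have [measurable]: "f \<in> borel_measurable M" using f by (simp add: L2_def)
    have "(\<integral>\<omega>. (f \<omega> * Q \<omega> * iexp (\<xi> h \<omega>)) * iexp (s * \<xi> k \<omega>) \<partial>M)
        = (\<integral>\<omega>. f \<omega> * Q \<omega> * iexp (\<xi> (h + s *\<^sub>R k) \<omega>) \<partial>M)"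
    proof (rule integral_cong_AE)
      show "AE \<omega> in M. (f \<omega> * Q \<omega> * iexp (\<xi> h \<omega>)) * iexp (s * \<xi> k \<omega>)
          = f \<omega> * Q \<omega> * iexp (\<xi> (h + s *\<^sub>R k) \<omega>)"
        using noise_linear[of 1 h s k] by eventually_elim (simp add: algebra_simps exp_add)
    qed measurable
    also have "\<dots> = 0"
    proof -
      have "\<forall>(k, B)\<in>set L. B \<in> sets borel" using Cons.prems by auto
      from Cons.IH[OF this, of "h + s *\<^sub>R k"] show ?thesis unfolding Q_def .
    qed
    finally show ?thesis .
  qed
  from fourier_uniqueness[OF int noise_measurable this, of B]
  show ?case by (simp add: kB Q_def mult_ac)
qed

text \<open>Cylinder sets form a generator of the \<open>\<sigma>\<close>-algebra that is stable under intersection, so the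
integral of \<open>f\<close> vanishes over every measurable set, in particular over \<open>{f \<ge> 0}\<close> and
\<open>{f < 0}\<close>.\<close>

lemma wick_monomials_complete:
  fixes f :: "'w \<Rightarrow> real"
  assumes f: "f \<in> L2 M" and orth: "\<And>m. set_mset m \<subseteq> J \<Longrightarrow> L2_inner M f (wick_monomial m) = 0"
  shows "AE \<omega> in M. f \<omega> = 0"
proof -
  have [measurable]: "f \<in> borel_measurable M" using f by (simp add: L2_def)
  have fi: "integrable M f" using L2_inner_integrable[OF f L2_const[of 1]] by simp
  have fA: "set_integrable M A f" if "A \<in> sets M" for A
    unfolding set_integrable_def by (rule integrable_mult_indicator[OF that fi])
  define cyl where "cyl L = {\<omega>\<in>space M. \<forall>(k, B)\<in>set L. \<xi> k \<omega> \<in> B}" for L :: "('h \<times> real set) list"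
  define C where "C = {cyl L | L. \<forall>(k, B)\<in>set L. B \<in> sets borel}"
  have cyl_append: "cyl (L @ L') = cyl L \<inter> cyl L'" for L L' by (auto simp: cyl_def)
  have "cyl L \<in> sets M" if "\<forall>(k, B)\<in>set L. B \<in> sets borel" for L
    using that
  proof (induction L)
    case Nil then show ?case by (simp add: cyl_def)
  next
    case (Cons a L)
    obtain k B where a: "a = (k, B)" by (cases a)
    then have "\<xi> k -` B \<inter> space M \<in> sets M" using Cons.prems by (intro measurable_sets[OF noise_measurable]) auto
    moreover have "cyl (a # L) = (\<xi> k -` B \<inter> space M) \<inter> cyl L" by (auto simp: cyl_def a)
    ultimately show ?case using Cons by auto
  qed
  then have C: "C \<subseteq> sets M" by (auto simp: C_def)
  have stable: "Int_stable C"
  proof (rule Int_stableI)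
    fix a b assume "a \<in> C" "b \<in> C"
    then obtain L L' where "a = cyl L" "b = cyl L'" "\<forall>(k, B)\<in>set L. B \<in> sets borel" "\<forall>(k, B)\<in>set L'. B \<in> sets borel"
      by (auto simp: C_def)
    then show "a \<inter> b \<in> C" unfolding C_def by (auto simp: cyl_append[symmetric] intro!: exI[of _ "L @ L'"])
  qed
  have sets_C: "sets M = sigma_sets (space M) C"
  proof (rule antisym)
    have "{\<xi> h -` B \<inter> space M | h B. B \<in> sets borel} \<subseteq> C"
    proof safe
      fix h and B :: "real set" assume "B \<in> sets borel"
      moreover have "\<xi> h -` B \<inter> space M = cyl [(h, B)]" by (auto simp: cyl_def)
      ultimately show "\<xi> h -` B \<inter> space M \<in> C" unfolding C_def by (auto intro!: exI[of _ "[(h, B)]"])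
    qed
    then show "sets M \<subseteq> sigma_sets (space M) C"
      unfolding generated noise_sigma_def by (rule sigma_sets_mono')
    show "sigma_sets (space M) C \<subseteq> sets M" using C by (rule sets.sigma_sets_subset)
  qed
  have zero: "(LINT \<omega>:A|M. f \<omega>) = 0" if "A \<in> sets M" for A
  proof -
    have "A \<in> sigma_sets (space M) C" using that sets_C by simp
    have "C \<subseteq> Pow (space M)" using C sets.sets_into_space by blast
    from stable this \<open>A \<in> sigma_sets (space M) C\<close> show ?thesis
    proof (induction rule: sigma_sets_induct_disjoint)
      case (basic A)
      then obtain L where L: "A = cyl L" "\<forall>(k, B)\<in>set L. B \<in> sets borel" by (auto simp: C_def)
      have ind: "(\<Prod>(k, B)\<leftarrow>L. indicator B (\<xi> k \<omega>)) = (indicator (cyl L) \<omega> :: complex)" if "\<omega> \<in> space M" for \<omega>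
        using that by (induction L) (auto simp: cyl_def split: split_indicator)
      have "complex_of_real (LINT \<omega>:A|M. f \<omega>) = (\<integral>\<omega>. complex_of_real (indicator A \<omega> * f \<omega>) \<partial>M)"
        by (simp only: set_lebesgue_integral_def real_scaleR_def integral_complex_of_real)
      also have "\<dots> = (\<integral>\<omega>. complex_of_real (f \<omega>) * (\<Prod>(k, B)\<leftarrow>L. indicator B (\<xi> k \<omega>)) * iexp (\<xi> 0 \<omega>) \<partial>M)"
      proof (rule integral_cong_AE)
        show "AE \<omega> in M. complex_of_real (indicator A \<omega> * f \<omega>)
          = complex_of_real (f \<omega>) * (\<Prod>(k, B)\<leftarrow>L. indicator B (\<xi> k \<omega>)) * iexp (\<xi> 0 \<omega>)"
          using noise_zero AE_space by eventually_elim (simp add: ind L(1) split: split_indicator)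
        have [measurable]: "A \<in> sets M" using basic C by auto
        show "(\<lambda>\<omega>. complex_of_real (indicator A \<omega> * f \<omega>)) \<in> borel_measurable M" by measurable
        have "(\<lambda>\<omega>. complex_of_real (f \<omega>) * (indicator (cyl L) \<omega> :: complex) * iexp (\<xi> 0 \<omega>)) \<in> borel_measurable M"
          unfolding L(1)[symmetric] by measurable
        then show "(\<lambda>\<omega>. complex_of_real (f \<omega>) * (\<Prod>(k, B)\<leftarrow>L. indicator B (\<xi> k \<omega>)) * iexp (\<xi> 0 \<omega>)) \<in> borel_measurable M"
          by (subst measurable_cong[where g = "\<lambda>\<omega>. complex_of_real (f \<omega>) * indicator (cyl L) \<omega> * iexp (\<xi> 0 \<omega>)"])
            (simp_all add: ind)
      qed
      also have "\<dots> = 0" by (rule orthogonal_cylinder[OF f orth L(2)])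
      finally show ?case by simp
    next
      case empty then show ?case by (simp add: set_lebesgue_integral_def)
    next
      case (compl A)
      have A: "A \<in> sets M" using compl sets_C by simp
      have "(LINT \<omega>:space M|M. f \<omega>) = (LINT \<omega>:A|M. f \<omega>) + (LINT \<omega>:space M - A|M. f \<omega>)"
        using A fA[of A] fA[of "space M - A"] sets.sets_into_space[OF A]
        by (subst set_integral_Un[symmetric]) (auto simp: Un_absorb1)
      moreover have "(LINT \<omega>:space M|M. f \<omega>) = 0"
        using orth[of "{#}"] by (simp add: set_integral_space[OF fi] L2_inner_def)
      ultimately show ?case using compl by simp
    next
      case (union A)
      have A: "range A \<subseteq> sets M" using union sets_C by auto
      then show ?case
        using union fA
        by (subst lebesgue_integral_countable_add) (auto simp: disjoint_family_on_def)
    qed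
  qed
  have "(\<integral>\<omega>. \<bar>f \<omega>\<bar> \<partial>M) = (\<integral>\<omega>. indicator {\<omega>\<in>space M. f \<omega> \<ge> 0} \<omega> *\<^sub>R f \<omega>
      - indicator {\<omega>\<in>space M. f \<omega> < 0} \<omega> *\<^sub>R f \<omega> \<partial>M)"
    by (intro Bochner_Integration.integral_cong) (auto split: split_indicator)
  also have "\<dots> = (LINT \<omega>:{\<omega>\<in>space M. f \<omega> \<ge> 0}|M. f \<omega>) - (LINT \<omega>:{\<omega>\<in>space M. f \<omega> < 0}|M. f \<omega>)"
    unfolding set_lebesgue_integral_def
    by (intro Bochner_Integration.integral_diff fA[unfolded set_integrable_def]) measurable
  also have "\<dots> = 0" by (simp add: zero)
  finally show ?thesis
    using integral_nonneg_eq_0_iff_AE[of M "\<lambda>\<omega>. \<bar>f \<omega>\<bar>"] fi by simp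
qed

section \<open>Expansion in Wick monomials\<close>

lemma multiset_fact_nz [simp]: "multiset_fact m \<noteq> 0" and multiset_fact_nonneg [simp]: "0 \<le> multiset_fact m"
  using multiset_fact_pos[of m] by linarith+

text \<open>Identities that are continuous and linear in a vector \<open>h\<close> need only be checked on the basis. This
spares all computations with coordinates of a general \<open>h\<close>.\<close>

lemma bounded_linear_eq_basis:
  fixes P Q :: "'h \<Rightarrow> real"
  assumes "bounded_linear P" "bounded_linear Q" "\<And>k. k \<in> J \<Longrightarrow> P (e k) = Q (e k)"
  shows "P h = Q h"
proof -
  interpret P: bounded_linear P by fact
  interpret Q: bounded_linear Q by fact
  have "closed {x. P x = Q x}"
    by (intro closed_Collect_eq P.continuous_on Q.continuous_on continuous_on_id)
  moreover have "span (e ` J) \<subseteq> {x. P x = Q x}"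
    using linear_eq_on_span[OF P.linear_axioms Q.linear_axioms, of "e ` J"] assms(3) by auto
  ultimately have "closure (span (e ` J)) \<subseteq> {x. P x = Q x}" by (intro closure_minimal)
  then show ?thesis using basis by (auto simp: orthonormal_basis_def)
qed

lemma vector_eq_basis:
  fixes x y :: 'h
  assumes "\<And>k. k \<in> J \<Longrightarrow> x \<bullet> e k = y \<bullet> e k" shows "x = y"
proof -
  have "x \<bullet> (x - y) = y \<bullet> (x - y)"
    by (rule bounded_linear_eq_basis[OF bounded_linear_inner_right bounded_linear_inner_right assms])
  then have "(x - y) \<bullet> (x - y) = 0" by (simp add: inner_diff_left)
  then show ?thesis by simp
qed

lemma bessel_basis:
  fixes x :: 'h
  assumes "finite K" "K \<subseteq> J" shows "(\<Sum>k\<in>K. (x \<bullet> e k)\<^sup>2) \<le> x \<bullet> x"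
proof -
  define y where "y = (\<Sum>k\<in>K. (x \<bullet> e k) *\<^sub>R e k)"
  have ye: "y \<bullet> e k = x \<bullet> e k" if "k \<in> K" for k
  proof -
    have "y \<bullet> e k = (\<Sum>j\<in>K. if j = k then x \<bullet> e j else 0)"
      unfolding y_def inner_sum_left using assms that
      by (intro sum.cong) (auto simp: inner_basis subset_eq)
    then show ?thesis using assms(1) that by simp
  qed
  have xy: "x \<bullet> y = (\<Sum>k\<in>K. (x \<bullet> e k)\<^sup>2)"
    by (simp add: y_def inner_sum_right power2_eq_square)
  have yy: "y \<bullet> y = (\<Sum>k\<in>K. (x \<bullet> e k)\<^sup>2)"
    by (subst (2) y_def) (simp add: inner_sum_right power2_eq_square ye)
  have "0 \<le> (x - y) \<bullet> (x - y)" by simp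
  also have "\<dots> = x \<bullet> x - (\<Sum>k\<in>K. (x \<bullet> e k)\<^sup>2)"
    using xy yy by (simp add: inner_diff_left inner_diff_right inner_commute)
  finally show ?thesis by simp
qed

lemma L2_eq_wick_monomials:
  fixes f g :: "'w \<Rightarrow> real"
  assumes f: "f \<in> L2 M" and g: "g \<in> L2 M"
    and eq: "\<And>m. set_mset m \<subseteq> J \<Longrightarrow> L2_inner M f (wick_monomial m) = L2_inner M g (wick_monomial m)"
  shows "AE \<omega> in M. f \<omega> = g \<omega>"
proof -
  have "AE \<omega> in M. f \<omega> - g \<omega> = 0"
    using eq by (intro wick_monomials_complete L2_diff f g)
      (simp add: L2_inner_diff_left[OF f g wick_monomial_L2])
  then show ?thesis by simp
qed

lemma L2_vec_eq_wick_monomials: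
  fixes v w :: "'w \<Rightarrow> 'h"
  assumes v: "v \<in> L2 M" and w: "w \<in> L2 M"
    and eq: "\<And>k m. k \<in> J \<Longrightarrow> set_mset m \<subseteq> J \<Longrightarrow>
      L2_inner M (\<lambda>\<omega>. v \<omega> \<bullet> e k) (wick_monomial m) = L2_inner M (\<lambda>\<omega>. w \<omega> \<bullet> e k) (wick_monomial m)"
  shows "AE \<omega> in M. v \<omega> = w \<omega>"
proof -
  have "AE \<omega> in M. \<forall>k\<in>J. v \<omega> \<bullet> e k = w \<omega> \<bullet> e k"
    using eq by (intro AE_ball_countable' L2_eq_wick_monomials L2_inner_vec v w) auto
  then show ?thesis by eventually_elim (auto intro: vector_eq_basis)
qed

definition wick_coord :: "('w \<Rightarrow> real) \<Rightarrow> nat multiset \<Rightarrow> real" where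
  "wick_coord f m = L2_inner M f (wick_monomial m) / multiset_fact m"

abbreviation wick_indices :: "nat multiset set" where
  "wick_indices \<equiv> {m. set_mset m \<subseteq> J}"

lemma scaled_monomial_inner:
  assumes "set_mset m \<subseteq> J" "set_mset m' \<subseteq> J"
  shows "L2_inner M (\<lambda>\<omega>. a * wick_monomial m \<omega>) (\<lambda>\<omega>. b * wick_monomial m' \<omega>)
    = (if m = m' then a * b * multiset_fact m else 0)"
proof -
  have "L2_inner M (\<lambda>\<omega>. a * wick_monomial m \<omega>) (\<lambda>\<omega>. b * wick_monomial m' \<omega>)
      = a * (b * L2_inner M (wick_monomial m') (wick_monomial m))"
    by (simp only: L2_inner_mult_left L2_inner_commute[of M "wick_monomial m" "\<lambda>\<omega>. b * wick_monomial m' \<omega>"])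
  then show ?thesis using wick_monomial_inner[OF assms(2,1)] by simp
qed

lemma scaled_monomial_L2: "set_mset m \<subseteq> J \<Longrightarrow> (\<lambda>\<omega>. c * wick_monomial m \<omega>) \<in> L2 M"
  by (intro L2_mult wick_monomial_L2)

text \<open>The index set is a parameter because the series of a single degree and the full expansion both
occur.\<close>

lemma wick_series_exists:
  assumes I: "I \<subseteq> wick_indices"
    and bound: "\<And>F. finite F \<Longrightarrow> F \<subseteq> I \<Longrightarrow> (\<Sum>m\<in>F. (c m)\<^sup>2 * multiset_fact m) \<le> C"
  shows "\<exists>S. L2_tendsto M (\<lambda>F \<omega>. \<Sum>m\<in>F. c m * wick_monomial m \<omega>) S (finite_subsets_at_top I)"
proof (rule L2_orthogonal_series)
  fix F assume F: "finite F" "F \<subseteq> I"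
  have "(\<Sum>m\<in>F. L2_inner M (\<lambda>\<omega>. c m * wick_monomial m \<omega>) (\<lambda>\<omega>. c m * wick_monomial m \<omega>))
      = (\<Sum>m\<in>F. (c m)\<^sup>2 * multiset_fact m)"
    using F I by (intro sum.cong refl) (auto simp: scaled_monomial_inner power2_eq_square subset_eq)
  then show "(\<Sum>m\<in>F. L2_inner M (\<lambda>\<omega>. c m * wick_monomial m \<omega>) (\<lambda>\<omega>. c m * wick_monomial m \<omega>)) \<le> C"
    using bound[OF F] by simp
next
  fix m m' assume "m \<in> I" "m' \<in> I" "m \<noteq> m'"
  then show "L2_inner M (\<lambda>\<omega>. c m * wick_monomial m \<omega>) (\<lambda>\<omega>. c m' * wick_monomial m' \<omega>) = 0"
    using I by (subst scaled_monomial_inner) auto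
qed (use I in \<open>auto intro: scaled_monomial_L2\<close>)

lemma wick_series_inner:
  assumes lim: "L2_tendsto M (\<lambda>F \<omega>. \<Sum>m\<in>F. c m * wick_monomial m \<omega>) S (finite_subsets_at_top I)"
    and I: "I \<subseteq> wick_indices" and m: "set_mset m \<subseteq> J"
  shows "L2_inner M S (wick_monomial m) = (if m \<in> I then c m * multiset_fact m else 0)"
proof (rule L2_series_inner[OF lim _ wick_monomial_L2[OF m]])
  fix m' assume "m' \<in> I"
  then have m': "set_mset m' \<subseteq> J" using I by auto
  then show "(\<lambda>\<omega>. c m' * wick_monomial m' \<omega>) \<in> L2 M" by (rule scaled_monomial_L2)
  show "L2_inner M (\<lambda>\<omega>. c m' * wick_monomial m' \<omega>) (wick_monomial m) = (if m' = m then c m * multiset_fact m else 0)"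
    unfolding L2_inner_mult_left wick_monomial_inner[OF m' m] by simp
qed

lemma wick_bessel:
  assumes f: "f \<in> L2 M" and F: "finite F" "F \<subseteq> wick_indices"
  shows "(\<Sum>m\<in>F. (wick_coord f m)\<^sup>2 * multiset_fact m) \<le> L2_inner M f f"
proof -
  define S where "S \<omega> = (\<Sum>m\<in>F. wick_coord f m * wick_monomial m \<omega>)" for \<omega>
  have mon: "(\<lambda>\<omega>. wick_coord f m * wick_monomial m \<omega>) \<in> L2 M" if "m \<in> F" for m
    using F that by (intro scaled_monomial_L2) auto
  have S: "S \<in> L2 M" unfolding S_def[abs_def] using mon by (intro L2_sum)
  have SS: "L2_inner M S S = (\<Sum>m\<in>F. (wick_coord f m)\<^sup>2 * multiset_fact m)"
    unfolding S_def[abs_def] using F mon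
    by (subst L2_inner_orthogonal_sums) (auto simp: scaled_monomial_inner power2_eq_square subset_eq intro!: sum.cong)
  have "L2_inner M S f = (\<Sum>m\<in>F. L2_inner M (\<lambda>\<omega>. wick_coord f m * wick_monomial m \<omega>) f)"
    unfolding S_def[abs_def] using mon f by (intro L2_inner_sum_left)
  also have "\<dots> = (\<Sum>m\<in>F. (wick_coord f m)\<^sup>2 * multiset_fact m)"
    unfolding L2_inner_mult_left
    by (intro sum.cong refl) (simp add: L2_inner_commute[of M _ f] wick_coord_def power2_eq_square)
  finally have fS: "L2_inner M f S = (\<Sum>m\<in>F. (wick_coord f m)\<^sup>2 * multiset_fact m)"
    by (simp add: L2_inner_commute)
  show ?thesis
    using L2_inner_self_scaled_add[OF f S, of "-1"] SS fS
      L2_inner_self_nonneg[of M "\<lambda>\<omega>. f \<omega> + (-1) *\<^sub>R S \<omega>"] by simp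
qed

lemma wick_expansion:
  assumes f: "f \<in> L2 M"
  shows "L2_tendsto M (\<lambda>F \<omega>. \<Sum>m\<in>F. wick_coord f m * wick_monomial m \<omega>) f (finite_subsets_at_top wick_indices)"
proof -
  obtain S where S: "L2_tendsto M (\<lambda>F \<omega>. \<Sum>m\<in>F. wick_coord f m * wick_monomial m \<omega>) S
      (finite_subsets_at_top wick_indices)"
    using wick_series_exists[OF subset_refl wick_bessel[OF f]] by blast
  then have SL2: "S \<in> L2 M" by (simp add: L2_tendsto_def)
  have "AE \<omega> in M. S \<omega> = f \<omega>"
    by (rule L2_eq_wick_monomials[OF SL2 f]) (simp add: wick_series_inner[OF S subset_refl] wick_coord_def)
  from L2_tendsto_cong_AE[OF S f this] show ?thesis .
qed

lemma L2_inner_eq_0_wick: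
  assumes f: "f \<in> L2 M" and g: "g \<in> L2 M"
    and zero: "\<And>m. set_mset m \<subseteq> J \<Longrightarrow> L2_inner M f (wick_monomial m) = 0 \<or> L2_inner M g (wick_monomial m) = 0"
  shows "L2_inner M f g = 0"
proof -
  have "L2_inner M f g = (if {#} \<in> wick_indices then 0 else 0)"
  proof (rule L2_series_inner[OF wick_expansion[OF f] _ g])
    fix m assume "m \<in> wick_indices"
    then show "(\<lambda>\<omega>. wick_coord f m * wick_monomial m \<omega>) \<in> L2 M"
      by (intro L2_mult wick_monomial_L2) auto
    show "L2_inner M (\<lambda>\<omega>. wick_coord f m * wick_monomial m \<omega>) g = (if m = {#} then 0 else 0)"
      unfolding L2_inner_mult_left using zero[of m] \<open>m \<in> wick_indices\<close>
      by (auto simp: wick_coord_def L2_inner_commute[of M "wick_monomial m"])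
  qed
  then show ?thesis by simp
qed

text \<open>Convergence of the sum over degrees follows from the unordered expansion: the partial sum below
degree \<open>N\<close> is the orthogonal projection of \<open>f\<close> on the degrees below \<open>N\<close>, hence at least as
close to \<open>f\<close> as any finite partial sum of the expansion inside these degrees.\<close>

lemma graded_sum_tendsto:
  assumes f: "f \<in> L2 M" and P: "\<And>n. P n \<in> L2 M"
    and coord: "\<And>n m. set_mset m \<subseteq> J \<Longrightarrow>
      L2_inner M (P n) (wick_monomial m) = (if size m = n then L2_inner M f (wick_monomial m) else 0)"
  shows "L2_tendsto M (\<lambda>N \<omega>. \<Sum>n<N. P n \<omega>) f sequentially"
proof -
  define S where "S N \<omega> = (\<Sum>n<N. P n \<omega>)" for N :: nat and \<omega>
  have S: "S N \<in> L2 M" for N unfolding S_def[abs_def] by (intro L2_sum P)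
  have Scoord: "L2_inner M (S N) (wick_monomial m) = (if size m < N then L2_inner M f (wick_monomial m) else 0)"
    if "set_mset m \<subseteq> J" for N m
    unfolding S_def[abs_def] using that P
    by (subst L2_inner_sum_left) (auto simp: coord wick_monomial_L2)
  have "(\<lambda>N. L2_norm M (\<lambda>\<omega>. S N \<omega> - f \<omega>)) \<longlonglongrightarrow> 0"
  proof (rule tendstoI)
    fix \<epsilon> :: real assume "\<epsilon> > 0"
    define T where "T F \<omega> = (\<Sum>m\<in>F. wick_coord f m * wick_monomial m \<omega>)" for F \<omega>
    have "((\<lambda>F. L2_norm M (\<lambda>\<omega>. T F \<omega> - f \<omega>)) \<longlongrightarrow> 0) (finite_subsets_at_top wick_indices)"
      using wick_expansion[OF f] by (simp add: L2_tendsto_iff_norm T_def[abs_def])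
    then have "\<forall>\<^sub>F F in finite_subsets_at_top wick_indices. L2_norm M (\<lambda>\<omega>. T F \<omega> - f \<omega>) < \<epsilon>"
      using \<open>\<epsilon> > 0\<close> by (rule order_tendstoD)
    then obtain F where F: "finite F" "F \<subseteq> wick_indices" "L2_norm M (\<lambda>\<omega>. T F \<omega> - f \<omega>) < \<epsilon>"
      unfolding eventually_finite_subsets_at_top by blast
    obtain N0 where N0: "\<And>m. m \<in> F \<Longrightarrow> size m < N0"
      using finite_nat_set_iff_bounded[of "size ` F"] F(1) by auto
    have T: "T F \<in> L2 M"
      unfolding T_def[abs_def] using F(2) by (intro L2_sum L2_mult wick_monomial_L2) auto
    have Tcoord: "L2_inner M (T F) (wick_monomial m) = 0" if "set_mset m \<subseteq> J" "m \<notin> F" for m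
      unfolding T_def[abs_def] using F(2) that
      by (subst L2_inner_sum_left)
        (auto intro!: sum.neutral L2_mult wick_monomial_L2 simp: L2_inner_mult_left wick_monomial_inner subset_eq)
    have "L2_norm M (\<lambda>\<omega>. S N \<omega> - f \<omega>) < \<epsilon>" if "N \<ge> N0" for N
    proof -
      define a where "a \<omega> = f \<omega> - S N \<omega>" for \<omega>
      define b where "b \<omega> = S N \<omega> - T F \<omega>" for \<omega>
      have ab: "a \<in> L2 M" "b \<in> L2 M" unfolding a_def[abs_def] b_def[abs_def] by (intro L2_diff f S T)+
      have "L2_inner M a b = 0"
      proof (rule L2_inner_eq_0_wick[OF ab])
        fix m assume m: "set_mset m \<subseteq> J"
        note mon = wick_monomial_L2[OF m]
        show "L2_inner M a (wick_monomial m) = 0 \<or> L2_inner M b (wick_monomial m) = 0"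
        proof (cases "size m < N")
          case True
          then show ?thesis unfolding a_def[abs_def] by (simp add: L2_inner_diff_left[OF f S mon] Scoord[OF m])
        next
          case False
          then have "m \<notin> F" using N0 \<open>N \<ge> N0\<close> by force
          then show ?thesis
            using False unfolding b_def[abs_def] by (simp add: L2_inner_diff_left[OF S T mon] Scoord[OF m] Tcoord[OF m])
        qed
      qed
      then have "L2_inner M (\<lambda>\<omega>. a \<omega> + 1 *\<^sub>R b \<omega>) (\<lambda>\<omega>. a \<omega> + 1 *\<^sub>R b \<omega>) = L2_inner M a a + L2_inner M b b"
        by (simp only: L2_inner_self_scaled_add[OF ab]) simp
      then have "L2_inner M a a \<le> L2_inner M (\<lambda>\<omega>. f \<omega> - T F \<omega>) (\<lambda>\<omega>. f \<omega> - T F \<omega>)"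
        by (simp add: a_def b_def)
      then have "L2_norm M a \<le> L2_norm M (\<lambda>\<omega>. f \<omega> - T F \<omega>)"
        unfolding L2_norm_def by (rule real_sqrt_le_mono)
      then show ?thesis
        using F(3) by (simp add: a_def[abs_def] L2_norm_minus_commute[of M f])
    qed
    then show "\<forall>\<^sub>F N in sequentially. dist (L2_norm M (\<lambda>\<omega>. S N \<omega> - f \<omega>)) 0 < \<epsilon>"
      unfolding eventually_sequentially by auto
  qed
  then show ?thesis using f S by (simp add: L2_tendsto_iff_norm S_def[abs_def])
qed

section \<open>The divided derivative in coordinates\<close>

text \<open>This is \<open>D\<Phi>\<^sub>m / |m| = d\<Phi>\<^sub>m\<close>, from \<open>H\<^sub>j' = jH\<^sub>j\<^sub>-\<^sub>1\<close>. At the empty multiset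
the sum is empty, so the value is \<open>0\<close>.\<close>

definition wick_gradient :: "nat multiset \<Rightarrow> 'w \<Rightarrow> 'h" where
  "wick_gradient m \<omega> =
     (\<Sum>k\<in>set_mset m. (real (count m k) / real (size m) * wick_monomial (m - {#k#}) \<omega>) *\<^sub>R e k)"

lemma wick_gradient_L2: "set_mset m \<subseteq> J \<Longrightarrow> wick_gradient m \<in> L2 M"
  unfolding wick_gradient_def[abs_def]
  by (intro L2_sum L2_scaleR_vec L2_mult wick_monomial_L2) (auto dest: in_diffD)

lemma multiset_fact_add: "multiset_fact (add_mset k m) = real (Suc (count m k)) * multiset_fact m"
proof -
  define K where "K = insert k (set_mset m)"
  have K: "finite K" "k \<in> K" by (auto simp: K_def)
  have "multiset_fact (add_mset k m) = (\<Prod>l\<in>K. fact (count (add_mset k m) l))"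
    by (rule multiset_fact_prod) (auto simp: K_def)
  moreover have "multiset_fact m = (\<Prod>l\<in>K. fact (count m l))"
    by (rule multiset_fact_prod) (auto simp: K_def)
  ultimately show ?thesis by (simp add: prod.remove[OF K])
qed

lemma wick_gradient_inner_basis:
  assumes "k \<in> J" "set_mset m \<subseteq> J"
  shows "wick_gradient m \<omega> \<bullet> e k = real (count m k) / real (size m) * wick_monomial (m - {#k#}) \<omega>"
proof -
  have "wick_gradient m \<omega> \<bullet> e k = (\<Sum>j\<in>set_mset m. if j = k then
      real (count m k) / real (size m) * wick_monomial (m - {#k#}) \<omega> else 0)"
    unfolding wick_gradient_def inner_sum_left using assms
    by (intro sum.cong refl) (auto simp: inner_basis subset_eq)
  then show ?thesis by (auto simp: not_in_iff)
qed

lemma wick_gradient_coord: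
  assumes k: "k \<in> J" and m: "set_mset m \<subseteq> J" and m': "set_mset m' \<subseteq> J"
  shows "L2_inner M (\<lambda>\<omega>. wick_gradient m \<omega> \<bullet> e k) (wick_monomial m')
    = (if m = add_mset k m' then multiset_fact m / real (size m) else 0)"
proof -
  have "set_mset (m - {#k#}) \<subseteq> J" using m by (auto dest: in_diffD)
  then have "L2_inner M (\<lambda>\<omega>. wick_gradient m \<omega> \<bullet> e k) (wick_monomial m')
      = real (count m k) / real (size m) * (if m - {#k#} = m' then multiset_fact m' else 0)"
    unfolding wick_gradient_inner_basis[OF k m] L2_inner_mult_left
    using wick_monomial_inner[OF _ m'] by auto
  also have "\<dots> = (if m = add_mset k m' then multiset_fact m / real (size m) else 0)"
    by (cases "k \<in># m") (auto simp: multiset_fact_add not_in_iff)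
  finally show ?thesis .
qed

text \<open>For \<open>m \<noteq> \<emptyset>\<close> the weights \<open>m(k)/|m|\<close> add up to \<open>1\<close>; so if all shifted coordinates of \<open>v\<close> agree, their common
value is the inner product. The hypothesis holds when \<open>v\<close> is a stochastic derivative, whose
shifted coordinates depend on \<open>m\<close> only.\<close>

lemma L2_inner_wick_gradient:
  assumes v: "v \<in> L2 M" and m: "set_mset m \<subseteq> J"
    and c: "\<And>k. k \<in># m \<Longrightarrow> L2_inner M (\<lambda>\<omega>. v \<omega> \<bullet> e k) (wick_monomial (m - {#k#})) = c"
  shows "L2_inner M v (wick_gradient m) = (if m = {#} then 0 else c)"
proof -
  have "L2_inner M v (wick_gradient m) = (\<Sum>k\<in>set_mset m. L2_inner M v
      (\<lambda>\<omega>. (real (count m k) / real (size m) * wick_monomial (m - {#k#}) \<omega>) *\<^sub>R e k))"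
    unfolding wick_gradient_def[abs_def] using m
    by (intro L2_inner_sum_right L2_scaleR_vec L2_mult wick_monomial_L2 v) (auto dest: in_diffD)
  also have "\<dots> = (\<Sum>k\<in>set_mset m. real (count m k) / real (size m) * c)"
  proof (intro sum.cong refl)
    fix k assume k: "k \<in># m"
    have "L2_inner M v (\<lambda>\<omega>. (real (count m k) / real (size m) * wick_monomial (m - {#k#}) \<omega>) *\<^sub>R e k)
        = real (count m k) / real (size m) * L2_inner M v (\<lambda>\<omega>. wick_monomial (m - {#k#}) \<omega> *\<^sub>R e k)"
      using L2_inner_scaleR_right[of M v "real (count m k) / real (size m)" "\<lambda>\<omega>. wick_monomial (m - {#k#}) \<omega> *\<^sub>R e k"]
      by simp
    then show "L2_inner M v (\<lambda>\<omega>. (real (count m k) / real (size m) * wick_monomial (m - {#k#}) \<omega>) *\<^sub>R e k)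
        = real (count m k) / real (size m) * c"
      using c[OF k] by (simp add: L2_inner_vec_scaleR)
  qed
  also have "\<dots> = real (\<Sum>k\<in>set_mset m. count m k) / real (size m) * c"
    by (simp add: sum_divide_distrib sum_distrib_right)
  also have "(\<Sum>k\<in>set_mset m. count m k) = size m" by (simp add: size_multiset_overloaded_eq)
  finally show ?thesis by auto
qed

lemma wick_gradient_inner:
  assumes m: "set_mset m \<subseteq> J" and m': "set_mset m' \<subseteq> J"
  shows "L2_inner M (wick_gradient m) (wick_gradient m')
    = (if m = m' then (if m = {#} then 0 else multiset_fact m / real (size m)) else 0)"
proof -
  have "L2_inner M (wick_gradient m) (wick_gradient m')
      = (if m' = {#} then 0 else if m = m' then multiset_fact m / real (size m) else 0)"
  proof (rule L2_inner_wick_gradient[OF wick_gradient_L2[OF m] m'])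
    fix k assume k: "k \<in># m'"
    then have "k \<in> J" "set_mset (m' - {#k#}) \<subseteq> J" using m' by (auto dest: in_diffD)
    from wick_gradient_coord[OF this(1) m this(2)] k
    show "L2_inner M (\<lambda>\<omega>. wick_gradient m \<omega> \<bullet> e k) (wick_monomial (m' - {#k#}))
        = (if m = m' then multiset_fact m / real (size m) else 0)" by simp
  qed
  then show ?thesis by auto
qed

text \<open>The operator \<open>d\<close>, built from the coordinates of \<open>f\<close>; the symmetric forms of \<open>f\<close> are in turn
constructed from it.\<close>

definition divided_derivative :: "('w \<Rightarrow> real) \<Rightarrow> 'w \<Rightarrow> 'h" where
  "divided_derivative f =
     L2_Lim M (\<lambda>F \<omega>. \<Sum>m\<in>F. wick_coord f m *\<^sub>R wick_gradient m \<omega>) (finite_subsets_at_top wick_indices)"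

text \<open>The vectors \<open>d\<Phi>\<^sub>m\<close> are orthogonal with squared norms \<open>m!/|m|\<close> (\<open>0\<close> at \<open>m = \<emptyset>\<close>), at most the squared norm
\<open>m!\<close> of \<open>\<Phi>\<^sub>m\<close>. So the series converges and \<open>d\<close> is a contraction.\<close>

lemma
  assumes f: "f \<in> L2 M"
  shows divided_derivative_tendsto: "L2_tendsto M (\<lambda>F \<omega>. \<Sum>m\<in>F. wick_coord f m *\<^sub>R wick_gradient m \<omega>)
      (divided_derivative f) (finite_subsets_at_top wick_indices)"
    and divided_derivative_L2: "divided_derivative f \<in> L2 M"
    and divided_derivative_norm_le: "L2_norm M (divided_derivative f) \<le> L2_norm M f"
proof -
  define \<phi> where "\<phi> m \<omega> = wick_coord f m *\<^sub>R wick_gradient m \<omega>" for m \<omega>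
  have \<phi>: "\<phi> m \<in> L2 M" if "m \<in> wick_indices" for m
    unfolding \<phi>_def[abs_def] using that by (intro L2_scaleR wick_gradient_L2) auto
  have ip: "L2_inner M (\<phi> m) (\<phi> m') = (wick_coord f m * wick_coord f m') *
      (if m = m' then (if m = {#} then 0 else multiset_fact m / real (size m)) else 0)"
    if "m \<in> wick_indices" "m' \<in> wick_indices" for m m'
    using that wick_gradient_inner[of m m'] unfolding \<phi>_def[abs_def]
    by (simp add: L2_inner_scaleR_left L2_inner_scaleR_right)
  have bound: "(\<Sum>m\<in>F. L2_inner M (\<phi> m) (\<phi> m)) \<le> L2_inner M f f" if F: "finite F" "F \<subseteq> wick_indices" for F
  proof -
    have "(\<Sum>m\<in>F. L2_inner M (\<phi> m) (\<phi> m)) \<le> (\<Sum>m\<in>F. (wick_coord f m)\<^sup>2 * multiset_fact m)"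
    proof (rule sum_mono)
      fix m assume "m \<in> F"
      then have "L2_inner M (\<phi> m) (\<phi> m) = (wick_coord f m)\<^sup>2 * (if m = {#} then 0 else multiset_fact m / real (size m))"
        using F by (subst ip) (auto simp: power2_eq_square)
      also have "\<dots> \<le> (wick_coord f m)\<^sup>2 * multiset_fact m"
      proof (intro mult_left_mono)
        have "multiset_fact m / real (size m) \<le> multiset_fact m / 1" if "m \<noteq> {#}"
          using that multiset_fact_pos[of m]
          by (intro divide_left_mono) (auto simp: Suc_le_eq nonempty_has_size)
        then show "(if m = {#} then 0 else multiset_fact m / real (size m)) \<le> multiset_fact m"
          using multiset_fact_pos[of m] by auto
      qed simp
      finally show "L2_inner M (\<phi> m) (\<phi> m) \<le> (wick_coord f m)\<^sup>2 * multiset_fact m" .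
    qed
    then show ?thesis using wick_bessel[OF f F] by linarith
  qed
  have "\<exists>S. L2_tendsto M (\<lambda>F \<omega>. \<Sum>m\<in>F. \<phi> m \<omega>) S (finite_subsets_at_top wick_indices)"
    by (rule L2_orthogonal_series[OF \<phi> _ bound]) (auto simp: ip)
  then show lim: "L2_tendsto M (\<lambda>F \<omega>. \<Sum>m\<in>F. wick_coord f m *\<^sub>R wick_gradient m \<omega>)
      (divided_derivative f) (finite_subsets_at_top wick_indices)"
    unfolding divided_derivative_def L2_Lim_def \<phi>_def by (rule someI_ex)
  then show "divided_derivative f \<in> L2 M" by (simp add: L2_tendsto_def)
  show "L2_norm M (divided_derivative f) \<le> L2_norm M f"
  proof (rule tendsto_upperbound[OF L2_tendsto_norm[OF lim]])
    show "\<forall>\<^sub>F F in finite_subsets_at_top wick_indices.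
        L2_norm M (\<lambda>\<omega>. \<Sum>m\<in>F. wick_coord f m *\<^sub>R wick_gradient m \<omega>) \<le> L2_norm M f"
    proof (rule eventually_finite_subsets_at_top_weakI)
      fix F assume F: "finite F" "F \<subseteq> wick_indices"
      have "L2_inner M (\<lambda>\<omega>. \<Sum>m\<in>F. \<phi> m \<omega>) (\<lambda>\<omega>. \<Sum>m\<in>F. \<phi> m \<omega>) = (\<Sum>m\<in>F. L2_inner M (\<phi> m) (\<phi> m))"
      proof (rule L2_inner_orthogonal_sums[OF F(1)])
        show "\<phi> m \<in> L2 M" if "m \<in> F" for m using \<phi> F(2) that by blast
        show "L2_inner M (\<phi> m) (\<phi> m') = 0" if "m \<in> F" "m' \<in> F" "m \<noteq> m'" for m m'
          using ip[of m m'] F(2) that by auto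
      qed
      then show "L2_norm M (\<lambda>\<omega>. \<Sum>m\<in>F. wick_coord f m *\<^sub>R wick_gradient m \<omega>) \<le> L2_norm M f"
        using bound[OF F] unfolding L2_norm_def \<phi>_def by (intro real_sqrt_le_mono) simp
    qed
  qed simp
qed

lemma divided_derivative_coord:
  assumes f: "f \<in> L2 M" and k: "k \<in> J" and m: "set_mset m \<subseteq> J"
  shows "L2_inner M (\<lambda>\<omega>. divided_derivative f \<omega> \<bullet> e k) (wick_monomial m)
    = L2_inner M f (wick_monomial (add_mset k m)) / real (Suc (size m))"
proof -
  have "L2_inner M (divided_derivative f) (\<lambda>\<omega>. wick_monomial m \<omega> *\<^sub>R e k)
      = (if add_mset k m \<in> wick_indices then L2_inner M f (wick_monomial (add_mset k m)) / real (Suc (size m)) else 0)"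
  proof (rule L2_series_inner[OF divided_derivative_tendsto[OF f]])
    fix m' assume m': "m' \<in> wick_indices"
    then show "(\<lambda>\<omega>. wick_coord f m' *\<^sub>R wick_gradient m' \<omega>) \<in> L2 M"
      by (intro L2_scaleR wick_gradient_L2) auto
    have "L2_inner M (\<lambda>\<omega>. wick_coord f m' *\<^sub>R wick_gradient m' \<omega>) (\<lambda>\<omega>. wick_monomial m \<omega> *\<^sub>R e k)
        = wick_coord f m' * L2_inner M (\<lambda>\<omega>. wick_gradient m' \<omega> \<bullet> e k) (wick_monomial m)"
      by (simp add: L2_inner_scaleR_left L2_inner_vec_scaleR)
    then show "L2_inner M (\<lambda>\<omega>. wick_coord f m' *\<^sub>R wick_gradient m' \<omega>) (\<lambda>\<omega>. wick_monomial m \<omega> *\<^sub>R e k)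
        = (if m' = add_mset k m then L2_inner M f (wick_monomial (add_mset k m)) / real (Suc (size m)) else 0)"
      using wick_gradient_coord[OF k _ m, of m'] m' multiset_fact_pos[of m'] by (auto simp: wick_coord_def)
  qed (intro L2_scaleR_vec wick_monomial_L2 m)
  then show ?thesis using k m by (simp add: L2_inner_vec_scaleR)
qed

lemma divided_derivative_cong:
  assumes "f \<in> L2 M" "g \<in> L2 M" "AE \<omega> in M. f \<omega> = g \<omega>"
  shows "divided_derivative f = divided_derivative g"
proof -
  have [measurable]: "f \<in> borel_measurable M" "g \<in> borel_measurable M" using assms by (auto simp: L2_def)
  have "L2_inner M f (wick_monomial m) = L2_inner M g (wick_monomial m)" for m
    unfolding L2_inner_def using assms(3) by (intro integral_cong_AE) auto
  then show ?thesis by (simp add: divided_derivative_def wick_coord_def)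
qed

lemma divided_derivative_linear:
  assumes f: "f \<in> L2 M" and g: "g \<in> L2 M"
  shows "AE \<omega> in M. divided_derivative (\<lambda>\<omega>. a * f \<omega> + b * g \<omega>) \<omega>
    = a *\<^sub>R divided_derivative f \<omega> + b *\<^sub>R divided_derivative g \<omega>"
proof (rule L2_vec_eq_wick_monomials)
  have fg: "(\<lambda>\<omega>. a * f \<omega> + b * g \<omega>) \<in> L2 M" by (intro L2_add L2_mult f g)
  show "divided_derivative (\<lambda>\<omega>. a * f \<omega> + b * g \<omega>) \<in> L2 M" by (rule divided_derivative_L2[OF fg])
  show "(\<lambda>\<omega>. a *\<^sub>R divided_derivative f \<omega> + b *\<^sub>R divided_derivative g \<omega>) \<in> L2 M"
    by (intro L2_add L2_scaleR divided_derivative_L2 f g)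
  fix k m assume k: "k \<in> J" and m: "set_mset m \<subseteq> J"
  then have m': "set_mset (add_mset k m) \<subseteq> J" by auto
  have lin: "L2_inner M (\<lambda>\<omega>. a * p \<omega> + b * q \<omega>) r = a * L2_inner M p r + b * L2_inner M q r"
    if "p \<in> L2 M" "q \<in> L2 M" "r \<in> L2 M" for p q r :: "'w \<Rightarrow> real"
    using that by (simp add: L2_inner_add_left L2_inner_mult_left L2_mult)
  show "L2_inner M (\<lambda>\<omega>. divided_derivative (\<lambda>\<omega>. a * f \<omega> + b * g \<omega>) \<omega> \<bullet> e k) (wick_monomial m)
    = L2_inner M (\<lambda>\<omega>. (a *\<^sub>R divided_derivative f \<omega> + b *\<^sub>R divided_derivative g \<omega>) \<bullet> e k) (wick_monomial m)"
    unfolding inner_add_left inner_scaleR_left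
    using lin[OF L2_inner_vec[OF divided_derivative_L2[OF f]] L2_inner_vec[OF divided_derivative_L2[OF g]] wick_monomial_L2[OF m]]
      lin[OF f g wick_monomial_L2[OF m']]
    by (simp add: divided_derivative_coord f g fg k m add_divide_distrib)
qed

text \<open>On basis vectors both sides have the coordinates of \<open>f\<close> shifted by the same two indices, up to
the same factor. Boundedness in each argument, which the contraction property provides, carries
the identity over to all vectors.\<close>

lemma divided_derivative_commute:
  assumes f: "f \<in> L2 M"
  shows "AE \<omega> in M. divided_derivative (\<lambda>\<omega>. divided_derivative f \<omega> \<bullet> h) \<omega> \<bullet> k
    = divided_derivative (\<lambda>\<omega>. divided_derivative f \<omega> \<bullet> k) \<omega> \<bullet> h"
proof -
  define v where "v = divided_derivative f"
  have v: "v \<in> L2 M" unfolding v_def by (rule divided_derivative_L2[OF f])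
  note vh = L2_inner_vec[OF v] and dvh = divided_derivative_L2[OF L2_inner_vec[OF v]]
  define B where "B m h k = L2_inner M (\<lambda>\<omega>. divided_derivative (\<lambda>\<omega>. v \<omega> \<bullet> h) \<omega> \<bullet> k) (wick_monomial m)" for m h k
  have B2: "bounded_linear (B m h)" if "set_mset m \<subseteq> J" for m h
    unfolding B_def by (rule bounded_linear_L2_inner_vec[OF dvh wick_monomial_L2[OF that]])
  have B1: "bounded_linear (\<lambda>h. B m h k)" if m: "set_mset m \<subseteq> J" for m k
  proof (rule bounded_linear_intro[where K = "L2_norm M v * norm k * L2_norm M (wick_monomial m)"])
    note mon = wick_monomial_L2[OF m]
    have lin: "B m (a *\<^sub>R x + b *\<^sub>R y) k = a * B m x k + b * B m y k" for a b x y
    proof -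
      have "B m (a *\<^sub>R x + b *\<^sub>R y) k
          = L2_inner M (\<lambda>\<omega>. (a *\<^sub>R divided_derivative (\<lambda>\<omega>. v \<omega> \<bullet> x) \<omega> + b *\<^sub>R divided_derivative (\<lambda>\<omega>. v \<omega> \<bullet> y) \<omega>) \<bullet> k) (wick_monomial m)"
        unfolding B_def
      proof (rule L2_inner_cong_AE[OF _ _ mon])
        show "AE \<omega> in M. divided_derivative (\<lambda>\<omega>. v \<omega> \<bullet> (a *\<^sub>R x + b *\<^sub>R y)) \<omega> \<bullet> k
          = (a *\<^sub>R divided_derivative (\<lambda>\<omega>. v \<omega> \<bullet> x) \<omega> + b *\<^sub>R divided_derivative (\<lambda>\<omega>. v \<omega> \<bullet> y) \<omega>) \<bullet> k"
          using divided_derivative_linear[OF vh[of x] vh[of y], of a b]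
          by eventually_elim (simp add: inner_add_right)
      qed (intro L2_inner_vec L2_add L2_scaleR dvh)+
      then show ?thesis
        by (simp add: B_def inner_add_left L2_inner_add_left L2_inner_mult_left L2_mult L2_inner_vec dvh mon)
    qed
    show "B m (x + y) k = B m x k + B m y k" for x y using lin[of 1 x 1 y] by simp
    show "B m (r *\<^sub>R x) k = r *\<^sub>R B m x k" for r x using lin[of r x 0 0] by simp
    show "norm (B m x k) \<le> norm x * (L2_norm M v * norm k * L2_norm M (wick_monomial m))" for x
    proof -
      have "\<bar>B m x k\<bar> \<le> L2_norm M (\<lambda>\<omega>. divided_derivative (\<lambda>\<omega>. v \<omega> \<bullet> x) \<omega> \<bullet> k) * L2_norm M (wick_monomial m)"
        unfolding B_def by (intro L2_Cauchy_Schwarz L2_inner_vec dvh mon)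
      also have "\<dots> \<le> ((L2_norm M v * norm x) * norm k) * L2_norm M (wick_monomial m)"
        by (intro mult_right_mono order.trans[OF L2_norm_inner_vec_le[OF dvh]]
            order.trans[OF divided_derivative_norm_le[OF vh]] L2_norm_inner_vec_le v) simp_all
      finally show ?thesis by (simp add: mult_ac)
    qed
  qed
  have Bsym_basis: "B m (e i) (e j) = B m (e j) (e i)" if "set_mset m \<subseteq> J" "i \<in> J" "j \<in> J" for m i j
    using that unfolding B_def v_def
    by (simp add: divided_derivative_coord L2_inner_vec divided_derivative_L2 f add_mset_commute[of i j])
  have Bsym: "B m h k = B m k h" if m: "set_mset m \<subseteq> J" for m
  proof -
    have "B m (e i) k = B m k (e i)" if "i \<in> J" for i k
      by (rule bounded_linear_eq_basis[OF B2[OF m] B1[OF m]]) (rule Bsym_basis[OF m that])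
    then show ?thesis by (rule bounded_linear_eq_basis[OF B1[OF m] B2[OF m]])
  qed
  show ?thesis
    using Bsym unfolding B_def v_def[symmetric]
    by (intro L2_eq_wick_monomials L2_inner_vec dvh) auto
qed

section \<open>Symmetric forms of a square integrable variable\<close>

text \<open>The symmetric forms of \<open>f\<close>, all degrees at once: the length of the list selects the degree. The
recursion makes the contraction \<open>A\<^sub>n\<^sub>+\<^sub>1(h, \<cdot>)\<close> the form of \<open>(df, h)\<close> by definition, and
boundedness and multilinearity follow from the corresponding properties of \<open>d\<close>.\<close>

fun chaos_form :: "('w \<Rightarrow> real) \<Rightarrow> 'h list \<Rightarrow> real" where
  "chaos_form f [] = (\<integral>\<omega>. f \<omega> \<partial>M)"
| "chaos_form f (h # hs) = chaos_form (\<lambda>\<omega>. divided_derivative f \<omega> \<bullet> h) hs"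

lemma chaos_form_cong:
  assumes "f \<in> L2 M" "g \<in> L2 M" "AE \<omega> in M. f \<omega> = g \<omega>"
  shows "chaos_form f hs = chaos_form g hs"
proof (cases hs)
  case Nil
  then show ?thesis using assms by (auto intro: integral_cong_AE simp: L2_def)
next
  case (Cons h hs)
  then show ?thesis by (simp add: divided_derivative_cong[OF assms])
qed

lemma L2_divided_derivative_inner: "f \<in> L2 M \<Longrightarrow> (\<lambda>\<omega>. divided_derivative f \<omega> \<bullet> h) \<in> L2 M"
  by (intro L2_inner_vec divided_derivative_L2)

lemma chaos_form_linear:
  assumes "f \<in> L2 M" "g \<in> L2 M"
  shows "chaos_form (\<lambda>\<omega>. a * f \<omega> + b * g \<omega>) hs = a * chaos_form f hs + b * chaos_form g hs"
  using assms
proof (induction hs arbitrary: f g)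
  case Nil
  have "integrable M p" if "p \<in> L2 M" for p :: "'w \<Rightarrow> real"
    using L2_inner_integrable[OF that L2_const[of 1]] by simp
  then show ?case using Nil by simp
next
  case (Cons h hs)
  note f = Cons.prems(1) and g = Cons.prems(2)
  have "chaos_form (\<lambda>\<omega>. divided_derivative (\<lambda>\<omega>. a * f \<omega> + b * g \<omega>) \<omega> \<bullet> h) hs
      = chaos_form (\<lambda>\<omega>. a * (divided_derivative f \<omega> \<bullet> h) + b * (divided_derivative g \<omega> \<bullet> h)) hs"
  proof (rule chaos_form_cong)
    show "AE \<omega> in M. divided_derivative (\<lambda>\<omega>. a * f \<omega> + b * g \<omega>) \<omega> \<bullet> h
        = a * (divided_derivative f \<omega> \<bullet> h) + b * (divided_derivative g \<omega> \<bullet> h)"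
      using divided_derivative_linear[OF f g, of a b] by eventually_elim (simp add: inner_add_left)
  qed (intro L2_divided_derivative_inner L2_add L2_mult f g)+
  then show ?case using Cons.IH[OF L2_divided_derivative_inner[OF f, of h] L2_divided_derivative_inner[OF g, of h]] by simp
qed

lemma chaos_form_bound: "f \<in> L2 M \<Longrightarrow> \<bar>chaos_form f hs\<bar> \<le> L2_norm M f * prod_list (map norm hs)"
proof (induction hs arbitrary: f)
  case Nil
  then show ?case
    using L2_Cauchy_Schwarz[OF Nil L2_const[of 1]] by (simp add: L2_inner_def L2_norm_def prob_space)
next
  case (Cons h hs)
  have "\<bar>chaos_form f (h # hs)\<bar> \<le> L2_norm M (\<lambda>\<omega>. divided_derivative f \<omega> \<bullet> h) * prod_list (map norm hs)"
    using Cons.IH[OF L2_divided_derivative_inner[OF Cons.prems]] by simp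
  also have "\<dots> \<le> (L2_norm M f * norm h) * prod_list (map norm hs)"
    by (intro mult_right_mono order.trans[OF L2_norm_inner_vec_le[OF divided_derivative_L2[OF Cons.prems]]]
        divided_derivative_norm_le Cons.prems prod_list_nonneg) auto
  finally show ?case by (simp add: mult.assoc)
qed

lemma chaos_form_multilinear: "f \<in> L2 M \<Longrightarrow> multilinear_form n (chaos_form f)"
proof -
  have "linear (\<lambda>x. chaos_form f (hs[i := x]))" if "f \<in> L2 M" "i < length hs" for f hs i
    using that
  proof (induction hs arbitrary: f i)
    case (Cons h hs)
    note d = L2_divided_derivative_inner[OF Cons.prems(1)]
    show ?case
    proof (cases i)
      case 0
      have "chaos_form (\<lambda>\<omega>. divided_derivative f \<omega> \<bullet> (a *\<^sub>R x + b *\<^sub>R y)) hs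
          = a * chaos_form (\<lambda>\<omega>. divided_derivative f \<omega> \<bullet> x) hs + b * chaos_form (\<lambda>\<omega>. divided_derivative f \<omega> \<bullet> y) hs"
        for a b x y
        using chaos_form_linear[OF d[of x] d[of y], of a b hs] by (simp add: inner_add_right)
      from this[of 1 _ 1] this[of _ _ 0] show ?thesis
        unfolding 0 by (intro linearI) simp_all
    next
      case (Suc j)
      then show ?thesis using Cons.IH[OF d, of j] Cons.prems by simp
    qed
  qed simp
  then show "f \<in> L2 M \<Longrightarrow> multilinear_form n (chaos_form f)" unfolding multilinear_form_def by blast
qed

lemma chaos_form_swap:
  assumes f: "f \<in> L2 M" shows "chaos_form f (h # k # hs) = chaos_form f (k # h # hs)"
  using divided_derivative_commute[OF f]
  by simp (intro chaos_form_cong L2_divided_derivative_inner f)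

lemma chaos_form_move: "f \<in> L2 M \<Longrightarrow> chaos_form f (us @ h # vs) = chaos_form f (h # us @ vs)"
proof (induction us arbitrary: f)
  case (Cons u us)
  have "chaos_form f ((u # us) @ h # vs) = chaos_form f (u # h # us @ vs)"
    using Cons.IH[OF L2_divided_derivative_inner[OF Cons.prems]] by simp
  also have "\<dots> = chaos_form f (h # u # us @ vs)" by (rule chaos_form_swap[OF Cons.prems])
  finally show ?case by simp
qed simp

lemma chaos_form_symmetric: "f \<in> L2 M \<Longrightarrow> symmetric_form n (chaos_form f)"
proof -
  have "chaos_form f xs = chaos_form f ys" if "f \<in> L2 M" "mset xs = mset ys" for f xs ys
    using that
  proof (induction xs arbitrary: f ys)
    case (Cons x xs)
    then have "x \<in> set ys" using mset_eq_setD[OF Cons.prems(2)] by auto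
    then obtain us vs where ys: "ys = us @ x # vs" by (auto simp: in_set_conv_decomp)
    have "chaos_form f ys = chaos_form f (x # us @ vs)" unfolding ys by (rule chaos_form_move[OF Cons.prems(1)])
    also have "\<dots> = chaos_form f (x # xs)"
      using Cons.prems(2) Cons.IH[OF L2_divided_derivative_inner[OF Cons.prems(1)], of "us @ vs"] by (simp add: ys)
    finally show ?case by simp
  qed simp
  then show "f \<in> L2 M \<Longrightarrow> symmetric_form n (chaos_form f)" unfolding symmetric_form_def by blast
qed

text \<open>The denominators \<open>|m| + 1\<close> of the successive applications of \<open>d\<close> multiply up to the factorial.\<close>

lemma chaos_form_basis:
  "f \<in> L2 M \<Longrightarrow> set ks \<subseteq> J \<Longrightarrow>
    chaos_form f (map e ks) = L2_inner M f (wick_monomial (mset ks)) / fact (length ks)"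
proof (induction ks arbitrary: f)
  case Nil then show ?case by (simp add: L2_inner_def)
next
  case (Cons k ks)
  then show ?case
    using Cons.IH[OF L2_divided_derivative_inner[OF Cons.prems(1), of "e k"]]
    by (simp add: divided_derivative_coord)
qed

text \<open>Bessel's inequality in \<open>H\<close> and the contraction property of \<open>d\<close>, applied once per argument of the
form, give the Hilbert--Schmidt bound without counting the lists that share a multiset.\<close>

lemma chaos_form_square_sum:
  assumes K: "finite K" "K \<subseteq> J"
  shows "f \<in> L2 M \<Longrightarrow> (\<Sum>ks | length ks = n \<and> set ks \<subseteq> K. (chaos_form f (map e ks))\<^sup>2) \<le> L2_inner M f f"
proof (induction n arbitrary: f)
  case 0
  have "{ks. length ks = 0 \<and> set ks \<subseteq> K} = {[]}" by auto
  moreover have "(\<integral>\<omega>. f \<omega> \<partial>M)\<^sup>2 \<le> L2_inner M f f"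
    using chaos_form_bound[OF 0, of "[]"] abs_le_square_iff[of "\<integral>\<omega>. f \<omega> \<partial>M" "L2_norm M f"]
    by (simp add: L2_norm_power2)
  ultimately show ?case by simp
next
  case (Suc n)
  let ?L = "{ks. length ks = n \<and> set ks \<subseteq> K}" and ?D = "\<lambda>k \<omega>. divided_derivative f \<omega> \<bullet> e k"
  have fin: "finite ?L" using finite_lists_length_eq[OF K(1), of n] by (simp add: conj_commute)
  have d: "divided_derivative f \<in> L2 M" by (rule divided_derivative_L2[OF Suc.prems])
  have "{ks. length ks = Suc n \<and> set ks \<subseteq> K} = (\<lambda>(k, ks). k # ks) ` (K \<times> ?L)"
    by (auto simp: length_Suc_conv image_iff)
  moreover have inj: "inj_on (\<lambda>(k, ks). k # ks) (K \<times> ?L)" by (auto simp: inj_on_def)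
  ultimately have "(\<Sum>ks | length ks = Suc n \<and> set ks \<subseteq> K. (chaos_form f (map e ks))\<^sup>2)
      = (\<Sum>(k, ks)\<in>K \<times> ?L. (chaos_form (?D k) (map e ks))\<^sup>2)"
    by (simp only: sum.reindex[OF inj]) (simp add: case_prod_beta comp_def)
  also have "\<dots> = (\<Sum>k\<in>K. \<Sum>ks\<in>?L. (chaos_form (?D k) (map e ks))\<^sup>2)"
    by (rule sum.cartesian_product[symmetric])
  also have "\<dots> \<le> (\<Sum>k\<in>K. L2_inner M (?D k) (?D k))"
    by (intro sum_mono Suc.IH L2_divided_derivative_inner Suc.prems)
  also have "\<dots> = (\<integral>\<omega>. (\<Sum>k\<in>K. (?D k \<omega>)\<^sup>2) \<partial>M)"
    using L2_inner_integrable[OF L2_inner_vec[OF d] L2_inner_vec[OF d]]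
    by (simp add: L2_inner_def power2_eq_square)
  also have "\<dots> \<le> (\<integral>\<omega>. divided_derivative f \<omega> \<bullet> divided_derivative f \<omega> \<partial>M)"
    using L2_inner_integrable[OF L2_inner_vec[OF d] L2_inner_vec[OF d]] L2_inner_integrable[OF d d]
    by (intro integral_mono bessel_basis[OF K]) (auto simp: power2_eq_square)
  also have "\<dots> = (L2_norm M (divided_derivative f))\<^sup>2" by (simp add: L2_norm_power2 L2_inner_def)
  also have "\<dots> \<le> (L2_norm M f)\<^sup>2" by (intro power_mono divided_derivative_norm_le Suc.prems) simp
  finally show ?case by (simp add: L2_norm_power2)
qed

lemma chaos_form_sym_HS:
  assumes f: "f \<in> L2 M" shows "chaos_form f \<in> sym_HS J e n"
proof -
  have "(\<lambda>ks. (chaos_form f (map e ks))\<^sup>2) summable_on {ks. length ks = n \<and> set ks \<subseteq> J}"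
  proof (rule nonneg_bdd_above_summable_on)
    show "bdd_above (sum (\<lambda>ks. (chaos_form f (map e ks))\<^sup>2) ` {F. F \<subseteq> {ks. length ks = n \<and> set ks \<subseteq> J} \<and> finite F})"
    proof (rule bdd_aboveI2)
      fix F assume F: "F \<in> {F. F \<subseteq> {ks. length ks = n \<and> set ks \<subseteq> J} \<and> finite F}"
      define K where "K = (\<Union>ks\<in>F. set ks)"
      have K: "finite K" "K \<subseteq> J" using F by (auto simp: K_def)
      have "(\<Sum>ks\<in>F. (chaos_form f (map e ks))\<^sup>2)
          \<le> (\<Sum>ks | length ks = n \<and> set ks \<subseteq> K. (chaos_form f (map e ks))\<^sup>2)"
        using F finite_lists_length_eq[OF K(1), of n]
        by (intro sum_mono2) (auto simp: K_def conj_commute)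
      also have "\<dots> \<le> L2_inner M f f" by (rule chaos_form_square_sum[OF K f])
      finally show "(\<Sum>ks\<in>F. (chaos_form f (map e ks))\<^sup>2) \<le> L2_inner M f f" .
    qed
  qed simp
  moreover have "bounded_form n (chaos_form f)"
    using chaos_form_bound[OF f] by (auto simp: bounded_form_def)
  ultimately show ?thesis
    using chaos_form_multilinear[OF f] chaos_form_symmetric[OF f] by (simp add: sym_HS_def)
qed

section \<open>Ito--Wiener series in coordinates\<close>

text \<open>The convergence of a Wick series rests on this part of \<open>sym_HS\<close>, which passes at once from a form
\<open>A\<close> to its contractions \<open>A(e\<^sub>k, \<cdot>)\<close>.\<close>

definition square_summable_on_basis :: "nat \<Rightarrow> ('h list \<Rightarrow> real) \<Rightarrow> bool" where
  "square_summable_on_basis n B \<longleftrightarrow>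
     (\<lambda>ks. (B (map e ks))\<^sup>2) summable_on {ks. length ks = n \<and> set ks \<subseteq> J}"

lemma length_sorted_list_of_multiset: "length (sorted_list_of_multiset m) = size m"
  by (metis mset_sorted_list_of_multiset size_mset)

lemma wick_coeff_conv: "wick_coeff e B m = fact (size m) / multiset_fact m * B (map e (sorted_list_of_multiset m))"
  by (simp add: wick_coeff_def multiset_fact_def)

lemma multiset_fact_ge_1: "1 \<le> multiset_fact m"
  unfolding multiset_fact_def by (intro prod_ge_1) (simp add: fact_ge_1)

text \<open>Each multiset contributes through its sorted list only, so the sum over multisets is bounded by a
sum over lists; the combinatorial factors are bounded by \<open>(n!)\<^sup>2\<close>.\<close>

lemma wick_tendsto:
  assumes B: "square_summable_on_basis n B"
  shows "L2_tendsto M (\<lambda>F \<omega>. \<Sum>m\<in>F. wick_coeff e B m * wick_monomial m \<omega>) (wick M \<xi> J e n B)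
    (finite_subsets_at_top {m. size m = n \<and> set_mset m \<subseteq> J})"
proof -
  let ?I = "{m. size m = n \<and> set_mset m \<subseteq> J}" and ?L = "{ks. length ks = n \<and> set ks \<subseteq> J}"
  define b where "b ks = (B (map e ks))\<^sup>2" for ks
  have "\<exists>S. L2_tendsto M (\<lambda>F \<omega>. \<Sum>m\<in>F. wick_coeff e B m * wick_monomial m \<omega>) S (finite_subsets_at_top ?I)"
  proof (rule wick_series_exists[where C = "(fact n)\<^sup>2 * infsum b ?L"])
    fix F assume F: "finite F" "F \<subseteq> ?I"
    have "(\<Sum>m\<in>F. (wick_coeff e B m)\<^sup>2 * multiset_fact m) \<le> (\<Sum>m\<in>F. (fact n)\<^sup>2 * b (sorted_list_of_multiset m))"
    proof (rule sum_mono)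
      fix m assume "m \<in> F"
      then have m: "m \<in> ?I" using F by auto
      have "(wick_coeff e B m)\<^sup>2 * multiset_fact m = (fact n)\<^sup>2 * b (sorted_list_of_multiset m) / multiset_fact m"
        using m by (simp add: wick_coeff_conv b_def power_mult_distrib power_divide power2_eq_square)
      also have "\<dots> \<le> (fact n)\<^sup>2 * b (sorted_list_of_multiset m) / 1"
        using multiset_fact_ge_1[of m] by (intro divide_left_mono) (auto simp: b_def)
      finally show "(wick_coeff e B m)\<^sup>2 * multiset_fact m \<le> (fact n)\<^sup>2 * b (sorted_list_of_multiset m)"
        by simp
    qed
    also have "\<dots> = (fact n)\<^sup>2 * (\<Sum>ks\<in>sorted_list_of_multiset ` F. b ks)"
    proof -
      have "inj_on sorted_list_of_multiset F"
        by (rule inj_on_inverseI[where g = mset]) simp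
      then show ?thesis by (simp add: sum_distrib_left sum.reindex)
    qed
    also have "\<dots> \<le> (fact n)\<^sup>2 * infsum b ?L"
    proof (intro mult_left_mono finite_sum_le_infsum)
      show "b summable_on ?L" using B by (simp add: square_summable_on_basis_def b_def[abs_def])
      show "sorted_list_of_multiset ` F \<subseteq> ?L" using F(2) by (force simp: length_sorted_list_of_multiset)
    qed (use F in \<open>auto simp: b_def\<close>)
    finally show "(\<Sum>m\<in>F. (wick_coeff e B m)\<^sup>2 * multiset_fact m) \<le> (fact n)\<^sup>2 * infsum b ?L" .
  qed auto
  then show ?thesis
    unfolding wick_def L2_Lim_def wick_monomial_def[abs_def] by (rule someI_ex)
qed

lemma
  assumes B: "square_summable_on_basis n B"
  shows wick_L2: "wick M \<xi> J e n B \<in> L2 M"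
    and wick_inner_monomial: "set_mset m \<subseteq> J \<Longrightarrow> L2_inner M (wick M \<xi> J e n B) (wick_monomial m)
      = (if size m = n then fact n * B (map e (sorted_list_of_multiset m)) else 0)"
proof -
  note lim = wick_tendsto[OF B]
  show "wick M \<xi> J e n B \<in> L2 M" using lim by (simp add: L2_tendsto_def)
  assume m: "set_mset m \<subseteq> J"
  have "L2_inner M (wick M \<xi> J e n B) (wick_monomial m)
      = (if m \<in> {m. size m = n \<and> set_mset m \<subseteq> J} then wick_coeff e B m * multiset_fact m else 0)"
    by (rule wick_series_inner[OF lim _ m]) auto
  then show "L2_inner M (wick M \<xi> J e n B) (wick_monomial m)
      = (if size m = n then fact n * B (map e (sorted_list_of_multiset m)) else 0)"
    using m by (auto simp: wick_coeff_conv)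
qed

text \<open>Coordinates of a weighted sum of Wick series. The weights \<open>1\<close> and \<open>n + 1\<close> are those of the
operators \<open>d\<close> and \<open>D\<close>.\<close>

lemma wick_series_coord:
  assumes B: "\<And>n. square_summable_on_basis n (B n)"
    and lim: "L2_tendsto M (\<lambda>N \<omega>. \<Sum>n<N. c n * wick M \<xi> J e n (B n) \<omega>) f sequentially"
    and m: "set_mset m \<subseteq> J"
  shows "L2_inner M f (wick_monomial m)
    = c (size m) * (fact (size m) * B (size m) (map e (sorted_list_of_multiset m)))"
proof (rule tendsto_unique[OF _ L2_tendsto_inner[OF lim wick_monomial_L2[OF m]]])
  let ?x = "c (size m) * (fact (size m) * B (size m) (map e (sorted_list_of_multiset m)))"
  have "L2_inner M (\<lambda>\<omega>. \<Sum>n<N. c n * wick M \<xi> J e n (B n) \<omega>) (wick_monomial m) = ?x" if "N > size m" for N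
  proof -
    have "L2_inner M (\<lambda>\<omega>. \<Sum>n<N. c n * wick M \<xi> J e n (B n) \<omega>) (wick_monomial m)
        = (\<Sum>n<N. L2_inner M (\<lambda>\<omega>. c n * wick M \<xi> J e n (B n) \<omega>) (wick_monomial m))"
      by (intro L2_inner_sum_left L2_mult wick_L2 B wick_monomial_L2 m)
    also have "\<dots> = (\<Sum>n<N. if n = size m then ?x else 0)"
      by (intro sum.cong refl) (simp add: L2_inner_mult_left wick_inner_monomial[OF B m])
    finally show ?thesis using that by simp
  qed
  then have "\<forall>\<^sub>F N in sequentially. L2_inner M (\<lambda>\<omega>. \<Sum>n<N. c n * wick M \<xi> J e n (B n) \<omega>) (wick_monomial m) = ?x"
    by (rule eventually_mono[OF eventually_gt_at_top])
  then show "(\<lambda>N. L2_inner M (\<lambda>\<omega>. \<Sum>n<N. c n * wick M \<xi> J e n (B n) \<omega>) (wick_monomial m)) \<longlonglongrightarrow> ?x"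
    by (rule tendsto_eventually)
qed simp

lemma sym_HS_square_summable: "A \<in> sym_HS J e n \<Longrightarrow> square_summable_on_basis n A"
  by (simp add: sym_HS_def square_summable_on_basis_def)

lemma sym_HS_contract_square_summable:
  assumes A: "A \<in> sym_HS J e (Suc n)" and k: "k \<in> J"
  shows "square_summable_on_basis n (\<lambda>xs. A (e k # xs))"
proof -
  let ?L = "\<lambda>n. {ks. length ks = n \<and> set ks \<subseteq> J}"
  have "(\<lambda>ks. (A (map e ks))\<^sup>2) summable_on ((#) k) ` ?L n"
    by (rule summable_on_subset_banach[of _ "?L (Suc n)"]) (use A k in \<open>auto simp: sym_HS_def\<close>)
  then have "((\<lambda>ks. (A (map e ks))\<^sup>2) \<circ> (#) k) summable_on ?L n"
    by (subst (asm) summable_on_reindex) auto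
  then show ?thesis by (simp add: square_summable_on_basis_def comp_def)
qed

text \<open>So the \<open>n\<close>-th Wick series of \<open>chaos_form f\<close> is the projection of \<open>f\<close> on the degree \<open>n\<close>.\<close>

lemma wick_chaos_form_coord:
  assumes f: "f \<in> L2 M" and m: "set_mset m \<subseteq> J"
  shows "L2_inner M (wick M \<xi> J e n (chaos_form f)) (wick_monomial m)
    = (if size m = n then L2_inner M f (wick_monomial m) else 0)"
proof -
  have "chaos_form f (map e (sorted_list_of_multiset m)) = L2_inner M f (wick_monomial m) / fact (size m)"
    using chaos_form_basis[OF f, of "sorted_list_of_multiset m"] m
    by (simp flip: size_mset)
  then show ?thesis
    by (simp add: wick_inner_monomial[OF sym_HS_square_summable[OF chaos_form_sym_HS[OF f]] m])
qed

lemma wick_chaos_form_L2: "f \<in> L2 M \<Longrightarrow> wick M \<xi> J e n (chaos_form f) \<in> L2 M"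
  by (intro wick_L2 sym_HS_square_summable chaos_form_sym_HS)

lemma ito_wiener_chaos_form:
  assumes f: "f \<in> L2 M" shows "ito_wiener M \<xi> J e f (\<lambda>_. chaos_form f)"
  unfolding ito_wiener_def
  by (intro conjI allI chaos_form_sym_HS graded_sum_tendsto wick_chaos_form_L2 wick_chaos_form_coord f)

lemma ito_wiener_coord:
  assumes A: "ito_wiener M \<xi> J e f A" and m: "set_mset m \<subseteq> J"
  shows "L2_inner M f (wick_monomial m) = fact (size m) * A (size m) (map e (sorted_list_of_multiset m))"
proof -
  have "L2_tendsto M (\<lambda>N \<omega>. \<Sum>n<N. 1 * wick M \<xi> J e n (A n) \<omega>) f sequentially"
    using A by (simp add: ito_wiener_def)
  from wick_series_coord[OF _ this m] show ?thesis
    using A by (simp add: ito_wiener_def sym_HS_square_summable)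
qed

text \<open>The index shift, for an arbitrary choice of the forms \<open>A\<close> representing \<open>f\<close>: by symmetry,
\<open>A(e\<^sub>k, e\<^sub>m)\<close> is the value of \<open>A\<close> at the multiset \<open>m + k\<close>, which is determined by \<open>f\<close>.\<close>

lemma contracted_series_coord:
  assumes A: "ito_wiener M \<xi> J e f A"
    and lim: "L2_tendsto M (\<lambda>N \<omega>. \<Sum>n<N. c n * wick M \<xi> J e n (\<lambda>xs. A (Suc n) (e k # xs)) \<omega>) g sequentially"
    and k: "k \<in> J" and m: "set_mset m \<subseteq> J"
  shows "L2_inner M g (wick_monomial m)
    = c (size m) * L2_inner M f (wick_monomial (add_mset k m)) / real (Suc (size m))"
proof -
  let ?s = "sorted_list_of_multiset"
  have AS: "A n \<in> sym_HS J e n" for n using A by (simp add: ito_wiener_def)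
  have "A (Suc (size m)) (e k # map e (?s m)) = A (Suc (size m)) (map e (?s (add_mset k m)))"
  proof -
    have "symmetric_form (Suc (size m)) (A (Suc (size m)))" using AS[of "Suc (size m)"] by (simp add: sym_HS_def)
    moreover have "length (e k # map e (?s m)) = Suc (size m)" by (simp flip: size_mset)
    moreover have "mset (e k # map e (?s m)) = mset (map e (?s (add_mset k m)))"
      by (simp del: sorted_list_of_multiset_insert)
    ultimately show ?thesis unfolding symmetric_form_def by blast
  qed
  then have "L2_inner M f (wick_monomial (add_mset k m))
      = real (Suc (size m)) * (fact (size m) * A (Suc (size m)) (e k # map e (?s m)))"
    using ito_wiener_coord[OF A, of "add_mset k m"] k m by simp
  moreover have "L2_inner M g (wick_monomial m)
      = c (size m) * (fact (size m) * A (Suc (size m)) (e k # map e (?s m)))"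
    by (rule wick_series_coord[OF sym_HS_contract_square_summable[OF AS k] lim m])
  ultimately show ?thesis by (simp del: of_nat_Suc)
qed

lemma stoch_deriv_coord:
  assumes v: "stoch_deriv M \<xi> J e f v" and k: "k \<in> J" and m: "set_mset m \<subseteq> J"
  shows "L2_inner M (\<lambda>\<omega>. v \<omega> \<bullet> e k) (wick_monomial m) = L2_inner M f (wick_monomial (add_mset k m))"
proof -
  obtain A where A: "ito_wiener M \<xi> J e f A"
    and lim: "\<And>h. L2_tendsto M (\<lambda>N \<omega>. \<Sum>n<N. real (Suc n) * wick M \<xi> J e n (\<lambda>xs. A (Suc n) (h # xs)) \<omega>)
      (\<lambda>\<omega>. v \<omega> \<bullet> h) sequentially"
    using v unfolding stoch_deriv_def by blast
  show ?thesis using contracted_series_coord[OF A lim k m] by (simp del: of_nat_Suc)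
qed

text \<open>The hypothesis says that \<open>f\<close> arises from \<open>g\<close> by multiplying the degree \<open>n\<close> by \<open>n\<close>, for every
\<open>n \<ge> 1\<close>; this compensates the division by the degree, so that \<open>df = Dg\<close>. The constant term of
\<open>f\<close> is free, since \<open>d\<close> annihilates it.\<close>

lemma stoch_deriv_divided_derivative:
  assumes f: "f \<in> L2 M" and g: "g \<in> L2 M"
    and coord: "\<And>m. set_mset m \<subseteq> J \<Longrightarrow> m \<noteq> {#} \<Longrightarrow>
      L2_inner M f (wick_monomial m) = real (size m) * L2_inner M g (wick_monomial m)"
  shows "stoch_deriv M \<xi> J e g (divided_derivative f)"
  unfolding stoch_deriv_def
proof (intro conjI exI[of _ "\<lambda>_. chaos_form g"] allI)
  show "divided_derivative f \<in> L2 M" by (rule divided_derivative_L2[OF f])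
  show "ito_wiener M \<xi> J e g (\<lambda>_. chaos_form g)" by (rule ito_wiener_chaos_form[OF g])
  fix h
  have "L2_inner M (\<lambda>\<omega>. divided_derivative f \<omega> \<bullet> h) (wick_monomial m)
      = real (Suc (size m)) * L2_inner M (\<lambda>\<omega>. divided_derivative g \<omega> \<bullet> h) (wick_monomial m)"
    if m: "set_mset m \<subseteq> J" for m
  proof (rule bounded_linear_eq_basis)
    note mon = wick_monomial_L2[OF m]
    show "bounded_linear (\<lambda>h. L2_inner M (\<lambda>\<omega>. divided_derivative f \<omega> \<bullet> h) (wick_monomial m))"
      by (rule bounded_linear_L2_inner_vec[OF divided_derivative_L2[OF f] mon])
    show "bounded_linear (\<lambda>h. real (Suc (size m)) * L2_inner M (\<lambda>\<omega>. divided_derivative g \<omega> \<bullet> h) (wick_monomial m))"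
      by (intro bounded_linear_const_mult bounded_linear_L2_inner_vec divided_derivative_L2 g mon)
    fix k assume k: "k \<in> J"
    show "L2_inner M (\<lambda>\<omega>. divided_derivative f \<omega> \<bullet> e k) (wick_monomial m)
      = real (Suc (size m)) * L2_inner M (\<lambda>\<omega>. divided_derivative g \<omega> \<bullet> e k) (wick_monomial m)"
      using coord[of "add_mset k m"] k m by (simp add: divided_derivative_coord[OF _ k m] f g)
  qed
  then have "L2_tendsto M (\<lambda>N \<omega>. \<Sum>n<N. real (Suc n) * wick M \<xi> J e n (chaos_form (\<lambda>\<omega>. divided_derivative g \<omega> \<bullet> h)) \<omega>)
      (\<lambda>\<omega>. divided_derivative f \<omega> \<bullet> h) sequentially"
    by (intro graded_sum_tendsto L2_divided_derivative_inner L2_mult wick_chaos_form_L2 f g)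
      (simp add: L2_inner_mult_left wick_chaos_form_coord L2_divided_derivative_inner g)
  then show "L2_tendsto M (\<lambda>N \<omega>. \<Sum>n<N. real (Suc n) * wick M \<xi> J e n (\<lambda>xs. chaos_form g (h # xs)) \<omega>)
      (\<lambda>\<omega>. divided_derivative f \<omega> \<bullet> h) sequentially"
    by simp
qed

text \<open>The defining property of \<open>d_op\<close> has a solution, and it fixes the coordinates of any solution.\<close>

lemma d_op_eq_divided_derivative:
  assumes f: "f \<in> L2 M"
  shows "d_op M \<xi> J e f \<in> L2 M" and "AE \<omega> in M. d_op M \<xi> J e f \<omega> = divided_derivative f \<omega>"
proof -
  define P where "P v \<longleftrightarrow> v \<in> L2 M \<and> (\<exists>A. ito_wiener M \<xi> J e f A \<and>
         (\<forall>h. L2_tendsto M (\<lambda>N \<omega>. \<Sum>n<N. wick M \<xi> J e n (\<lambda>xs. A (Suc n) (h # xs)) \<omega>)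
                (\<lambda>\<omega>. v \<omega> \<bullet> h) sequentially))" for v
  have "P (divided_derivative f)"
    unfolding P_def
  proof (intro conjI exI[of _ "\<lambda>_. chaos_form f"] allI)
    fix h
    have "L2_tendsto M (\<lambda>N \<omega>. \<Sum>n<N. wick M \<xi> J e n (chaos_form (\<lambda>\<omega>. divided_derivative f \<omega> \<bullet> h)) \<omega>)
        (\<lambda>\<omega>. divided_derivative f \<omega> \<bullet> h) sequentially"
      using ito_wiener_chaos_form[OF L2_divided_derivative_inner[OF f]] by (simp add: ito_wiener_def)
    then show "L2_tendsto M (\<lambda>N \<omega>. \<Sum>n<N. wick M \<xi> J e n (\<lambda>xs. chaos_form f (h # xs)) \<omega>)
        (\<lambda>\<omega>. divided_derivative f \<omega> \<bullet> h) sequentially"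
      by simp
  qed (intro divided_derivative_L2 ito_wiener_chaos_form f)+
  then have "P (SOME v. P v)" by (rule someI[of P])
  then have P: "P (d_op M \<xi> J e f)" by (simp only: d_op_def P_def)
  then show L2: "d_op M \<xi> J e f \<in> L2 M" by (simp add: P_def)
  obtain A where A: "ito_wiener M \<xi> J e f A"
    and lim: "\<And>h. L2_tendsto M (\<lambda>N \<omega>. \<Sum>n<N. 1 * wick M \<xi> J e n (\<lambda>xs. A (Suc n) (h # xs)) \<omega>)
      (\<lambda>\<omega>. d_op M \<xi> J e f \<omega> \<bullet> h) sequentially"
    using P by (auto simp: P_def)
  show "AE \<omega> in M. d_op M \<xi> J e f \<omega> = divided_derivative f \<omega>"
  proof (rule L2_vec_eq_wick_monomials[OF L2 divided_derivative_L2[OF f]])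
    fix k m assume k: "k \<in> J" and m: "set_mset m \<subseteq> J"
    show "L2_inner M (\<lambda>\<omega>. d_op M \<xi> J e f \<omega> \<bullet> e k) (wick_monomial m)
      = L2_inner M (\<lambda>\<omega>. divided_derivative f \<omega> \<bullet> e k) (wick_monomial m)"
      using contracted_series_coord[OF A lim k m] by (simp add: divided_derivative_coord[OF f k m])
  qed
qed

section \<open>Duality and minimality\<close>

text \<open>Expanding \<open>df = \<Sum>\<^sub>m c\<^sub>m d\<Phi>\<^sub>m\<close>, where \<open>c\<^sub>m\<close> are the coordinates of \<open>f\<close>, each pairing
\<open>\<langle>D\<gamma>, d\<Phi>\<^sub>m\<rangle>\<close> equals \<open>\<langle>\<gamma>, \<Phi>\<^sub>m\<rangle>\<close> for \<open>m \<noteq> \<emptyset>\<close> and \<open>0\<close> for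
\<open>m = \<emptyset>\<close>. The result is the expansion of \<open>\<langle>\<gamma>, f - Ef\<rangle>\<close>.\<close>

lemma divided_derivative_adjoint:
  assumes f: "f \<in> L2 M"
  shows "ext_integral_graph M \<xi> J e (divided_derivative f) (\<lambda>\<omega>. f \<omega> - (\<integral>\<omega>'. f \<omega>' \<partial>M))"
  unfolding ext_integral_graph_def
proof (intro conjI allI impI)
  define \<beta> where "\<beta> \<omega> = f \<omega> - (\<integral>\<omega>'. f \<omega>' \<partial>M)" for \<omega>
  show \<beta>: "(\<lambda>\<omega>. f \<omega> - (\<integral>\<omega>'. f \<omega>' \<partial>M)) \<in> L2 M" by (intro L2_diff L2_const f)
  then have \<beta>': "\<beta> \<in> L2 M" by (simp add: \<beta>_def[abs_def])
  show "divided_derivative f \<in> L2 M" by (rule divided_derivative_L2[OF f])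
  have fi: "integrable M f" using L2_inner_integrable[OF f L2_const[of 1]] by simp
  have \<beta>_coord: "L2_inner M \<beta> (wick_monomial m) = (if m = {#} then 0 else L2_inner M f (wick_monomial m))"
    if m: "set_mset m \<subseteq> J" for m
  proof -
    have "L2_inner M (\<lambda>_. c) (wick_monomial m) = (if m = {#} then c else 0)" for c
      using wick_monomial_inner[of "{#}" m] m L2_inner_mult_left[of M c "\<lambda>_. 1" "wick_monomial m"]
      by (auto simp: multiset_fact_def)
    then show ?thesis
      unfolding \<beta>_def[abs_def] L2_inner_diff_left[OF f L2_const wick_monomial_L2[OF m]]
      by (auto simp: L2_inner_def)
  qed
  fix \<gamma> v assume v: "stoch_deriv M \<xi> J e \<gamma> v"
  then have vL2: "v \<in> L2 M" by (simp add: stoch_deriv_def)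
  have \<gamma>: "\<gamma> \<in> L2 M" using v by (auto simp: stoch_deriv_def ito_wiener_def L2_tendsto_def)
  let ?F = "finite_subsets_at_top wick_indices"
  have "((\<lambda>F. L2_inner M (\<lambda>\<omega>. \<Sum>m\<in>F. wick_coord f m *\<^sub>R wick_gradient m \<omega>) v) \<longlongrightarrow> L2_inner M (divided_derivative f) v) ?F"
    by (rule L2_tendsto_inner[OF divided_derivative_tendsto[OF f] vL2])
  moreover have "((\<lambda>F. L2_inner M (\<lambda>\<omega>. \<Sum>m\<in>F. wick_coord \<beta> m * wick_monomial m \<omega>) \<gamma>) \<longlongrightarrow> L2_inner M \<beta> \<gamma>) ?F"
    by (rule L2_tendsto_inner[OF wick_expansion[OF \<beta>'] \<gamma>])
  moreover have "\<forall>\<^sub>F F in ?F. L2_inner M (\<lambda>\<omega>. \<Sum>m\<in>F. wick_coord f m *\<^sub>R wick_gradient m \<omega>) v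
      = L2_inner M (\<lambda>\<omega>. \<Sum>m\<in>F. wick_coord \<beta> m * wick_monomial m \<omega>) \<gamma>"
  proof (rule eventually_finite_subsets_at_top_weakI)
    fix F assume F: "finite F" "F \<subseteq> wick_indices"
    have "L2_inner M (\<lambda>\<omega>. \<Sum>m\<in>F. wick_coord f m *\<^sub>R wick_gradient m \<omega>) v
        = (\<Sum>m\<in>F. wick_coord f m * L2_inner M (wick_gradient m) v)"
      using F vL2 by (subst L2_inner_sum_left) (auto intro!: L2_scaleR wick_gradient_L2 simp: L2_inner_scaleR_left)
    also have "\<dots> = (\<Sum>m\<in>F. wick_coord \<beta> m * L2_inner M (wick_monomial m) \<gamma>)"
    proof (rule sum.cong[OF refl])
      fix m assume "m \<in> F"
      then have m: "set_mset m \<subseteq> J" using F by auto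
      have "L2_inner M v (wick_gradient m) = (if m = {#} then 0 else L2_inner M \<gamma> (wick_monomial m))"
      proof (rule L2_inner_wick_gradient[OF vL2 m])
        fix k assume k: "k \<in># m"
        then have "k \<in> J" "set_mset (m - {#k#}) \<subseteq> J" using m by (auto dest: in_diffD)
        from stoch_deriv_coord[OF v this] k
        show "L2_inner M (\<lambda>\<omega>. v \<omega> \<bullet> e k) (wick_monomial (m - {#k#})) = L2_inner M \<gamma> (wick_monomial m)"
          by simp
      qed
      then show "wick_coord f m * L2_inner M (wick_gradient m) v = wick_coord \<beta> m * L2_inner M (wick_monomial m) \<gamma>"
        by (simp add: wick_coord_def \<beta>_coord[OF m] L2_inner_commute[of M v] L2_inner_commute[of M \<gamma>])
    qed
    also have "\<dots> = L2_inner M (\<lambda>\<omega>. \<Sum>m\<in>F. wick_coord \<beta> m * wick_monomial m \<omega>) \<gamma>"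
      using F \<gamma> by (subst L2_inner_sum_left) (auto intro!: L2_mult wick_monomial_L2 simp: L2_inner_mult_left)
    finally show "L2_inner M (\<lambda>\<omega>. \<Sum>m\<in>F. wick_coord f m *\<^sub>R wick_gradient m \<omega>) v
      = L2_inner M (\<lambda>\<omega>. \<Sum>m\<in>F. wick_coord \<beta> m * wick_monomial m \<omega>) \<gamma>" .
  qed
  ultimately have "L2_inner M (divided_derivative f) v = L2_inner M \<beta> \<gamma>"
    by (intro tendsto_unique[OF finite_subsets_at_top_neq_bot]) (auto intro: Lim_transform_eventually)
  then show "(\<integral>\<omega>. v \<omega> \<bullet> divided_derivative f \<omega> \<partial>M) = (\<integral>\<omega>. \<gamma> \<omega> * (f \<omega> - (\<integral>\<omega>'. f \<omega>' \<partial>M)) \<partial>M)"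
    by (simp add: L2_inner_def \<beta>_def inner_commute mult.commute)
qed

lemma stoch_deriv_wick_monomial:
  assumes m: "set_mset m \<subseteq> J" shows "\<exists>v. stoch_deriv M \<xi> J e (wick_monomial m) v"
proof
  show "stoch_deriv M \<xi> J e (wick_monomial m) (divided_derivative (\<lambda>\<omega>. real (size m) * wick_monomial m \<omega>))"
    using m by (intro stoch_deriv_divided_derivative L2_mult wick_monomial_L2)
      (auto simp: L2_inner_mult_left wick_monomial_inner)
qed

text \<open>\<open>D\<close> is densely defined, its domain containing the Wick monomials, so its adjoint is
single-valued.\<close>

lemma ext_integral_graph_unique:
  assumes "ext_integral_graph M \<xi> J e u \<beta>" "ext_integral_graph M \<xi> J e u \<beta>'"
  shows "AE \<omega> in M. \<beta> \<omega> = \<beta>' \<omega>"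
proof (rule L2_eq_wick_monomials)
  show "\<beta> \<in> L2 M" "\<beta>' \<in> L2 M" using assms by (auto simp: ext_integral_graph_def)
  fix m assume m: "set_mset m \<subseteq> J"
  obtain v where v: "stoch_deriv M \<xi> J e (wick_monomial m) v" using stoch_deriv_wick_monomial[OF m] ..
  have "(\<integral>\<omega>. wick_monomial m \<omega> * \<beta> \<omega> \<partial>M) = (\<integral>\<omega>. wick_monomial m \<omega> * \<beta>' \<omega> \<partial>M)"
    using assms v unfolding ext_integral_graph_def by metis
  then show "L2_inner M \<beta> (wick_monomial m) = L2_inner M \<beta>' (wick_monomial m)"
    by (simp add: L2_inner_def mult.commute)
qed

text \<open>Frees the integrands from the choice of a representative in \<open>ext_integral\<close>.\<close>

lemma integrands_iff:
  assumes f: "f \<in> L2 M"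
  shows "u \<in> integrands M \<xi> J e f \<longleftrightarrow> ext_integral_graph M \<xi> J e u (\<lambda>\<omega>. f \<omega> - (\<integral>\<omega>'. f \<omega>' \<partial>M))"
proof
  let ?\<beta> = "\<lambda>\<omega>. f \<omega> - (\<integral>\<omega>'. f \<omega>' \<partial>M)"
  have \<beta>: "?\<beta> \<in> L2 M" by (intro L2_diff L2_const f)
  {
    assume "u \<in> integrands M \<xi> J e f"
    then have ex: "\<exists>\<beta>. ext_integral_graph M \<xi> J e u \<beta>" and ae: "AE \<omega> in M. ext_integral M \<xi> J e u \<omega> = ?\<beta> \<omega>"
      by (auto simp: integrands_def Dom_ext_integral_def)
    from ex have g: "ext_integral_graph M \<xi> J e u (ext_integral M \<xi> J e u)"
      unfolding ext_integral_def by (rule someI_ex)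
    then have I: "ext_integral M \<xi> J e u \<in> L2 M" by (simp add: ext_integral_graph_def)
    show "ext_integral_graph M \<xi> J e u ?\<beta>"
      unfolding ext_integral_graph_def
    proof (intro conjI allI impI \<beta>)
      show "u \<in> L2 M" using g by (simp add: ext_integral_graph_def)
      fix \<gamma> v assume v: "stoch_deriv M \<xi> J e \<gamma> v"
      then have \<gamma>: "\<gamma> \<in> L2 M" by (auto simp: stoch_deriv_def ito_wiener_def L2_tendsto_def)
      have "(\<integral>\<omega>. v \<omega> \<bullet> u \<omega> \<partial>M) = L2_inner M (ext_integral M \<xi> J e u) \<gamma>"
        using g v by (simp add: ext_integral_graph_def L2_inner_def mult.commute)
      also have "\<dots> = L2_inner M ?\<beta> \<gamma>" by (rule L2_inner_cong_AE[OF I \<beta> \<gamma> ae])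
      finally show "(\<integral>\<omega>. v \<omega> \<bullet> u \<omega> \<partial>M) = (\<integral>\<omega>. \<gamma> \<omega> * ?\<beta> \<omega> \<partial>M)"
        by (simp add: L2_inner_def mult.commute)
    qed
  next
    assume g: "ext_integral_graph M \<xi> J e u ?\<beta>"
    then have "ext_integral_graph M \<xi> J e u (ext_integral M \<xi> J e u)"
      unfolding ext_integral_def by (rule someI[of "ext_integral_graph M \<xi> J e u"])
    with g show "u \<in> integrands M \<xi> J e f"
      by (auto simp: integrands_def Dom_ext_integral_def intro: ext_integral_graph_unique)
  }
qed

text \<open>The witness divides the degree \<open>n\<close> of \<open>f\<close> by \<open>n\<close>; its constant term is \<open>0\<close>, as \<open>x / 0 = 0\<close>.\<close>

lemma divided_derivative_is_stoch_deriv: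
  assumes f: "f \<in> L2 M" shows "\<exists>g. stoch_deriv M \<xi> J e g (divided_derivative f)"
proof -
  define c where "c m = wick_coord f m / real (size m)" for m
  have "(\<Sum>m\<in>F. (c m)\<^sup>2 * multiset_fact m) \<le> L2_inner M f f" if F: "finite F" "F \<subseteq> wick_indices" for F
  proof -
    have "(\<Sum>m\<in>F. (c m)\<^sup>2 * multiset_fact m) \<le> (\<Sum>m\<in>F. (wick_coord f m)\<^sup>2 * multiset_fact m)"
    proof (intro sum_mono mult_right_mono)
      fix m
      have "\<bar>c m\<bar> \<le> \<bar>wick_coord f m\<bar> / 1" if "m \<noteq> {#}"
        using that unfolding c_def abs_divide
        by (intro divide_left_mono) (auto simp: Suc_le_eq nonempty_has_size)
      then show "(c m)\<^sup>2 \<le> (wick_coord f m)\<^sup>2"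
        unfolding abs_le_square_iff[symmetric] by (cases "m = {#}") (simp_all add: c_def)
    qed simp
    then show ?thesis using wick_bessel[OF f F] by linarith
  qed
  then obtain g where g: "L2_tendsto M (\<lambda>F \<omega>. \<Sum>m\<in>F. c m * wick_monomial m \<omega>) g (finite_subsets_at_top wick_indices)"
    using wick_series_exists[OF subset_refl] by blast
  then have gL2: "g \<in> L2 M" by (simp add: L2_tendsto_def)
  have "L2_inner M g (wick_monomial m) = L2_inner M f (wick_monomial m) / real (size m)" if "set_mset m \<subseteq> J" for m
    using that by (simp add: wick_series_inner[OF g subset_refl] c_def wick_coord_def)
  then show ?thesis
    by (intro exI[of _ g] stoch_deriv_divided_derivative[OF f gL2]) simp
qed

text \<open>Pythagoras in the affine space of integrands: the difference of two integrands is orthogonal to the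
range of \<open>D\<close>, and \<open>df\<close> lies in this range.\<close>

lemma integrands_norm:
  assumes f: "f \<in> L2 M" and u: "u \<in> integrands M \<xi> J e f"
  shows "L2_inner M u u = L2_inner M (divided_derivative f) (divided_derivative f)
    + L2_inner M (\<lambda>\<omega>. u \<omega> - divided_derivative f \<omega>) (\<lambda>\<omega>. u \<omega> - divided_derivative f \<omega>)"
proof -
  let ?d = "divided_derivative f"
  define w where "w \<omega> = u \<omega> - ?d \<omega>" for \<omega>
  have d: "?d \<in> L2 M" by (rule divided_derivative_L2[OF f])
  have gu: "ext_integral_graph M \<xi> J e u (\<lambda>\<omega>. f \<omega> - (\<integral>\<omega>'. f \<omega>' \<partial>M))" using u by (simp add: integrands_iff[OF f])
  then have uL2: "u \<in> L2 M" by (simp add: ext_integral_graph_def)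
  have w: "w \<in> L2 M" unfolding w_def[abs_def] by (rule L2_diff[OF uL2 d])
  obtain g where g: "stoch_deriv M \<xi> J e g ?d" using divided_derivative_is_stoch_deriv[OF f] ..
  have "L2_inner M ?d u = L2_inner M ?d ?d"
    using gu divided_derivative_adjoint[OF f] g unfolding ext_integral_graph_def L2_inner_def by simp
  then have "L2_inner M ?d w = 0"
    unfolding w_def[abs_def] by (subst L2_inner_commute) (simp add: L2_inner_diff_left uL2 d L2_inner_commute[of M u])
  then have "L2_inner M (\<lambda>\<omega>. ?d \<omega> + 1 *\<^sub>R w \<omega>) (\<lambda>\<omega>. ?d \<omega> + 1 *\<^sub>R w \<omega>) = L2_inner M ?d ?d + L2_inner M w w"
    unfolding L2_inner_self_scaled_add[OF d w] by simp
  moreover have "(\<lambda>\<omega>. ?d \<omega> + 1 *\<^sub>R w \<omega>) = u" by (simp add: w_def)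
  ultimately show ?thesis by (simp only: w_def[abs_def])
qed

end

theorem lemma6:
  fixes M :: "'w measure"
    and \<xi> :: "'h::{real_inner, banach, second_countable_topology} \<Rightarrow> 'w \<Rightarrow> real"
    and J :: "nat set" and e :: "nat \<Rightarrow> 'h"
    and \<alpha> :: "'w \<Rightarrow> real"
  assumes "prob_space M"
    and "white_noise M \<xi>"
    and "sets M = noise_sigma M \<xi>"
    and "orthonormal_basis J e"
    and "\<alpha> \<in> L2 M"
  shows "(\<exists>u. is_arg_min (\<lambda>u. \<integral>\<omega>. (norm (u \<omega>))\<^sup>2 \<partial>M) (\<lambda>u. u \<in> integrands M \<xi> J e \<alpha>) u) \<and>
         (\<forall>u. is_arg_min (\<lambda>u. \<integral>\<omega>. (norm (u \<omega>))\<^sup>2 \<partial>M) (\<lambda>u. u \<in> integrands M \<xi> J e \<alpha>) u \<longrightarrow>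
              (AE \<omega> in M. u \<omega> = d_op M \<xi> J e \<alpha> \<omega>))"
proof -
  interpret white_noise_basis M \<xi> J e
    using assms by (simp add: white_noise_basis_def white_noise_basis_axioms_def)
  note \<alpha> = assms(5)
  let ?d = "divided_derivative \<alpha>" and ?K = "integrands M \<xi> J e \<alpha>"
  have dK: "?d \<in> ?K" using divided_derivative_adjoint[OF \<alpha>] by (simp add: integrands_iff[OF \<alpha>])
  have "L2_inner M ?d ?d \<le> L2_inner M u u" if "u \<in> ?K" for u
    using integrands_norm[OF \<alpha> that] L2_inner_self_nonneg[of M "\<lambda>\<omega>. u \<omega> - ?d \<omega>"] by linarith
  then have "is_arg_min (\<lambda>u. \<integral>\<omega>. (norm (u \<omega>))\<^sup>2 \<partial>M) (\<lambda>u. u \<in> ?K) ?d"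
    unfolding is_arg_min_def L2_inner_self[symmetric] using dK by (blast dest: leD)
  moreover have "AE \<omega> in M. u \<omega> = d_op M \<xi> J e \<alpha> \<omega>"
    if "is_arg_min (\<lambda>u. \<integral>\<omega>. (norm (u \<omega>))\<^sup>2 \<partial>M) (\<lambda>u. u \<in> ?K) u" for u
  proof -
    have u: "u \<in> ?K" and le: "L2_inner M u u \<le> L2_inner M ?d ?d"
      using that dK unfolding is_arg_min_def L2_inner_self[symmetric] by (auto simp: not_less)
    have uL2: "u \<in> L2 M" using u by (simp add: integrands_iff[OF \<alpha>] ext_integral_graph_def)
    have "L2_inner M (\<lambda>\<omega>. u \<omega> - ?d \<omega>) (\<lambda>\<omega>. u \<omega> - ?d \<omega>) = 0"
      using integrands_norm[OF \<alpha> u] le L2_inner_self_nonneg[of M "\<lambda>\<omega>. u \<omega> - ?d \<omega>"] by linarith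
    then have "AE \<omega> in M. u \<omega> - ?d \<omega> = 0"
      by (rule L2_inner_self_eq_0[OF L2_diff[OF uL2 divided_derivative_L2[OF \<alpha>]]])
    with d_op_eq_divided_derivative(2)[OF \<alpha>] show ?thesis by eventually_elim simp
  qed
  ultimately show ?thesis by blast
qed

end
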